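(* For the weak-star convergence of measures on the compact space $\mathbb{S}^1_\infty\times (\widehat K/R)$, we have, as $n\rightarrow+\infty$, $$ \frac{1}{q^2(q-1)} \;q^{-2n} \sum_{v\in R^2_{{\rm prim}}\;:\;\|v\|_\infty= q^n} \Delta_{\mathrm{dir}(v)}\otimes\Delta_{\frac{z_{w_{v}}}{z_v}+R}\;\;\overset{*}\rightharpoonup\;\; \mu_{\mathbb{S}^1_\infty}\otimes \mu_{\widehat K/R}\;. $$ Furthermore, there exists $\tau\in\;]0,\frac{1}{8}]$ such that for all $\epsilon,\delta>0$, this equidistribution holds with a multiplicative error term of the form $1+\operatorname{O}_{\delta}(q^{2n(-\tau+\delta)}\,\|f\|_\epsilon\,\|g\|_\epsilon)$ when evaluated on $(f,g)$ for all $\epsilon$-locally constant maps $f:\mathbb{S}^1_\infty\rightarrow\mathbb{R}$ and $g:\widehat K/R\rightarrow\mathbb{R}$, that is, $$ \frac{1}{q^2(q-1)} \;q^{-2n}\sum_{v\in R^2_{{\rm prim}}\;:\;\|v\|_\infty= q^n} f(\mathrm{dir}(v))\,g\Big(\frac{z_{w_{v}}}{z_v}+R\Big) =\Big(\int_{\mathbb{S}^1_\infty} f\,d\mu_{\mathbb{S}^1_\infty}\Big)\Big(\int_{\widehat K/R} g\,d\mu_{\widehat K/R}\Big)\Big(1+\operatorname{O}_{\delta}\big(q^{2n(-\tau+\delta)}\,\|f\|_\epsilon\,\|g\|_\epsilon\big)\Big). $$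
   Context: Let $\mathbb{F}_q$ be a finite field of order $q$ (a positive power of a prime), $K=\mathbb{F}_q(Y)$, $R=\mathbb{F}_q[Y]$, $\widehat K=\mathbb{F}_q((Y^{-1}))$ the field of formal Laurent series in $Y^{-1}$, and ${\cal O}=\mathbb{F}_q[[Y^{-1}]]$. Let $|\cdot|$ be the nonarchimedean absolute value on $\widehat K$ with $|P|=q^{\deg P}$ for $P\in R$. Endow $\widehat K$ with its Haar measure $\mu_{\widehat K}$ normalized by $\mu_{\widehat K}({\cal O})=1$, the quotient $\widehat K/R$ with the induced measure $\mu_{\widehat K/R}$, and the plane $\widehat K^{\,2}$ with the product measure and the supremum norm $\|(a,b)\|_\infty=\max\{|a|,|b|\}\in q^{\mathbb{Z}}$. Let $\mathbb{S}^1_\infty$ be the (compact-open) unit sphere of $\widehat K^{\,2}$ for this norm, with $\mu_{\mathbb{S}^1_\infty}$ the restriction of the product measure. For $v=(a,b)\in\widehat K^{\,2}-\{0\}$, let $z_v=a$ if $|a|\geq|b|$ and $z_v=b$ otherwise, and let $\mathrm{dir}(v)=\big(a\,Y^{-\log_q\|v\|_\infty},\, b\,Y^{-\log_q\|v\|_\infty}\big)\in\mathbb{S}^1_\infty$ (the direction of $v$). Let $R^2_{\rm prim}=\{(a,b)\in R^2: aR+bR=R\}$. For $v=(a,b)\in R^2_{\rm prim}$, let $w_v=(-y',x')$ where $(x',y')\in R^2$ is a solution of $ax+by=1$ (e.g. the one of smallest supremum norm); the statement does not depend on this choice. $\Delta_x$ denotes the unit Dirac mass at $x$. For a metric space $E$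 and $\epsilon>0$, a bounded map $f:E\to\mathbb{R}$ is $\epsilon$-locally constant if it is constant on every closed ball of radius $\epsilon$, and its $\epsilon$-locally constant norm is $\|f\|_\epsilon=\frac{1}{\epsilon}\sup_{x\in E}|f(x)|$.
   Formalization: The multiplicative error 1+O(...), which fails on rescaling f or when an integral vanishes, is replaced by an additive one: the sum differs from (∫f)(∫g) by at most C_δ q^{2n(-τ+δ)}‖f‖_ε‖g‖_ε for n ≥ N_δ, with C_δ, N_δ independent of ε, f, g. *)

theory Defs
  imports "HOL-Probability.Probability" "HOL-Computational_Algebra.Formal_Laurent_Series"
begin

text \<open>Conventions. The finite field F_q is a type 'a of class {finite, field}, q = CARD('a).
 The completion F_q((Y^-1)) is modelled by the formal Laurent series 'a fls in the
 variable X = Y^-1 (finitely many negative powers of X = finitely many positive powers of Y).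
 R = F_q[Y] is the subring of series with no positive powers of X.\<close>

definition inR :: "'a::{finite,field} fls \<Rightarrow> bool" where
  "inR x \<longleftrightarrow> (\<forall>n>0. fls_nth x n = 0)"

text \<open>absolute value |x| = q^(-v(x)), v = X-adic valuation, so |P| = q^(deg P) for P in R\<close>
definition kabs :: "'a::{finite,field} fls \<Rightarrow> real" where
  "kabs x = (if x = 0 then 0 else real CARD('a) powi (- fls_subdegree x))"

definition knorm :: "'a::{finite,field} fls \<times> 'a fls \<Rightarrow> real" where
  "knorm v = max (kabs (fst v)) (kabs (snd v))"

definition sphere1 :: "('a::{finite,field} fls \<times> 'a fls) set" where
  "sphere1 = {v. knorm v = 1}"

definition Rprim :: "('a::{finite,field} fls \<times> 'a fls) set" where
  "Rprim = {(a,b). inR a \<and> inR b \<and> (\<exists>x y. inR x \<and> inR y \<and> a * x + b * y = 1)}"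

text \<open>direction: (a Y^(-k), b Y^(-k)) with k = log_q ||v||; note Y^(-k) = X^k\<close>
definition dir :: "'a::{finite,field} fls \<times> 'a fls \<Rightarrow> 'a fls \<times> 'a fls" where
  "dir v = (let k = \<lfloor>log (real CARD('a)) (knorm v)\<rfloor> in
              (fst v * fls_X_intpow k, snd v * fls_X_intpow k))"

definition zz :: "'a::{finite,field} fls \<times> 'a fls \<Rightarrow> 'a fls" where
  "zz v = (if kabs (fst v) \<ge> kabs (snd v) then fst v else snd v)"

definition ww :: "'a::{finite,field} fls \<times> 'a fls \<Rightarrow> 'a fls \<times> 'a fls" where
  "ww v = (let (x', y') = (SOME p. inR (fst p) \<and> inR (snd p) \<and>
                                   fst v * fst p + snd v * snd p = 1)
           in (- y', x'))"

text \<open>Haar measure: O = F_q[[Y^-1]] is identified with coefficient sequences, Haar measure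
 with mu(O)=1 being the infinite product of uniform measures on F_q.\<close>
definition Oemb :: "(nat \<Rightarrow> 'a::{finite,field}) \<Rightarrow> 'a fls" where
  "Oemb c = fps_to_fls (Abs_fps c)"

definition haarO :: "(nat \<Rightarrow> 'a::{finite,field}) measure" where
  "haarO = PiM UNIV (\<lambda>_. uniform_count_measure (UNIV :: 'a set))"

text \<open>integral over the unit sphere S^1_infty (subset of O^2: max(|a|,|b|)=1 iff a_0 or b_0 nonzero)\<close>
definition int_sphere :: "('a::{finite,field} fls \<times> 'a fls \<Rightarrow> real) \<Rightarrow> real" where
  "int_sphere f = (\<integral>p. (if fst p 0 \<noteq> 0 \<or> snd p 0 \<noteq> 0 then f (Oemb (fst p), Oemb (snd p)) else 0)
                     \<partial>(haarO \<Otimes>\<^sub>M haarO))"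

text \<open>functions on K^/R are R-periodic functions on K^; integral over the fundamental
 domain {|x|<1} = Y^-1 O = X O, whose Haar measure is 1/q\<close>
definition Rperiodic :: "('a::{finite,field} fls \<Rightarrow> real) \<Rightarrow> bool" where
  "Rperiodic g \<longleftrightarrow> (\<forall>x r. inR r \<longrightarrow> g (x + r) = g x)"

definition int_quot :: "('a::{finite,field} fls \<Rightarrow> real) \<Rightarrow> real" where
  "int_quot g = (1 / real CARD('a)) * (\<integral>c. g (fls_X * Oemb c) \<partial>haarO)"

definition int_prod :: "('a::{finite,field} fls \<times> 'a fls \<Rightarrow> 'a fls \<Rightarrow> real) \<Rightarrow> real" where
  "int_prod F = (1 / real CARD('a)) *
     (\<integral>p. (if fst (fst p) 0 \<noteq> 0 \<or> snd (fst p) 0 \<noteq> 0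
            then F (Oemb (fst (fst p)), Oemb (snd (fst p))) (fls_X * Oemb (snd p)) else 0)
        \<partial>((haarO \<Otimes>\<^sub>M haarO) \<Otimes>\<^sub>M haarO))"

definition cont_SQ :: "('a::{finite,field} fls \<times> 'a fls \<Rightarrow> 'a fls \<Rightarrow> real) \<Rightarrow> bool" where
  "cont_SQ F \<longleftrightarrow> (\<forall>u x r. inR r \<longrightarrow> F u (x + r) = F u x) \<and>
     (\<forall>u\<in>sphere1. \<forall>x. \<forall>\<eta>>0. \<exists>\<rho>>0. \<forall>u'\<in>sphere1. \<forall>x'.
        knorm (fst u - fst u', snd u - snd u') \<le> \<rho> \<and> kabs (x - x') \<le> \<rho> \<longrightarrow>
        \<bar>F u' x' - F u x\<bar> < \<eta>)"

definition loc_const_S :: "real \<Rightarrow> ('a::{finite,field} fls \<times> 'a fls \<Rightarrow> real) \<Rightarrow> bool" where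
  "loc_const_S \<epsilon> f \<longleftrightarrow> (\<exists>B. \<forall>v\<in>sphere1. \<bar>f v\<bar> \<le> B) \<and>
     (\<forall>u\<in>sphere1. \<forall>v\<in>sphere1. knorm (fst u - fst v, snd u - snd v) \<le> \<epsilon> \<longrightarrow> f u = f v)"

definition lcnorm_S :: "real \<Rightarrow> ('a::{finite,field} fls \<times> 'a fls \<Rightarrow> real) \<Rightarrow> real" where
  "lcnorm_S \<epsilon> f = (1 / \<epsilon>) * (SUP v\<in>sphere1. \<bar>f v\<bar>)"

definition loc_const_Q :: "real \<Rightarrow> ('a::{finite,field} fls \<Rightarrow> real) \<Rightarrow> bool" where
  "loc_const_Q \<epsilon> g \<longleftrightarrow> Rperiodic g \<and> (\<exists>B. \<forall>x. \<bar>g x\<bar> \<le> B) \<and>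
     (\<forall>x y. kabs (x - y) \<le> \<epsilon> \<longrightarrow> g x = g y)"

definition lcnorm_Q :: "real \<Rightarrow> ('a::{finite,field} fls \<Rightarrow> real) \<Rightarrow> real" where
  "lcnorm_Q \<epsilon> g = (1 / \<epsilon>) * (SUP x. \<bar>g x\<bar>)"

definition Lambda :: "nat \<Rightarrow> ('a::{finite,field} fls \<times> 'a fls \<Rightarrow> 'a fls \<Rightarrow> real) \<Rightarrow> real" where
  "Lambda n F = (1 / (real CARD('a) ^ 2 * (real CARD('a) - 1))) * real CARD('a) powi (- 2 * int n) *
     (\<Sum>v\<in>{v\<in>Rprim. knorm v = real CARD('a) ^ n}. F (dir v) (zz (ww v) / zz v))"

end

theory Submission
  imports Defs
begin

text \<open>
  A primitive vector \<open>(a, b)\<close> with \<open>\<bar>a\<bar> \<ge> \<bar>b\<bar>\<close> is the first row of a unique matrix \<open>(a, b; c, d)\<close> of determinant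
  one over \<open>F\<^sub>q[Y]\<close> with \<open>\<bar>c\<bar> < \<bar>a\<bar>\<close>, and \<open>z\<^bsub>w\<^esub> / z\<^bsub>v\<^esub>\<close> is \<open>c / a\<close> modulo \<open>R\<close>; the case \<open>\<bar>a\<bar> < \<bar>b\<bar>\<close> is symmetric.
  So one has to show that the leading digits \<open>u\<close> of \<open>a\<close>, the direction \<open>b / a\<close> and \<open>c / a\<close> are jointly
  equidistributed up to level \<open>m\<close>, with an error that saves a power of \<open>q\<^sup>n\<close>. A test function is split into three parts.

  (1) Mean zero in \<open>u\<close>. Matrices are sorted by cosets of the congruence subgroup of level \<open>m\<close>, and the square of
  the sum is bounded by a sum over pairs of cosets in the same orbit, i.e. over the matrices \<open>(p, q; r, s)\<close> that move
  one coset to another. Such a matrix multiplies \<open>u\<close> by \<open>p + q \<theta>\<close>, and when \<open>q\<close> is large this runs uniformly through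
  the units, so the contribution vanishes. The few remaining matrices give square root cancellation.

  (2) Independent of \<open>u\<close> and mean zero in \<open>c / a\<close>. Fixing the best rational approximation \<open>r / s\<close> of \<open>b / a\<close>, one
  factors out a matrix with first row \<open>(s, r)\<close>. In the remaining matrix \<open>(t, e; c', d')\<close> the entry \<open>t\<close> runs through
  complete residue systems modulo \<open>e\<close> while \<open>c / a\<close> is \<open>d' / e\<close> up to a negligible error.

  (3) Depending on \<open>b / a\<close> only. Reduced fractions of given denominator degree are exactly equidistributed.
\<close>

section \<open>Balls and digits in the field of Laurent series\<close>

text \<open>Ultrametric exactness carries the argument: balls are cosets, so polynomials in a ball
  are counted without error, and a function constant at level \<open>m\<close> depends on finitely
  many digits. Part (1) plays the role of a spectral gap. By
  \<open>(a, b; c, d) = (1, 0; c/a, 1) diag(a, 1/a) (1, b/a; 0, 1)\<close>, the matrices with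
  \<open>b/a\<close> fixed modulo \<open>X^m\<close> are points of one orbit of cosets with trivial
  stabilizers. The sum over a single orbit is hard to reach directly, but every orbit contributes a
  nonnegative term to the second moment, so all of them may be included, and then
  \<open>(u, c/a)\<close> ranges over a full box. The explicit count in part (2) handles functions
  of \<open>b/a\<close> and \<open>c/a\<close> alone; this is why the mean over \<open>u\<close> is
  separated beforehand. With Q the order of the field, the total error is about
  \<open>Q^(n + 5m)\<close> against \<open>Q^(2n)\<close>. A scale \<open>\<epsilon>\<close> near
  \<open>Q^(-m)\<close> makes the two norms supply \<open>Q^(2m)\<close>. For
  \<open>n \<ge> 8m\<close> one has \<open>Q^(5m - n) \<le> Q^(2m - n/4)\<close>; for
  \<open>n < 8m\<close> the right side exceeds 1 and the trivial bound suffices. So the rate is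
  \<open>n/4 = 2n * (1/8)\<close>.\<close>

definition vball :: "int \<Rightarrow> 'a::{finite,field} fls set" where
  "vball k = {x. \<forall>i<k. fls_nth x i = 0}"

text \<open>A complement of \<open>vball k\<close>: every series is uniquely a sum of a member of
  \<open>low k\<close> and one of \<open>vball k\<close>, and \<open>cutoff k\<close> is the
  projection to the former. The polynomial ring is \<open>low 1\<close>, and
  \<open>digits j k\<close> represents \<open>vball j\<close> modulo \<open>vball k\<close>.\<close>

definition low :: "int \<Rightarrow> 'a::{finite,field} fls set" where
  "low k = {x. \<forall>i\<ge>k. fls_nth x i = 0}"

definition digits :: "int \<Rightarrow> int \<Rightarrow> 'a::{finite,field} fls set" where
  "digits j k = vball j \<inter> low k"

definition cutoff :: "int \<Rightarrow> 'a::{finite,field} fls \<Rightarrow> 'a fls" where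
  "cutoff k x = Abs_fls (\<lambda>i. if i < k then fls_nth x i else 0)"

lemma nth_cutoff [simp]: "fls_nth (cutoff k x) i = (if i < k then fls_nth x i else 0)"
proof -
  have "\<forall>n<fls_subdegree x. (if n < k then fls_nth x n else 0) = 0"
    by simp
  then show ?thesis
    unfolding cutoff_def by (subst nth_Abs_fls_lower_bound) auto
qed

lemma inR_iff_low: "inR x \<longleftrightarrow> x \<in> low 1"
  by (auto simp: inR_def low_def)

lemma vball_iff: "x \<in> vball k \<longleftrightarrow> x = 0 \<or> k \<le> fls_subdegree x"
proof
  assume "x \<in> vball k"
  then show "x = 0 \<or> k \<le> fls_subdegree x"
    by (cases "x = 0") (auto simp: vball_def intro: fls_subdegree_geI)
qed (auto simp: vball_def)

lemma vball_0 [simp]: "0 \<in> vball k" by (simp add: vball_iff)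
lemma vball_add: "x \<in> vball k \<Longrightarrow> y \<in> vball k \<Longrightarrow> x + y \<in> vball k"
  by (auto simp: vball_def)
lemma vball_diff: "x \<in> vball k \<Longrightarrow> y \<in> vball k \<Longrightarrow> x - y \<in> vball k"
  by (auto simp: vball_def)
lemma vball_uminus: "x \<in> vball k \<Longrightarrow> - x \<in> vball k"
  by (auto simp: vball_def)
lemma vball_uminus_iff [simp]: "- x \<in> vball k \<longleftrightarrow> x \<in> vball k"
  by (auto simp: vball_def)
lemma vball_mono: "x \<in> vball k \<Longrightarrow> j \<le> k \<Longrightarrow> x \<in> vball j"
  by (auto simp: vball_def)
lemma vball_minus_commute: "x - y \<in> vball k \<longleftrightarrow> y - x \<in> vball k"
  by (metis minus_diff_eq vball_uminus_iff)
lemma vball_cong: "x - y \<in> vball k \<Longrightarrow> x \<in> vball k \<longleftrightarrow> y \<in> vball k"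
  using vball_add[of "x - y" k y] vball_diff[of x k "x - y"] by auto
lemma vball_diff_trans: "x - y \<in> vball k \<Longrightarrow> y - z \<in> vball k \<Longrightarrow> x - z \<in> vball k"
  using vball_add[of "x - y" k "y - z"] by simp

lemma vball_mult: "x \<in> vball j \<Longrightarrow> y \<in> vball k \<Longrightarrow> x * y \<in> vball (j + k)"
  by (cases "x = 0 \<or> y = 0") (auto simp: vball_iff)

lemma vball_mult_le: "x \<in> vball j \<Longrightarrow> y \<in> vball k \<Longrightarrow> l \<le> j + k \<Longrightarrow> x * y \<in> vball l"
  by (rule vball_mono[OF vball_mult])

lemma fls_subdegree_divide: "x \<noteq> 0 \<Longrightarrow> y \<noteq> 0 \<Longrightarrow> fls_subdegree (x / y :: 'a::field fls) = fls_subdegree x - fls_subdegree y"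
  by (rule fls_divide_subdegree) auto

lemma vball_divide_iff: "y \<noteq> 0 \<Longrightarrow> x / y \<in> vball k \<longleftrightarrow> x \<in> vball (k + fls_subdegree y)"
  by (cases "x = 0") (auto simp: vball_iff fls_subdegree_divide)

lemma vball_mult_iff: "y \<noteq> 0 \<Longrightarrow> y * x \<in> vball k \<longleftrightarrow> x \<in> vball (k - fls_subdegree y)"
  by (cases "x = 0") (auto simp: vball_iff)

lemma one_vball [simp]: "1 \<in> vball k \<longleftrightarrow> k \<le> 0"
  by (auto simp: vball_iff)

lemma low_0 [simp]: "0 \<in> low k" by (simp add: low_def)
lemma low_add: "x \<in> low k \<Longrightarrow> y \<in> low k \<Longrightarrow> x + y \<in> low k"
  by (auto simp: low_def)
lemma low_diff: "x \<in> low k \<Longrightarrow> y \<in> low k \<Longrightarrow> x - y \<in> low k"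
  by (auto simp: low_def)
lemma low_uminus: "x \<in> low k \<Longrightarrow> - x \<in> low k"
  by (auto simp: low_def)

lemma low_vball_eq_0: "x \<in> low k \<Longrightarrow> x \<in> vball k \<Longrightarrow> x = 0"
  unfolding low_def vball_def by (intro fls_eqI) (metis (mono_tags) mem_Collect_eq linorder_not_le fls_zero_nth)

lemma cutoff_low [simp]: "cutoff k x \<in> low k" by (simp add: low_def)
lemma cutoff_vball: "x \<in> vball j \<Longrightarrow> cutoff k x \<in> vball j" by (simp add: vball_def)
lemma cutoff_digits: "x \<in> vball j \<Longrightarrow> cutoff k x \<in> digits j k" by (simp add: digits_def cutoff_vball)
lemma diff_cutoff: "x - cutoff k x \<in> vball k" by (simp add: vball_def)
lemma cutoff_diff: "cutoff k x - x \<in> vball k" by (simp add: vball_def)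

lemma cutoff_unique: "y \<in> low k \<Longrightarrow> x - y \<in> vball k \<Longrightarrow> cutoff k x = y"
  using low_vball_eq_0[of "cutoff k x - y" k] low_diff[of "cutoff k x" k y]
    vball_diff_trans[of "cutoff k x" x k y] cutoff_diff[of k x] by simp

lemma cutoff_eq_iff: "cutoff k x = cutoff k y \<longleftrightarrow> x - y \<in> vball k"
proof
  assume "cutoff k x = cutoff k y"
  then show "x - y \<in> vball k"
    using vball_diff_trans[of x "cutoff k x" k y] diff_cutoff[of x k] cutoff_diff[of k y] by simp
next
  assume "x - y \<in> vball k"
  then show "cutoff k x = cutoff k y"
    by (intro cutoff_unique cutoff_low) (rule vball_diff_trans[OF _ diff_cutoff])
qed

lemma cutoff_id: "x \<in> low k \<Longrightarrow> cutoff k x = x"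
  by (rule cutoff_unique) auto

lemma inR_0 [simp]: "inR 0" by (simp add: inR_def)
lemma inR_1 [simp]: "inR 1" by (simp add: inR_def)
lemma inR_add: "inR x \<Longrightarrow> inR y \<Longrightarrow> inR (x + y)" by (simp add: inR_def)
lemma inR_diff: "inR x \<Longrightarrow> inR y \<Longrightarrow> inR (x - y)" by (simp add: inR_def)
lemma inR_uminus: "inR x \<Longrightarrow> inR (- x)" by (simp add: inR_def)
lemma inR_const [simp]: "inR (fls_const c)" by (simp add: inR_def)
lemma inR_cutoff [simp]: "inR (cutoff 1 x)" by (simp add: inR_iff_low)
lemma inR_subdegree_le: "inR x \<Longrightarrow> fls_subdegree x \<le> 0"
  using nth_fls_subdegree_zero_iff[of x] by (cases "x = 0") (auto simp: inR_def not_less[symmetric])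
text \<open>Discreteness of the polynomial ring. Every rigidity and uniqueness argument below ends
  here: an expression in polynomials is shown to have absolute value below 1, hence
  vanishes.\<close>

lemma inR_vball1: "inR x \<Longrightarrow> x \<in> vball 1 \<Longrightarrow> x = 0"
  by (simp add: inR_iff_low low_vball_eq_0)

lemma inR_mult: assumes "inR x" "inR y" shows "inR (x * y)"
proof -
  have "fls_nth (x * y) n = 0" if n: "n > 0" for n
  proof -
    have "(\<Sum>i=fls_subdegree x..n - fls_subdegree y. fls_nth x i * fls_nth y (n - i)) = 0"
    proof (rule sum.neutral, rule ballI)
      fix i
      show "fls_nth x i * fls_nth y (n - i) = 0"
        using assms n by (cases "i > 0") (auto simp: inR_def)
    qed
    then show ?thesis by (simp add: fls_times_nth(2))
  qed
  then show ?thesis by (simp add: inR_def)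
qed

lemmas inR_intros = inR_0 inR_1 inR_add inR_diff inR_uminus inR_const inR_cutoff inR_mult

lemma digits_bij:
  "bij_betw (\<lambda>x. restrict (fls_nth x) {j..<k}) (digits j k :: 'a::{finite,field} fls set) ({j..<k} \<rightarrow>\<^sub>E UNIV)"
proof (rule bij_betwI')
  fix x y :: "'a fls" assume xy: "x \<in> digits j k" "y \<in> digits j k"
  show "(restrict (fls_nth x) {j..<k} = restrict (fls_nth y) {j..<k}) = (x = y)"
  proof
    assume e: "restrict (fls_nth x) {j..<k} = restrict (fls_nth y) {j..<k}"
    show "x = y"
    proof (rule fls_eqI)
      fix n show "fls_nth x n = fls_nth y n"
      proof (cases "n \<in> {j..<k}")
        case True then show ?thesis using fun_cong[OF e, of n] by simp
      next
        case False then show ?thesis using xy by (auto simp: digits_def vball_def low_def)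
      qed
    qed
  qed simp
next
  fix f assume f: "f \<in> {j..<k} \<rightarrow>\<^sub>E (UNIV::'a set)"
  define x where "x = Abs_fls (\<lambda>i. if i \<in> {j..<k} then f i else 0)"
  have "\<forall>n<j. (if n \<in> {j..<k} then f n else 0) = 0" by simp
  then have nx: "fls_nth x i = (if i \<in> {j..<k} then f i else 0)" for i
    unfolding x_def by (subst nth_Abs_fls_lower_bound[where N=j]) auto
  have "x \<in> digits j k" by (auto simp: digits_def vball_def low_def nx)
  moreover have "f = restrict (fls_nth x) {j..<k}"
    using f by (auto simp: fun_eq_iff nx restrict_def)
  ultimately show "\<exists>x\<in>digits j k. f = restrict (fls_nth x) {j..<k}" by blast
qed auto

lemma finite_digits [simp]: "finite (digits j k)"
  using bij_betw_finite[OF digits_bij] by (simp add: finite_PiE)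

lemma card_digits: "card (digits j k :: 'a::{finite,field} fls set) = CARD('a) ^ nat (k - j)"
  using bij_betw_same_card[OF digits_bij[of j k, where 'a='a]] by (simp add: card_PiE)

text \<open>Below position \<open>l\<close> the coefficients of \<open>y\<close> are forced by
  \<open>x\<close>, and those from \<open>l\<close> to \<open>k - 1\<close> are free. For
  \<open>k = 1\<close> this is the exact count of polynomials in a ball.\<close>

lemma low_near_eq:
  assumes "l \<le> k" shows "{y \<in> low k. y - x \<in> vball l} = (+) (cutoff k x) ` digits l k"
proof (intro set_eqI iffI)
  fix y assume y: "y \<in> {y \<in> low k. y - x \<in> vball l}"
  have "y - cutoff k x \<in> vball l"
    using y vball_diff_trans[of y x l "cutoff k x"] vball_mono[OF diff_cutoff assms] by auto
  then have "y - cutoff k x \<in> digits l k" using y by (auto simp: digits_def intro: low_diff)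
  then show "y \<in> (+) (cutoff k x) ` digits l k" by (intro image_eqI[of _ _ "y - cutoff k x"]) auto
next
  fix y assume "y \<in> (+) (cutoff k x) ` digits l k"
  then obtain z where z: "z \<in> digits l k" "y = cutoff k x + z" by auto
  have "y - x = (cutoff k x - x) + z" using z by simp
  also have "\<dots> \<in> vball l" using z vball_mono[OF cutoff_diff assms] by (auto simp: digits_def intro!: vball_add)
  finally show "y \<in> {y \<in> low k. y - x \<in> vball l}" using z by (auto simp: digits_def intro!: low_add)
qed

lemma card_low_near:
  fixes x :: "'a::{finite,field} fls"
  assumes "l \<le> k" shows "card {y \<in> low k. y - x \<in> vball l} = CARD('a) ^ nat (k - l)"
  by (simp add: low_near_eq[OF assms] card_image card_digits)

lemma finite_low_near: "l \<le> k \<Longrightarrow> finite {y \<in> low k. y - x \<in> vball l}"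
  by (simp add: low_near_eq)

lemma card_field_ge_2: "CARD('a::{finite,field}) \<ge> 2"
proof -
  have "card {0::'a, 1} \<le> CARD('a)" by (rule card_mono) auto
  then show ?thesis by simp
qed

section \<open>Counting reduced fractions\<close>

definition Rdeg :: "nat \<Rightarrow> 'a::{finite,field} fls set" where
  "Rdeg n = {a. inR a \<and> a \<noteq> 0 \<and> fls_subdegree a = - int n}"

definition monic :: "'a::{finite,field} fls \<Rightarrow> bool" where
  "monic a \<longleftrightarrow> fls_nth a (fls_subdegree a) = 1"

definition Rmonic :: "nat \<Rightarrow> 'a::{finite,field} fls set" where
  "Rmonic n = {a \<in> Rdeg n. monic a}"

definition cop :: "'a::{finite,field} fls \<Rightarrow> 'a fls \<Rightarrow> bool" where
  "cop a b \<longleftrightarrow> (\<exists>x y. inR x \<and> inR y \<and> a * x + b * y = 1)"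

text \<open>In the application \<open>v = 0\<close> encodes |b| <= |a| and \<open>v = 1\<close>
  encodes |b| < |a|; the two values treat the two halves of the plane uniformly.\<close>

definition frac_pairs :: "int \<Rightarrow> nat \<Rightarrow> ('a::{finite,field} fls \<times> 'a fls) set" where
  "frac_pairs v n = {(a, b). a \<in> Rdeg n \<and> inR b \<and> b / a \<in> vball v}"

definition red_pairs :: "int \<Rightarrow> nat \<Rightarrow> ('a::{finite,field} fls \<times> 'a fls) set" where
  "red_pairs v n = {(a, b) \<in> frac_pairs v n. cop a b}"

lemma Rdeg_eq: "(Rdeg n :: 'a::{finite,field} fls set) = digits (- int n) 1 - digits (1 - int n) 1"
  by (auto simp: Rdeg_def digits_def vball_iff inR_iff_low)

lemma finite_Rdeg [simp]: "finite (Rdeg n)"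
  by (simp add: Rdeg_eq)

lemma card_Rdeg: "real (card (Rdeg n :: 'a::{finite,field} fls set)) = (real CARD('a) - 1) * real CARD('a) ^ n"
proof -
  have sub: "digits (1 - int n) 1 \<subseteq> (digits (- int n) 1 :: 'a fls set)"
    by (auto simp: digits_def intro: vball_mono)
  have "nat (1 - - int n) = Suc n" "nat (1 - (1 - int n)) = n" by auto
  then have "card (Rdeg n :: 'a fls set) = CARD('a) ^ Suc n - CARD('a) ^ n"
    unfolding Rdeg_eq by (subst card_Diff_subset[OF _ sub]) (auto simp: card_digits)
  moreover have "CARD('a) ^ n \<le> CARD('a) ^ Suc n" by simp
  ultimately show ?thesis by (simp add: of_nat_diff algebra_simps)
qed

lemma card_Rmonic: "card (Rmonic n :: 'a::{finite,field} fls set) = CARD('a) ^ n"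
proof -
  \<comment> \<open>Being monic of degree \<open>n\<close> means being closer to \<open>Y^n\<close>,
    which is \<open>fls_X_intpow (- int n)\<close>, than \<open>Y^n\<close> is to 0; so this too is
    the count of a ball.\<close>
  have "(Rmonic n :: 'a fls set) = {y \<in> low 1. y - fls_X_intpow (- int n) \<in> vball (1 - int n)}"
  proof (intro set_eqI iffI)
    fix a :: "'a fls" assume a: "a \<in> Rmonic n"
    then have "fls_nth (a - fls_X_intpow (- int n)) i = 0" if "i < 1 - int n" for i
      using that by (cases "i = - int n") (auto simp: Rmonic_def Rdeg_def monic_def)
    then show "a \<in> {y \<in> low 1. y - fls_X_intpow (- int n) \<in> vball (1 - int n)}"
      using a by (auto simp: Rmonic_def Rdeg_def vball_def inR_iff_low)
  next
    fix a :: "'a fls" assume a: "a \<in> {y \<in> low 1. y - fls_X_intpow (- int n) \<in> vball (1 - int n)}"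
    have nth: "fls_nth a i = fls_nth (fls_X_intpow (- int n)) i" if "i < 1 - int n" for i
      using a that by (auto simp: vball_def)
    have 1: "fls_nth a (- int n) = 1" using nth[of "- int n"] by simp
    have "fls_subdegree a = - int n"
      by (rule fls_subdegree_eqI) (use 1 nth in auto)
    then show "a \<in> Rmonic n" using 1 a by (auto simp: Rmonic_def Rdeg_def monic_def inR_iff_low)
  qed
  then show ?thesis by (simp add: card_low_near)
qed

lemma finite_Rmonic [simp]: "finite (Rmonic n)"
  by (simp add: Rmonic_def)

section \<open>Coprime polynomials and monic greatest common divisors\<close>

lemma lead_mult:
  "fls_nth (x * y :: 'a::field fls) (fls_subdegree x + fls_subdegree y) = fls_nth x (fls_subdegree x) * fls_nth y (fls_subdegree y)"
  by (rule fls_times_base)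

lemma inR_subdegree_0: assumes "inR w" "fls_subdegree w = 0" shows "w = fls_const (fls_nth w 0)"
proof (rule fls_eqI)
  fix n show "fls_nth w n = fls_nth (fls_const (fls_nth w 0)) n"
    using assms by (cases "n = 0"; cases "n > 0") (auto simp: inR_def)
qed

lemma monic_unit:
  assumes "inR w" "inR w'" "w * w' = 1" "monic s" "monic (s * w)"
  shows "w = 1"
proof -
  have nz: "w \<noteq> 0" "w' \<noteq> 0" using assms(3) by auto
  then have "fls_subdegree w + fls_subdegree w' = 0"
    using fls_subdegree_mult[of w w'] assms(3) by simp
  then have 0: "fls_subdegree w = 0"
    using inR_subdegree_le[OF assms(1)] inR_subdegree_le[OF assms(2)] by simp
  have "s \<noteq> 0" using assms(4) by (auto simp: monic_def)
  then have "fls_nth w 0 = 1"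
    using lead_mult[of s w] assms(4,5) nz 0 by (auto simp: monic_def)
  then show ?thesis using inR_subdegree_0[OF assms(1) 0] by simp
qed

text \<open>Euclid's lemma: \<open>s\<close> divides \<open>s' * r\<close> and is coprime to
  \<open>r\<close>, so it divides \<open>s'\<close>; the Bezout relation yields the
  quotient.\<close>

lemma cop_dvd_of_proportional:
  assumes "cop s r" "s * r' = s' * r" "inR s'" "inR r'"
  obtains w where "inR w" "s' = s * w"
proof -
  obtain x y where xy: "inR x" "inR y" "s * x + r * y = 1" using assms(1) by (auto simp: cop_def)
  have "s' = s' * (s * x + r * y)" using xy by simp
  also have "\<dots> = s * (s' * x) + (s' * r) * y" by (simp add: algebra_simps)
  also have "\<dots> = s * (s' * x + r' * y)" using assms(2) by (simp add: algebra_simps flip: assms(2))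
  finally have "s' = s * (s' * x + r' * y)" .
  moreover have "inR (s' * x + r' * y)" using xy assms by (auto intro!: inR_intros)
  ultimately show ?thesis using that by blast
qed

lemma cop_proportional_eq:
  assumes "cop s r" "cop s' r'" "s * r' = s' * r" "inR s" "inR r" "inR s'" "inR r'" "monic s" "monic s'"
  shows "s = s'" "r = r'"
proof -
  obtain w where w: "inR w" "s' = s * w" using cop_dvd_of_proportional[OF assms(1,3)] assms by blast
  have "s' * r = s * r'" using assms(3) by simp
  then obtain w' where w': "inR w'" "s = s' * w'" using cop_dvd_of_proportional[OF assms(2)] assms by blast
  have s0: "s \<noteq> 0" using assms(8) by (auto simp: monic_def)
  have "s * (w * w') = s * 1" using w w' by (metis mult.assoc mult_1_right)
  then have "w * w' = 1" using s0 by simp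
  then show "s = s'" using monic_unit[OF w(1) w'(1)] assms w by simp
  then show "r = r'" using assms(3) s0 by simp
qed

text \<open>An element \<open>g\<close> of least degree in the ideal generated by \<open>a\<close>
  and \<open>b\<close> divides every member \<open>z\<close>: the polynomial part of
  \<open>z / g\<close> is a quotient whose remainder again lies in the ideal and has smaller degree.
  Scaling by the leading coefficient makes the divisor monic, so that the factorization is
  unique.\<close>

lemma gcd_factor:
  assumes a: "inR a" "a \<noteq> 0" and b: "inR b"
  obtains g a' b' where "inR g" "monic g" "inR a'" "inR b'" "a = g * a'" "b = g * b'" "cop a' b'"
proof -
  define I where "I = {z. z \<noteq> 0 \<and> (\<exists>x y. inR x \<and> inR y \<and> z = a * x + b * y)}"
  have lin_a: "\<exists>x y. inR x \<and> inR y \<and> a = a * x + b * y"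
    by (rule exI[of _ 1], rule exI[of _ 0]) simp
  have lin_b: "\<exists>x y. inR x \<and> inR y \<and> b = a * x + b * y"
    by (rule exI[of _ 0], rule exI[of _ 1]) simp
  have "a \<in> I" using a lin_a by (simp add: I_def)
  then obtain g where g: "g \<in> I" and gmin: "\<And>z. z \<in> I \<Longrightarrow> nat (- fls_subdegree g) \<le> nat (- fls_subdegree z)"
    using ex_has_least_nat[of "\<lambda>z. z \<in> I" a "\<lambda>z. nat (- fls_subdegree z)"] by blast
  obtain x y where xy: "inR x" "inR y" "g = a * x + b * y" and g0: "g \<noteq> 0" using g by (auto simp: I_def)
  have gR: "inR g" using xy a b by (auto intro: inR_intros)
  have quot: "\<exists>c. inR c \<and> z = g * c" if z: "\<exists>x y. inR x \<and> inR y \<and> z = a * x + b * y" for z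
  proof -
    define c where "c = cutoff 1 (z / g)"
    define r where "r = z - g * c"
    obtain x' y' where xy': "inR x'" "inR y'" "z = a * x' + b * y'" using z by auto
    have "r / g = z / g - c" using g0 by (simp add: r_def field_simps)
    then have rg: "r / g \<in> vball 1" by (simp add: c_def diff_cutoff)
    have "r = a * (x' - x * c) + b * (y' - y * c)" by (simp add: r_def xy'(3) xy(3) algebra_simps)
    moreover have "inR (x' - x * c)" "inR (y' - y * c)"
      using xy xy' by (auto simp: c_def intro!: inR_intros)
    ultimately have lin: "\<exists>x y. inR x \<and> inR y \<and> r = a * x + b * y" by blast
    then have rR: "inR r" using a b by (auto intro: inR_intros)
    have "r = 0"
    proof (rule ccontr)
      assume r0: "r \<noteq> 0"
      then have "r \<in> I" using lin by (auto simp: I_def)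
      then have "nat (- fls_subdegree g) \<le> nat (- fls_subdegree r)" by (rule gmin)
      moreover have "fls_subdegree r \<ge> 1 + fls_subdegree g"
        using rg r0 g0 by (auto simp: vball_iff fls_subdegree_divide)
      ultimately show False using inR_subdegree_le[OF rR] by simp
    qed
    then have "z = g * c" by (simp add: r_def)
    moreover have "inR c" by (simp add: c_def)
    ultimately show ?thesis by blast
  qed
  define l where "l = fls_nth g (fls_subdegree g)"
  have l0: "l \<noteq> 0" using g0 by (simp add: l_def)
  define g' where "g' = g * fls_const (inverse l)"
  have ll: "fls_const l * fls_const (inverse l) = 1" using l0 by (simp add: fls_const_mult_const)
  have gg': "g = g' * fls_const l" using ll by (simp add: g'_def mult.assoc mult.commute)
  obtain c where c: "inR c" "a = g * c"
    using quot[OF lin_a] by blast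
  obtain d where d: "inR d" "b = g * d"
    using quot[OF lin_b] by blast
  have g'R: "inR g'" using gR by (auto simp: g'_def intro: inR_intros)
  have "fls_subdegree g' = fls_subdegree g" using g0 l0 by (simp add: g'_def)
  then have "monic g'" using lead_mult[of g "fls_const (inverse l)"] l0
    unfolding monic_def g'_def by (simp add: l_def)
  moreover have "cop (fls_const l * c) (fls_const l * d)"
  proof -
    have "g * (c * x + d * y) = g * 1" using xy c d by (simp add: algebra_simps)
    then have "c * x + d * y = 1" using g0 by simp
    then have "fls_const l * c * (fls_const (inverse l) * x) + fls_const l * d * (fls_const (inverse l) * y) = 1"
      using ll by (simp add: algebra_simps)
    then show ?thesis using xy unfolding cop_def by (meson inR_mult inR_const)
  qed
  moreover have "inR (fls_const l * c)" "inR (fls_const l * d)" using c d by (auto intro: inR_intros)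
  moreover have "a = g' * (fls_const l * c)" "b = g' * (fls_const l * d)" using c d gg' by (auto simp: mult.assoc)
  ultimately show ?thesis using that g'R by blast
qed

section \<open>Averages over all fractions and over reduced fractions of given denominator
  degree\<close>

lemma Rdeg_vball_divide: "a \<in> Rdeg n \<Longrightarrow> b / a \<in> vball v \<longleftrightarrow> b \<in> vball (v - int n)"
  by (auto simp: Rdeg_def vball_divide_iff)

lemma finite_frac_pairs: "finite (frac_pairs v n)"
proof (rule finite_subset)
  show "frac_pairs v n \<subseteq> Rdeg n \<times> digits (v - int n) 1"
    by (auto simp: frac_pairs_def Rdeg_vball_divide digits_def inR_iff_low)
qed simp

lemma finite_red_pairs: "finite (red_pairs v n)"
  using finite_frac_pairs by (rule rev_finite_subset) (auto simp: red_pairs_def)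

lemma frac_pairs_Sigma: "frac_pairs v n = (SIGMA a:Rdeg n. {b. inR b \<and> b / a \<in> vball v})"
  by (auto simp: frac_pairs_def)

text \<open>For fixed \<open>a\<close>, the numerators \<open>b\<close> for which
  \<open>b / a\<close> has prescribed digits below \<open>m\<close> are the polynomials in a ball of
  radius \<open>|a| CARD('a)^(-m)\<close>. Their number does not depend on the digits as soon as
  \<open>m \<le> n + 1\<close>.\<close>

lemma frac_sum:
  fixes h :: "'a::{finite,field} fls \<Rightarrow> real"
  assumes h: "\<And>x y. x \<in> vball v \<Longrightarrow> y \<in> vball v \<Longrightarrow> x - y \<in> vball (int m) \<Longrightarrow> h x = h y"
    and v: "v \<le> int m" and n: "m \<le> n + 1"
  shows "(\<Sum>(a,b)\<in>frac_pairs v n. h (b / a)) =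
    (real CARD('a) - 1) * real CARD('a) ^ (2 * n + 1 - m) * (\<Sum>y\<in>digits v (int m). h y)"
proof -
  have fin: "finite {b. inR b \<and> b / a \<in> vball v}" if "a \<in> Rdeg n" for a :: "'a fls"
  proof (rule finite_subset)
    show "{b. inR b \<and> b / a \<in> vball v} \<subseteq> digits (v - int n) 1"
      using Rdeg_vball_divide[OF that] by (auto simp: digits_def inR_iff_low)
  qed simp
  have inner: "(\<Sum>b\<in>{b. inR b \<and> b / a \<in> vball v}. h (b / a))
      = real CARD('a) ^ (n + 1 - m) * (\<Sum>y\<in>digits v (int m). h y)" if a: "a \<in> Rdeg n" for a
  proof -
    let ?S = "{b. inR b \<and> b / a \<in> vball v}"
    have a0: "a \<noteq> 0" using a by (simp add: Rdeg_def)
    have im: "(\<lambda>b. cutoff (int m) (b / a)) ` ?S \<subseteq> digits v (int m)"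
      by (auto intro: cutoff_digits)
    have fib: "card {b \<in> ?S. cutoff (int m) (b / a) = y} = CARD('a) ^ (n + 1 - m)"
      if y: "y \<in> digits v (int m)" for y
    proof -
      have "{b \<in> ?S. cutoff (int m) (b / a) = y} = {b \<in> low 1. b - a * y \<in> vball (int m - int n)}"
      proof (intro set_eqI iffI)
        fix b assume b: "b \<in> {b \<in> ?S. cutoff (int m) (b / a) = y}"
        then have "b / a - y \<in> vball (int m)" using diff_cutoff[of "b / a" "int m"] by auto
        moreover have "b / a - y = (b - a * y) / a" using a0 by (simp add: field_simps)
        ultimately show "b \<in> {b \<in> low 1. b - a * y \<in> vball (int m - int n)}"
          using b Rdeg_vball_divide[OF a] by (auto simp: inR_iff_low)
      next
        fix b assume b: "b \<in> {b \<in> low 1. b - a * y \<in> vball (int m - int n)}"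
        have "b / a - y = (b - a * y) / a" using a0 by (simp add: field_simps)
        then have *: "b / a - y \<in> vball (int m)" using b Rdeg_vball_divide[OF a] by auto
        then have "b / a \<in> vball v"
          using y vball_cong[of "b / a" y v] vball_mono[OF * v] by (auto simp: digits_def)
        then show "b \<in> {b \<in> ?S. cutoff (int m) (b / a) = y}"
          using b * y cutoff_unique[of y "int m" "b / a"] by (auto simp: inR_iff_low digits_def)
      qed
      moreover have "nat (1 - (int m - int n)) = n + 1 - m" using n by simp
      ultimately show ?thesis using n by (simp add: card_low_near)
    qed
    have "(\<Sum>b\<in>?S. h (b / a)) = (\<Sum>y\<in>digits v (int m). \<Sum>b\<in>{b \<in> ?S. cutoff (int m) (b / a) = y}. h (b / a))"
      by (rule sum.group[symmetric]) (use fin[OF a] im in auto)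
    also have "\<dots> = (\<Sum>y\<in>digits v (int m). \<Sum>b\<in>{b \<in> ?S. cutoff (int m) (b / a) = y}. h y)"
    proof (intro sum.cong refl)
      fix y b assume y: "y \<in> digits v (int m)" and b: "b \<in> {b \<in> ?S. cutoff (int m) (b / a) = y}"
      show "h (b / a) = h y"
        by (rule h) (use y b diff_cutoff[of "b / a" "int m"] in \<open>auto simp: digits_def\<close>)
    qed
    also have "\<dots> = real CARD('a) ^ (n + 1 - m) * (\<Sum>y\<in>digits v (int m). h y)"
      by (simp add: fib sum_distrib_left del: mem_Collect_eq)
    finally show ?thesis .
  qed
  have "(\<Sum>(a,b)\<in>frac_pairs v n. h (b / a)) = (\<Sum>a\<in>Rdeg n. \<Sum>b\<in>{b. inR b \<and> b / a \<in> vball v}. h (b / a))"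
    unfolding frac_pairs_Sigma by (rule sum.Sigma[symmetric]) (use fin in auto)
  also have "\<dots> = real (card (Rdeg n :: 'a fls set)) * (real CARD('a) ^ (n + 1 - m) * (\<Sum>y\<in>digits v (int m). h y))"
    by (simp add: inner)
  also have "\<dots> = (real CARD('a) - 1) * (real CARD('a) ^ n * real CARD('a) ^ (n + 1 - m)) * (\<Sum>y\<in>digits v (int m). h y)"
    by (simp add: card_Rdeg)
  also have "real CARD('a) ^ n * real CARD('a) ^ (n + 1 - m) = real CARD('a) ^ (2 * n + 1 - m)"
    using n by (subst power_add[symmetric], intro arg_cong2[where f=power]) auto
  finally show ?thesis .
qed

text \<open>Cancelling the monic gcd, of degree \<open>s\<close>, does not change
  \<open>b / a\<close>, and each of the \<open>CARD('a)^s\<close> monic polynomials of degree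
  \<open>s\<close> occurs as gcd.\<close>

lemma frac_sum_by_gcd:
  fixes h :: "'a::{finite,field} fls \<Rightarrow> real"
  shows "(\<Sum>(a,b)\<in>frac_pairs v n. h (b / a)) =
    (\<Sum>s\<le>n. real CARD('a) ^ s * (\<Sum>(a,b)\<in>red_pairs v (n - s). h (b / a)))"
proof -
  let ?D = "SIGMA s:{..n}. (Rmonic s :: 'a fls set) \<times> (red_pairs v (n - s) :: ('a fls \<times> 'a fls) set)"
  let ?f = "\<lambda>(s::nat, g, (a, b)). (g * a, g * b :: 'a fls)"
  have bij: "bij_betw ?f ?D (frac_pairs v n)"
    unfolding bij_betw_def
  proof
    show "inj_on ?f ?D"
    proof (rule inj_onI)
      fix z z' assume z: "z \<in> ?D" "z' \<in> ?D" "?f z = ?f z'"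
      obtain s g a b where ze: "z = (s, g, a, b)" and 1: "g \<in> Rmonic s" "(a, b) \<in> red_pairs v (n - s)"
        using z(1) by auto
      obtain s' g' a' b' where ze': "z' = (s', g', a', b')"
        and 2: "g' \<in> Rmonic s'" "(a', b') \<in> red_pairs v (n - s')"
        using z(2) by auto
      have ea: "g * a = g' * a'" and eb: "g * b = g' * b'" using z(3) by (auto simp: ze ze')
      have c: "cop a b" "cop a' b'" using 1 2 by (auto simp: red_pairs_def)
      have R: "inR g" "inR g'" "inR a" "inR b" "inR a'" "inR b'" "monic g" "monic g'" "g \<noteq> 0" "g' \<noteq> 0"
        using 1 2 by (auto simp: red_pairs_def frac_pairs_def Rmonic_def Rdeg_def)
      obtain x y where xy: "inR x" "inR y" "a * x + b * y = 1" using c by (auto simp: cop_def)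
      obtain x' y' where xy': "inR x'" "inR y'" "a' * x' + b' * y' = 1" using c by (auto simp: cop_def)
      have "g = g * (a * x + b * y)" using xy by simp
      also have "\<dots> = (g * a) * x + (g * b) * y" by (simp add: algebra_simps)
      also have "\<dots> = g' * (a' * x + b' * y)" unfolding ea eb by (simp add: algebra_simps)
      finally have g: "g = g' * (a' * x + b' * y)" .
      have "g' = g' * (a' * x' + b' * y')" using xy' by simp
      also have "\<dots> = (g' * a') * x' + (g' * b') * y'" by (simp add: algebra_simps)
      also have "\<dots> = g * (a * x' + b * y')" unfolding ea[symmetric] eb[symmetric] by (simp add: algebra_simps)
      finally have g': "g' = g * (a * x' + b * y')" .
      let ?w = "a' * x + b' * y" and ?w' = "a * x' + b * y'"
      have "g = g * ?w' * ?w" using g g' by simp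
      then have "g * 1 = g * (?w * ?w')" by (simp only: mult_1_right mult.assoc mult.commute[of ?w])
      then have "?w * ?w' = 1" using R(9) mult_left_cancel by metis
      moreover have "inR ?w" "inR ?w'" using R xy xy' by (auto intro!: inR_intros)
      ultimately have "?w = 1" using monic_unit[of ?w ?w' g'] R g by simp
      then have gg: "g = g'" using g by simp
      then have "a = a'" "b = b'" using ea eb R by auto
      moreover have "s = s'" using gg 1 2 by (auto simp: Rmonic_def Rdeg_def)
      ultimately show "z = z'" using gg by (simp add: ze ze')
    qed
    show "?f ` ?D = frac_pairs v n"
    proof (intro set_eqI iffI)
      fix p assume "p \<in> ?f ` ?D"
      then obtain s g a b where *: "s \<le> n" "g \<in> Rmonic s" "(a, b) \<in> red_pairs v (n - s)" "p = (g * a, g * b)"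
        by auto
      then show "p \<in> frac_pairs v n"
        by (auto simp: red_pairs_def frac_pairs_def Rmonic_def Rdeg_def inR_mult)
    next
      fix p assume "p \<in> (frac_pairs v n :: ('a fls \<times> 'a fls) set)"
      then obtain a b where p: "p = (a, b)" "a \<in> Rdeg n" "inR b" "b / a \<in> vball v" by (auto simp: frac_pairs_def)
      have aR: "inR a" "a \<noteq> 0" using p by (auto simp: Rdeg_def)
      obtain g a' b' where g: "inR g" "monic g" "inR a'" "inR b'" "a = g * a'" "b = g * b'" "cop a' b'"
        using gcd_factor[OF aR p(3)] by blast
      have nz: "g \<noteq> 0" "a' \<noteq> 0" using g aR by auto
      define s where "s = nat (- fls_subdegree g)"
      have sg: "fls_subdegree g = - int s" using inR_subdegree_le[OF g(1)] by (simp add: s_def)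
      have sa: "fls_subdegree a' = int s - int n" using p(2) g(5) nz sg by (auto simp: Rdeg_def)
      have sn: "s \<le> n" using inR_subdegree_le[OF g(3)] sa by simp
      have "g \<in> Rmonic s" using g nz sg by (simp add: Rmonic_def Rdeg_def)
      moreover have "(a', b') \<in> red_pairs v (n - s)"
        using g nz sa sn p(4) by (auto simp: red_pairs_def frac_pairs_def Rdeg_def of_nat_diff)
      ultimately show "p \<in> ?f ` ?D"
        using sn p g by (intro image_eqI[of _ _ "(s, g, (a', b'))"]) auto
    qed
  qed
  have "(\<Sum>(a,b)\<in>frac_pairs v n. h (b / a)) = (\<Sum>z\<in>?D. case ?f z of (a, b) \<Rightarrow> h (b / a))"
    by (rule sum.reindex_bij_betw[OF bij, symmetric])
  also have "\<dots> = (\<Sum>z\<in>?D. case z of (s, g, (a, b)) \<Rightarrow> h (b / a))"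
    by (rule sum.cong) (auto simp: Rmonic_def Rdeg_def)
  also have "\<dots> = (\<Sum>s\<le>n. \<Sum>z\<in>(Rmonic s :: 'a fls set) \<times> red_pairs v (n - s). case z of (g, (a, b)) \<Rightarrow> h (b / a))"
    by (subst sum.Sigma) (auto simp: finite_red_pairs intro!: sum.cong)
  also have "\<dots> = (\<Sum>s\<le>n. \<Sum>g\<in>(Rmonic s :: 'a fls set). \<Sum>(a,b)\<in>red_pairs v (n - s). h (b / a))"
    by (intro sum.cong refl) (rule sum.cartesian_product[symmetric])
  finally show ?thesis by (simp add: card_Rmonic)
qed

text \<open>Moebius inversion collapses to two terms, because the zeta function of the polynomial
  ring is \<open>1 / (1 - CARD('a) T)\<close>. The condition \<open>m \<le> n\<close> makes
  \<open>frac_sum\<close> exact both for \<open>n\<close> and for \<open>n - 1\<close>.\<close>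

lemma red_sum:
  fixes h :: "'a::{finite,field} fls \<Rightarrow> real"
  assumes h: "\<And>x y. x \<in> vball v \<Longrightarrow> y \<in> vball v \<Longrightarrow> x - y \<in> vball (int m) \<Longrightarrow> h x = h y"
    and v: "v \<le> int m" and n: "m \<le> n" "1 \<le> n"
  shows "(\<Sum>(a,b)\<in>red_pairs v n. h (b / a)) =
    (real CARD('a) - 1)\<^sup>2 * real CARD('a) ^ (2 * n - m) * (\<Sum>y\<in>digits v (int m). h y)"
proof -
  let ?P = "\<lambda>i. \<Sum>(a,b)\<in>red_pairs v i. h (b / a)"
  let ?N = "\<lambda>i. \<Sum>(a,b)\<in>frac_pairs v i. h (b / a)"
  obtain k where k: "n = Suc k" using n by (cases n) auto
  have "?N n = ?P n + (\<Sum>s\<le>k. real CARD('a) ^ Suc s * ?P (k - s))"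
    unfolding frac_sum_by_gcd k sum.atMost_Suc_shift by simp
  \<comment> \<open>The pairs with a gcd of positive degree reproduce the whole decomposition for
    denominator degree \<open>k = n - 1\<close>.\<close>
  also have "(\<Sum>s\<le>k. real CARD('a) ^ Suc s * ?P (k - s)) = real CARD('a) * ?N k"
    unfolding frac_sum_by_gcd by (simp add: sum_distrib_left mult.assoc)
  finally have "?P n = ?N n - real CARD('a) * ?N k" by simp
  moreover have "?N n = (real CARD('a) - 1) * real CARD('a) ^ (2 * n + 1 - m) * (\<Sum>y\<in>digits v (int m). h y)"
    using frac_sum[of v m h n, OF h v] n by simp
  moreover have "?N k = (real CARD('a) - 1) * real CARD('a) ^ (2 * k + 1 - m) * (\<Sum>y\<in>digits v (int m). h y)"
    using frac_sum[of v m h k, OF h v] n k by simp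
  moreover have "2 * n + 1 - m = Suc (2 * n - m)" "2 * n - m = Suc (2 * k + 1 - m)" using n k by auto
  ultimately show ?thesis by (simp add: algebra_simps power2_eq_square)
qed

section \<open>Matrices and transporters\<close>

type_synonym 'a mat = "'a fls \<times> 'a fls \<times> 'a fls \<times> 'a fls"

definition SL2R :: "'a::{finite,field} mat set" where
  "SL2R = {(a, b, c, d). inR a \<and> inR b \<and> inR c \<and> inR d \<and> a * d - b * c = 1}"

fun mmul :: "'a::{finite,field} mat \<Rightarrow> 'a mat \<Rightarrow> 'a mat" where
  "mmul (p, q, r, s) (a, b, c, d) = (p * a + q * c, p * b + q * d, r * a + s * c, r * b + s * d)"

fun minv :: "'a::{finite,field} mat \<Rightarrow> 'a mat" where
  "minv (a, b, c, d) = (d, - b, - c, a)"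

lemma mmul_assoc: "mmul (mmul x y) z = mmul x (mmul y z)"
  by (cases x; cases y; cases z) (simp add: algebra_simps)

lemma SL2R_mmul: "x \<in> SL2R \<Longrightarrow> y \<in> SL2R \<Longrightarrow> mmul x y \<in> SL2R"
proof -
  assume "x \<in> SL2R" "y \<in> SL2R"
  then obtain p q r s a b c d where e: "x = (p, q, r, s)" "y = (a, b, c, d)"
      "inR p" "inR q" "inR r" "inR s" "inR a" "inR b" "inR c" "inR d"
    and det: "p * s - q * r = 1" "a * d - b * c = 1"
    by (auto simp: SL2R_def)
  have "(p * a + q * c) * (r * b + s * d) - (p * b + q * d) * (r * a + s * c)
      = (p * s - q * r) * (a * d - b * c)" by (simp add: algebra_simps)
  then show ?thesis using e det by (auto simp: SL2R_def intro!: inR_intros)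
qed

lemma SL2R_minv: "x \<in> SL2R \<Longrightarrow> minv x \<in> SL2R"
  by (cases x) (auto simp: SL2R_def algebra_simps intro: inR_intros)

lemma mmul_minv:
  assumes "y \<in> SL2R"
  shows "mmul (mmul x y) (minv y) = x" "mmul (mmul x (minv y)) y = x"
    "mmul y (mmul (minv y) x) = x" "mmul (minv y) (mmul y x) = x"
proof -
  obtain a b c d where y: "y = (a, b, c, d)" "a * d - b * c = 1" using assms by (auto simp: SL2R_def)
  have ad: "a * d = 1 + b * c" using y by (simp add: algebra_simps)
  have 1: "mmul y (minv y) = (1, 0, 0, 1)" "mmul (minv y) y = (1, 0, 0, 1)"
    using ad by (auto simp: y algebra_simps)
  have 2: "mmul x (1, 0, 0, 1) = x" "mmul (1, 0, 0, 1) x = x" for x :: "'a mat" by (cases x; simp)+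
  show "mmul (mmul x y) (minv y) = x" "mmul (mmul x (minv y)) y = x"
    "mmul y (mmul (minv y) x) = x" "mmul (minv y) (mmul y x) = x"
    by (simp_all add: mmul_assoc 1 2) (simp_all add: 1 2 flip: mmul_assoc)
qed

definition unitO :: "'a::{finite,field} fls \<Rightarrow> bool" where
  "unitO u \<longleftrightarrow> u \<noteq> 0 \<and> fls_subdegree u = 0"

lemma unitO_vball: "unitO u \<Longrightarrow> u \<in> vball 0" by (simp add: unitO_def vball_iff)
lemma unitO_divide: "unitO u \<Longrightarrow> unitO v \<Longrightarrow> unitO (u / v)"
  by (auto simp: unitO_def fls_subdegree_divide)
lemma unitO_1 [simp]: "unitO 1" by (simp add: unitO_def)

lemma unitO_iff: "unitO u \<longleftrightarrow> u \<in> vball 0 \<and> u \<notin> vball 1"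
  by (auto simp: unitO_def vball_iff)

lemma unitO_cong: assumes "unitO u" "x - u \<in> vball k" "k \<ge> 1" shows "unitO x"
  using assms vball_mono[OF assms(2), of 1] vball_mono[OF assms(2), of 0] vball_cong[of x u 1] vball_cong[of x u 0]
  by (auto simp: unitO_iff)

lemma vball_unit_mult: "unitO u \<Longrightarrow> u * x \<in> vball k \<longleftrightarrow> x \<in> vball k"
  by (auto simp: unitO_def vball_mult_iff)
lemma vball_unit_divide: "unitO u \<Longrightarrow> x / u \<in> vball k \<longleftrightarrow> x \<in> vball k"
  by (auto simp: unitO_def vball_divide_iff)

lemma vball_mult_0: "x \<in> vball 0 \<Longrightarrow> y \<in> vball k \<Longrightarrow> x * y \<in> vball k"
  "x \<in> vball k \<Longrightarrow> y \<in> vball 0 \<Longrightarrow> x * y \<in> vball k"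
  by (auto intro: vball_mult_le)

text \<open>The condition \<open>c / a \<in> vball 1\<close> selects one completion of each
  primitive row \<open>(a, b)\<close>: the second row is otherwise determined only up to multiples
  of the first.\<close>

definition mats :: "int \<Rightarrow> nat \<Rightarrow> 'a::{finite,field} mat set" where
  "mats v n = {(a, b, c, d) \<in> SL2R. a \<in> Rdeg n \<and> b / a \<in> vball v \<and> c / a \<in> vball 1}"

text \<open>The matrices moving the coset of \<open>(1, 0; \<theta>, 1) diag(u Y\<^sup>n, u\<^sup>-\<^sup>1 Y\<^sup>-\<^sup>n)\<close> to the one of \<open>(u', \<theta>')\<close>, modulo
  the principal congruence subgroup of level \<open>m\<close> of \<open>SL\<^sub>2(O)\<close>.\<close>

definition transporter :: "nat \<Rightarrow> nat \<Rightarrow> 'a::{finite,field} fls \<times> 'a fls \<Rightarrow> 'a fls \<times> 'a fls \<Rightarrow> 'a mat set" where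
  "transporter n m = (\<lambda>(u, th) (u', th'). {(p, q, r, s) \<in> SL2R. q \<in> vball (int m - 2 * int n) \<and>
     p + q * th - u' / u \<in> vball (int m) \<and> s - th' * q - u / u' \<in> vball (int m) \<and>
     r + s * th - th' * (p + q * th) \<in> vball (int m + 2 * int n)})"

text \<open>Transporters compose like the arrows of a groupoid, since the congruence subgroup is
  closed under products; the estimates below are that product written in entries.\<close>

lemma trans_comp:
  assumes g: "g \<in> transporter n m (u, th) (u', th')" and g': "g' \<in> transporter n m (u', th') (u'', th'')"
    and U: "unitO u" "unitO u'" "unitO u''"
  shows "mmul g' g \<in> transporter n m (u, th) (u'', th'')"
proof -
  obtain p q r s where ge: "g = (p, q, r, s)" "g \<in> SL2R" using g by (cases g) (auto simp: transporter_def)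
  obtain p' q' r' s' where ge': "g' = (p', q', r', s')" "g' \<in> SL2R" using g' by (cases g') (auto simp: transporter_def)
  \<comment> \<open>\<open>(A, q; C, D)\<close> is
    \<open>(1, 0; -th', 1) (p, q; r, s) (1, 0; th, 1)\<close>. Conjugation by the diagonal parts
    divides \<open>q\<close> by \<open>Y^(2n)\<close> and multiplies \<open>C\<close> by it, which
    is the origin of the levels \<open>m - 2n\<close> and \<open>m + 2n\<close>.\<close>
  define A C D where "A = p + q * th" and "C = r + s * th - th' * (p + q * th)" and "D = s - th' * q"
  define A' C' D' where "A' = p' + q' * th'" and "C' = r' + s' * th' - th'' * (p' + q' * th')" and "D' = s' - th'' * q'"
  have m: "q \<in> vball (int m - 2 * int n)" "A - u' / u \<in> vball (int m)" "D - u / u' \<in> vball (int m)" "C \<in> vball (int m + 2 * int n)"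
    using g by (auto simp: ge transporter_def A_def C_def D_def)
  have m': "q' \<in> vball (int m - 2 * int n)" "A' - u'' / u' \<in> vball (int m)" "D' - u' / u'' \<in> vball (int m)" "C' \<in> vball (int m + 2 * int n)"
    using g' by (auto simp: ge' transporter_def A'_def C'_def D'_def)
  have v0: "u' / u \<in> vball 0" "u / u' \<in> vball 0" "u'' / u' \<in> vball 0" "u' / u'' \<in> vball 0"
    using U by (auto intro!: unitO_vball unitO_divide)
  have "A \<in> vball 0" "D \<in> vball 0" "A' \<in> vball 0" "D' \<in> vball 0"
    using vball_cong[of A "u' / u" 0] vball_cong[of D "u / u'" 0] vball_cong[of A' "u'' / u'" 0]
      vball_cong[of D' "u' / u''" 0] m m' v0 by (auto dest: vball_mono[where j = 0])
  note v = this v0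
  let ?p = "p' * p + q' * r" and ?q = "p' * q + q' * s" and ?r = "r' * p + s' * r" and ?s = "r' * q + s' * s"
  have nz: "u \<noteq> 0" "u' \<noteq> 0" "u'' \<noteq> 0" using U by (auto simp: unitO_def)
  have "?q = A' * q + q' * D" by (simp add: A'_def D_def algebra_simps)
  also have "\<dots> \<in> vball (int m - 2 * int n)" using v m m' by (intro vball_add vball_mult_0(1) vball_mult_0(2)) auto
  finally have 1: "?q \<in> vball (int m - 2 * int n)" .
  have "?p + ?q * th - u'' / u = (A' * (A - u' / u) + (A' - u'' / u') * (u' / u)) + q' * C"
    using nz by (simp add: A'_def A_def C_def field_simps)
  also have "\<dots> \<in> vball (int m)" using v m m'
    by (intro vball_add vball_mult_0(1)[of A'] vball_mult_0(2)[of "A' - u'' / u'"] vball_mult_le[of q' _ C]) auto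
  finally have 2: "?p + ?q * th - u'' / u \<in> vball (int m)" .
  have "?s - th'' * ?q - u / u'' = (D' * (D - u / u') + (D' - u' / u'') * (u / u')) + C' * q"
    using nz by (simp add: D'_def D_def C'_def field_simps)
  also have "\<dots> \<in> vball (int m)" using v m m'
    by (intro vball_add vball_mult_0(1)[of D'] vball_mult_0(2)[of "D' - u' / u''"] vball_mult_le[of C' _ q]) auto
  finally have 3: "?s - th'' * ?q - u / u'' \<in> vball (int m)" .
  have "?r + ?s * th - th'' * (?p + ?q * th) = C' * A + D' * C"
    by (simp add: D'_def A_def C_def C'_def algebra_simps)
  also have "\<dots> \<in> vball (int m + 2 * int n)" using v m m'
    by (intro vball_add vball_mult_0(1)[of D'] vball_mult_0(2)[of C']) auto
  finally have 4: "?r + ?s * th - th'' * (?p + ?q * th) \<in> vball (int m + 2 * int n)" .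
  have "mmul g' g \<in> SL2R" using ge ge' by (intro SL2R_mmul)
  then show ?thesis using 1 2 3 4 by (simp add: ge ge' transporter_def)
qed

lemma trans_minv:
  assumes "g \<in> transporter n m (u, th) (u', th')" shows "minv g \<in> transporter n m (u', th') (u, th)"
proof -
  obtain p q r s where ge: "g = (p, q, r, s)" "g \<in> SL2R" using assms by (cases g) (auto simp: transporter_def)
  have m: "q \<in> vball (int m - 2 * int n)" "p + q * th - u' / u \<in> vball (int m)"
    "s - th' * q - u / u' \<in> vball (int m)" "r + s * th - th' * (p + q * th) \<in> vball (int m + 2 * int n)"
    using assms by (auto simp: ge transporter_def)
  have "- r + p * th' - th * (s + - q * th') = - (r + s * th - th' * (p + q * th))"
    by (simp add: algebra_simps)
  then have "- r + p * th' - th * (s + - q * th') \<in> vball (int m + 2 * int n)" using m(4) by (simp only: vball_uminus_iff)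
  moreover have "s + - q * th' - u / u' \<in> vball (int m)" using m(3) by (simp add: algebra_simps)
  moreover have "p - th * - q - u' / u \<in> vball (int m)" using m(2) by (simp add: algebra_simps)
  moreover have "minv g \<in> SL2R" using ge by (intro SL2R_minv)
  ultimately show ?thesis using m(1) by (simp add: ge transporter_def)
qed

text \<open>A coset depends on \<open>u\<close> modulo \<open>X^m\<close> only, but on its second
  coordinate modulo \<open>X^(m + 2n)\<close>.\<close>

lemma trans_id:
  assumes "u - u' \<in> vball (int m)" "th - th' \<in> vball (int m + 2 * int n)" "unitO u" "unitO u'"
  shows "(1, 0, 0, 1) \<in> transporter n m (u, th) (u', th')"
proof -
  have nz: "u \<noteq> 0" "u' \<noteq> 0" using assms by (auto simp: unitO_def)
  have "1 - u' / u = (u - u') / u" "1 - u / u' = (u' - u) / u'" using nz by (auto simp: field_simps)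
  then have "1 - u' / u \<in> vball (int m)" "1 - u / u' \<in> vball (int m)"
    using assms vball_minus_commute[of u u'] by (auto simp: vball_unit_divide)
  then show ?thesis using assms by (auto simp: transporter_def SL2R_def)
qed

lemma trans_cong:
  assumes g: "g \<in> transporter n m (u, th) (u', th')" and U: "unitO u" "unitO u'" "unitO w" "unitO w'"
    and "u - w \<in> vball (int m)" "u' - w' \<in> vball (int m)"
    and "th - ph \<in> vball (int m + 2 * int n)" "th' - ph' \<in> vball (int m + 2 * int n)"
  shows "g \<in> transporter n m (w, ph) (w', ph')"
proof -
  have "(1, 0, 0, 1) \<in> transporter n m (w, ph) (u, th)" "(1, 0, 0, 1) \<in> transporter n m (u', th') (w', ph')"
    using assms vball_minus_commute by (blast intro: trans_id)+
  then have "mmul (1, 0, 0, 1) (mmul g (1, 0, 0, 1)) \<in> transporter n m (w, ph) (w', ph')"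
    using g U trans_comp by blast
  then show ?thesis by (cases g) simp
qed

text \<open>The upper right entry bounds the whole matrix: after removal of the unipotent parts the
  diagonal entries are units and the lower left one is tiny, and putting the unipotent parts back
  only adds multiples of \<open>q\<close> and of bounded terms.\<close>

lemma trans_vball:
  assumes "(p, q, r, s) \<in> transporter n m (u, th) (u', th')" "q \<in> vball k" "k \<le> 0" "unitO u" "unitO u'"
    "th \<in> vball 1" "th' \<in> vball 1"
  shows "p \<in> vball k" "r \<in> vball k" "s \<in> vball k"
proof -
  have th: "th \<in> vball 0" "th' \<in> vball 0" using assms by (auto dest: vball_mono[where j = 0])
  have m: "p + q * th - u' / u \<in> vball (int m)"
    "s - th' * q - u / u' \<in> vball (int m)" "r + s * th - th' * (p + q * th) \<in> vball (int m + 2 * int n)"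
    using assms(1) by (auto simp: transporter_def)
  have v0: "u' / u \<in> vball 0" "u / u' \<in> vball 0"
    using assms by (auto intro!: unitO_vball unitO_divide)
  have A: "p + q * th \<in> vball k" and D: "s - th' * q \<in> vball k"
    using vball_mono[OF v0(1) assms(3)] vball_mono[OF v0(2) assms(3)] vball_mono[OF m(1), of k]
      vball_mono[OF m(2), of k] vball_cong[of _ _ k] assms(3) by auto
  have "p = (p + q * th) - q * th" by simp
  also have "\<dots> \<in> vball k" using A assms th by (intro vball_diff vball_mult_0(2)) auto
  finally show "p \<in> vball k" .
  have "s = (s - th' * q) + th' * q" by simp
  also have "\<dots> \<in> vball k" using D assms th by (intro vball_add vball_mult_0(1)) auto
  finally show s: "s \<in> vball k" .
  define A' C where "A' = p + q * th" and "C = r + s * th - th' * (p + q * th)"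
  have "C \<in> vball k" "A' \<in> vball k" using A vball_mono[OF m(3), of k] assms(3) by (auto simp: A'_def C_def)
  have "r = C - s * th + th' * A'" by (simp add: A'_def C_def)
  also have "\<dots> \<in> vball k" using \<open>C \<in> vball k\<close> \<open>A' \<in> vball k\<close> s th
    by (intro vball_add vball_diff vball_mult_0(1)[of th'] vball_mult_0(2)[of s]) auto
  finally show "r \<in> vball k" .
qed

section \<open>The correspondence between matrices and cosets\<close>

lemma X_unit: "a \<in> Rdeg n \<Longrightarrow> unitO (a * fls_X_intpow (int n))"
  by (auto simp: Rdeg_def unitO_def)

text \<open>In \<open>(a, b; c, d) = (1, 0; c/a, 1) diag(a, 1/a) (1, b/a; 0, 1)\<close> the first
  two factors are the coset representative. Between the representatives, the quotient of the two
  matrices therefore becomes \<open>(1, b'/a' - b/a; 0, 1)\<close>, a member of the congruence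
  subgroup. Accordingly the diagonal conditions and the lower left one hold exactly.\<close>

lemma mats_trans:
  assumes M: "(a, b, c, d) \<in> mats v n" and M': "(a', b', c', d') \<in> mats v n"
    and bb: "b' / a' - b / a \<in> vball (int m)"
  shows "mmul (a', b', c', d') (minv (a, b, c, d))
    \<in> transporter n m (a * fls_X_intpow (int n), c / a) (a' * fls_X_intpow (int n), c' / a')"
proof -
  have S: "(a, b, c, d) \<in> SL2R" "(a', b', c', d') \<in> SL2R" and a: "a \<in> Rdeg n" "a' \<in> Rdeg n"
    using M M' by (auto simp: mats_def)
  have nz: "a \<noteq> 0" "a' \<noteq> 0" and sd: "fls_subdegree a = - int n" "fls_subdegree a' = - int n"
    using a by (auto simp: Rdeg_def)
  have det: "a * d - b * c = 1" "a' * d' - b' * c' = 1" using S by (auto simp: SL2R_def)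
  let ?p = "a' * d + b' * - c" and ?q = "a' * - b + b' * a" and ?r = "c' * d + d' * - c" and ?s = "c' * - b + d' * a"
  have "?q = (a * a') * (b' / a' - b / a)" using nz by (simp add: field_simps)
  moreover have "(a * a') * (b' / a' - b / a) \<in> vball (int m - 2 * int n)"
    using nz sd bb by (subst vball_mult_iff) auto
  ultimately have 1: "?q \<in> vball (int m - 2 * int n)" by (simp only:)
  have "a * (?p + ?q * (c / a)) = a' * (a * d - b * c)" using nz by (simp add: field_simps)
  then have A: "?p + ?q * (c / a) = a' / a" using nz(1) det(1) by (metis eq_divide_imp mult.commute mult_1_right)
  have "a' * (?s - (c' / a') * ?q) = a * (a' * d' - b' * c')" using nz by (simp add: field_simps)
  then have D: "?s - (c' / a') * ?q = a / a'" using nz(2) det(2) by (metis eq_divide_imp mult.commute mult_1_right)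
  have "a * (?r + ?s * (c / a)) = c' * (a * d - b * c)" using nz by (simp add: field_simps)
  then have "?r + ?s * (c / a) = c' / a" using nz(1) det(1) by (metis eq_divide_imp mult.commute mult_1_right)
  then have C: "?r + ?s * (c / a) - (c' / a') * (?p + ?q * (c / a)) = 0" unfolding A using nz by simp
  let ?x = "fls_X_intpow (int n) :: 'a fls"
  have ux: "a' * ?x / (a * ?x) = a' / a" "a * ?x / (a' * ?x) = a / a'" by auto
  have 2: "?p + ?q * (c / a) - a' * ?x / (a * ?x) \<in> vball (int m)" unfolding A ux by simp
  have 3: "?s - (c' / a') * ?q - a * ?x / (a' * ?x) \<in> vball (int m)" unfolding D ux by simp
  have 4: "?r + ?s * (c / a) - (c' / a') * (?p + ?q * (c / a)) \<in> vball (int m + 2 * int n)" unfolding C by simp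
  have "mmul (a', b', c', d') (minv (a, b, c, d)) \<in> SL2R" using S by (intro SL2R_mmul SL2R_minv)
  then show ?thesis using 1 2 3 4
    unfolding transporter_def mmul.simps minv.simps case_prod_conv mem_Collect_eq by blast
qed

text \<open>Converse of \<open>mats_trans\<close>. Left multiplication by \<open>g\<close> turns
  \<open>a\<close> into \<open>a * A\<close> with a unit \<open>A\<close>, changes
  \<open>b / a\<close> by \<open>q / (a * a')\<close> and moves \<open>c / a\<close> to within
  \<open>C / A\<close> of the target, so the product stays in \<open>mats v n\<close>.\<close>

lemma trans_mats:
  assumes M: "(a, b, c, d) \<in> mats v n" and g: "g \<in> transporter n m (a * fls_X_intpow (int n), c / a) (u, th)"
    and u: "unitO u" and th: "th \<in> vball 1" and m: "1 \<le> m" and v: "v \<le> int m"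
  obtains a' b' c' d' where "mmul g (a, b, c, d) = (a', b', c', d')" "(a', b', c', d') \<in> mats v n"
    "a' * fls_X_intpow (int n) - u \<in> vball (int m)" "c' / a' - th \<in> vball (int m + 2 * int n)"
    "b' / a' - b / a \<in> vball (int m)"
proof -
  obtain p q r s where ge: "g = (p, q, r, s)" "g \<in> SL2R" using g by (cases g) (auto simp: transporter_def)
  have S: "(a, b, c, d) \<in> SL2R" and a: "a \<in> Rdeg n" and ba: "b / a \<in> vball v"
    using M by (auto simp: mats_def)
  have nz: "a \<noteq> 0" and sd: "fls_subdegree a = - int n"
    using a by (auto simp: Rdeg_def)
  have det: "a * d - b * c = 1" using S by (auto simp: SL2R_def)
  let ?x = "fls_X_intpow (int n) :: 'a fls"
  define A where "A = p + q * (c / a)"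
  define C where "C = r + s * (c / a) - th * A"
  have q: "q \<in> vball (int m - 2 * int n)" and Av: "A - u / (a * ?x) \<in> vball (int m)" and Cv: "C \<in> vball (int m + 2 * int n)"
    using g by (auto simp: ge transporter_def A_def C_def)
  have ax: "unitO (a * ?x)" using X_unit[OF a] .
  have AU: "unitO A" by (rule unitO_cong[OF _ Av]) (use unitO_divide[OF u ax] m in auto)
  define a' where "a' = p * a + q * c"
  define b' where "b' = p * b + q * d"
  define c' where "c' = r * a + s * c"
  define d' where "d' = r * b + s * d"
  have mm: "mmul g (a, b, c, d) = (a', b', c', d')" by (simp add: ge a'_def b'_def c'_def d'_def)
  have S': "(a', b', c', d') \<in> SL2R" using SL2R_mmul[OF ge(2) S] by (simp add: mm)
  have a'A: "a' = a * A" using nz by (simp add: a'_def A_def field_simps)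
  then have a': "a' \<in> Rdeg n" using S' AU a by (auto simp: SL2R_def Rdeg_def unitO_def)
  have nz': "a' \<noteq> 0" "fls_subdegree a' = - int n" using a' by (auto simp: Rdeg_def)
  have xn: "?x \<noteq> 0" by simp
  have "a' * ?x - u = (a * ?x) * (A - u / (a * ?x))" using nz xn by (simp add: a'A field_simps)
  then have 1: "a' * ?x - u \<in> vball (int m)" using Av vball_unit_mult[OF ax] by simp
  have A0: "A \<noteq> 0" using AU by (simp add: unitO_def)
  have "c' = a * (C + th * A)" using nz by (simp add: c'_def C_def field_simps)
  then have "c' / a' - th = C / A" using nz A0 by (simp add: a'A field_simps)
  then have 2: "c' / a' - th \<in> vball (int m + 2 * int n)" using Cv vball_unit_divide[OF AU] by simp
  have "b' * a - b * a' = q * (a * d - b * c)" by (simp add: b'_def a'_def algebra_simps)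
  then have "b' / a' - b / a = q / (a * a')" using nz nz' det by (simp add: field_simps)
  then have 3: "b' / a' - b / a \<in> vball (int m)" using q nz nz' sd by (simp add: vball_divide_iff)
  have "b' / a' \<in> vball v" using vball_cong[OF vball_mono[OF 3 v]] ba by simp
  moreover have "c' / a' \<in> vball 1" using vball_cong[OF vball_mono[OF 2, of 1]] th m by simp
  ultimately have "(a', b', c', d') \<in> mats v n" using S' a' by (simp add: mats_def)
  then show ?thesis using that mm 1 2 3 by blast
qed

text \<open>The hypotheses make the inverse of one matrix times the other congruent to the identity
  modulo \<open>vball 1\<close>. Its entries are polynomials, so by discreteness it is the identity.
  Stabilizers in the orbit are thus trivial.\<close>

lemma mats_rigid:
  assumes M: "(a, b, c, d) \<in> mats v n" and M': "(a', b', c', d') \<in> mats v n" and m: "1 \<le> m"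
    and b: "b' / a' - b / a \<in> vball (int m)" and c: "c' / a' - c / a \<in> vball (int m + 2 * int n)"
    and aa: "a' * fls_X_intpow (int n) - a * fls_X_intpow (int n) \<in> vball (int m)"
  shows "(a, b, c, d) = (a', b', c', d')"
proof -
  have S: "(a, b, c, d) \<in> SL2R" "(a', b', c', d') \<in> SL2R" and a: "a \<in> Rdeg n" "a' \<in> Rdeg n"
    using M M' by (auto simp: mats_def)
  have nz: "a \<noteq> 0" "a' \<noteq> 0" and sd: "fls_subdegree a = - int n" "fls_subdegree a' = - int n"
    using a by (auto simp: Rdeg_def)
  have det: "a * d - b * c = 1" "a' * d' - b' * c' = 1" using S by (auto simp: SL2R_def)
  have R: "inR a" "inR b" "inR c" "inR d" "inR a'" "inR b'" "inR c'" "inR d'" using S by (auto simp: SL2R_def)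
  have "a * c' - c * a' = (a * a') * (c' / a' - c / a)" using nz by (simp add: field_simps)
  also have "\<dots> \<in> vball 1" using nz sd vball_mono[OF c, of "1 + 2 * int n"] m by (subst vball_mult_iff) auto
  finally have "a * c' - c * a' = 0" using R by (intro inR_vball1) (auto intro!: inR_intros)
  then have ac: "a * c' = a' * c" by (simp add: algebra_simps)
  have "a * (d * a' - b * c') = a' * (a * d - b * c)" using ac by (simp add: algebra_simps)
  then have e: "d * a' - b * c' = a' / a" using nz det by (simp add: field_simps)
  have "a' / a - 1 = (a' - a) * fls_X_intpow (int n) / (a * fls_X_intpow (int n))" using nz by (simp add: field_simps)
  also have "\<dots> \<in> vball 1" using vball_mono[OF aa, of 1] m vball_unit_divide[OF X_unit[OF a(1)]]
    by (simp add: algebra_simps)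
  finally have "d * a' - b * c' - 1 \<in> vball 1" by (simp add: e)
  then have "d * a' - b * c' - 1 = 0" using R by (intro inR_vball1) (auto intro!: inR_intros)
  then have eq: "a' = a" "c' = c" using e nz ac by (auto simp: field_simps)
  have "a * (d * b' - b * d') = b' * (a * d) - b * (a * d')" by (simp add: algebra_simps)
  also have "a * d = 1 + b * c" using det by (simp add: algebra_simps)
  also have "a * d' = 1 + b' * c" using det eq by (simp add: algebra_simps)
  finally have ab: "a * (d * b' - b * d') = b' - b" by (simp add: algebra_simps)
  have b1: "d * b' - b * d' \<in> vball 1"
  proof -
    have "a * (d * b' - b * d') = b' - b" by (rule ab)
    then have "d * b' - b * d' = b' / a' - b / a" using nz eq by (simp add: field_simps)
    then show ?thesis using vball_mono[OF b, of 1] m by simp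
  qed
  then have b0: "d * b' - b * d' = 0" using R by (intro inR_vball1) (auto intro!: inR_intros)
  have bb: "b' = b" using ab b0 by simp
  have "a * d = a * d'" using det eq bb by (simp add: algebra_simps)
  then show ?thesis using eq bb nz by simp
qed

text \<open>The right-hand side splits over the classes of \<open>E\<close>, and each class
  contributes \<open>k\<close> times the square of its sum of \<open>\<Phi>\<close>. All
  contributions are nonnegative and \<open>k \<ge> 1\<close>, so the class of \<open>x0\<close>
  alone is a lower bound. Here \<open>k\<close> stands for the order of the stabilizer.\<close>

lemma class_energy:
  fixes \<Phi> k :: "'x \<Rightarrow> real"
  assumes fin: "finite S"
    and refl: "\<And>x. x \<in> S \<Longrightarrow> E x x"
    and sym: "\<And>x y. x \<in> S \<Longrightarrow> y \<in> S \<Longrightarrow> E x y \<Longrightarrow> E y x"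
    and trans: "\<And>x y z. x \<in> S \<Longrightarrow> y \<in> S \<Longrightarrow> z \<in> S \<Longrightarrow> E x y \<Longrightarrow> E y z \<Longrightarrow> E x z"
    and k1: "\<And>x. x \<in> S \<Longrightarrow> k x \<ge> 1"
    and kE: "\<And>x y. x \<in> S \<Longrightarrow> y \<in> S \<Longrightarrow> E x y \<Longrightarrow> k x = k y"
    and x0: "x0 \<in> S"
  shows "(\<Sum>y\<in>{y\<in>S. E x0 y}. \<Phi> y)\<^sup>2 \<le> (\<Sum>x\<in>S. \<Sum>y\<in>S. (if E x y then k x else 0) * \<Phi> x * \<Phi> y)"
proof -
  define cl where "cl x = {y\<in>S. E x y}" for x
  define W where "W x = (\<Sum>y\<in>cl x. \<Phi> y)" for x
  define N where "N x = real (card (cl x))" for x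
  have fcl: "finite (cl x)" for x using fin by (simp add: cl_def)
  have cl_eq: "cl x = cl y" if "x \<in> S" "y \<in> S" "E x y" for x y
    unfolding cl_def using that sym trans by blast
  have Npos: "N x > 0" if "x \<in> S" for x
    using that refl fcl[of x] by (auto simp: N_def cl_def card_gt_0_iff)
  have W_eq: "W x = W y" "N x = N y" if "x \<in> S" "y \<in> S" "E x y" for x y
    using cl_eq[OF that] by (auto simp: W_def N_def)
  have sum_cl: "(\<Sum>y\<in>S. if E x y then f y else 0) = (\<Sum>y\<in>cl x. f y)" for x and f :: "'x \<Rightarrow> real"
    using fin by (simp add: cl_def sum.inter_filter)
  have "(\<Sum>x\<in>S. \<Sum>y\<in>S. (if E x y then k x else 0) * \<Phi> x * \<Phi> y) = (\<Sum>x\<in>S. k x * \<Phi> x * W x)"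
  proof (rule sum.cong)
    fix x
    have "(\<Sum>y\<in>S. (if E x y then k x else 0) * \<Phi> x * \<Phi> y) = (\<Sum>y\<in>S. if E x y then k x * \<Phi> x * \<Phi> y else 0)"
      by (rule sum.cong) auto
    then show "(\<Sum>y\<in>S. (if E x y then k x else 0) * \<Phi> x * \<Phi> y) = k x * \<Phi> x * W x"
      by (simp add: sum_cl W_def sum_distrib_left)
  qed simp
  \<comment> \<open>Since \<open>k\<close>, \<open>W\<close> and \<open>N\<close> are constant on
    classes, \<open>\<Phi> x\<close> may be replaced by its class mean \<open>W x / N x\<close>,
    which exposes the squares.\<close>
  also have "\<dots> = (\<Sum>x\<in>S. k x * (W x)\<^sup>2 / N x)"
  proof -
    have "(\<Sum>x\<in>S. k x * (W x)\<^sup>2 / N x) = (\<Sum>x\<in>S. \<Sum>y\<in>S. if E x y then k x * W x / N x * \<Phi> y else 0)"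
      by (rule sum.cong) (simp_all add: sum_cl power2_eq_square W_def flip: sum_distrib_left sum_divide_distrib)
    also have "\<dots> = (\<Sum>y\<in>S. \<Sum>x\<in>S. if E x y then k x * W x / N x * \<Phi> y else 0)" by (rule sum.swap)
    also have "\<dots> = (\<Sum>y\<in>S. \<Sum>x\<in>S. if E y x then k y * W y / N y * \<Phi> y else 0)"
    proof (intro sum.cong)
      fix x y assume "y \<in> S" "x \<in> S"
      then show "(if E x y then k x * W x / N x * \<Phi> y else 0) = (if E y x then k y * W y / N y * \<Phi> y else 0)"
        using sym[of x y] sym[of y x] W_eq[of x y] kE[of x y] by auto
    qed auto
    also have "\<dots> = (\<Sum>y\<in>S. k y * \<Phi> y * W y)"
    proof (rule sum.cong)
      fix y assume y: "y \<in> S"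
      show "(\<Sum>x\<in>S. if E y x then k y * W y / N y * \<Phi> y else 0) = k y * \<Phi> y * W y"
        using Npos[OF y] unfolding sum_cl by (simp add: N_def field_simps)
    qed simp
    finally show ?thesis by simp
  qed
  also have "\<dots> \<ge> (\<Sum>x\<in>cl x0. k x * (W x)\<^sup>2 / N x)"
  proof (rule sum_mono2[OF fin])
    fix x assume "x \<in> S - cl x0"
    then show "0 \<le> k x * (W x)\<^sup>2 / N x" using k1[of x] Npos[of x] by simp
  qed (auto simp: cl_def)
  moreover have "(\<Sum>x\<in>cl x0. k x * (W x)\<^sup>2 / N x) \<ge> (\<Sum>x\<in>cl x0. (W x0)\<^sup>2 / N x0)"
  proof (rule sum_mono)
    fix x assume x: "x \<in> cl x0"
    then have xS: "x \<in> S" "E x0 x" by (auto simp: cl_def)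
    have "(W x)\<^sup>2 / N x \<le> k x * ((W x)\<^sup>2 / N x)" using k1[OF xS(1)] Npos[OF xS(1)]
      by (intro mult_right_mono[of 1 "k x", simplified]) auto
    then show "(W x0)\<^sup>2 / N x0 \<le> k x * (W x)\<^sup>2 / N x" using W_eq[OF x0 xS] by simp
  qed
  moreover have "(\<Sum>x\<in>cl x0. (W x0)\<^sup>2 / N x0) = (W x0)\<^sup>2" using Npos[OF x0] by (simp add: N_def)
  ultimately show ?thesis unfolding W_def cl_def by linarith
qed

section \<open>Second moment bound\<close>

definition units :: "nat \<Rightarrow> 'a::{finite,field} fls set" where
  "units m = {u \<in> digits 0 (int m). unitO u}"

text \<open>All second coordinates, at the finest relevant level \<open>m + 2n\<close>, inside one
  ball of level \<open>m\<close>. Localizing \<open>c / a\<close> in this way lets a test function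
  be treated as constant in it.\<close>

definition thetas :: "nat \<Rightarrow> nat \<Rightarrow> 'a::{finite,field} fls \<Rightarrow> 'a fls set" where
  "thetas n m th0 = {t \<in> low (int m + 2 * int n). t - th0 \<in> vball (int m)}"

lemma finite_units [simp]: "finite (units m)" by (simp add: units_def)

lemma finite_thetas [simp]: "finite (thetas n m th0)"
  unfolding thetas_def by (rule finite_low_near) simp

lemma card_thetas: "card (thetas n m (th0 :: 'a::{finite,field} fls)) = CARD('a) ^ (2 * n)"
proof -
  have "nat (2 * int n) = 2 * n" by simp
  then show ?thesis unfolding thetas_def by (subst card_low_near) auto
qed

lemma card_units_le: "card (units m :: 'a::{finite,field} fls set) \<le> CARD('a) ^ m"
proof -
  have "card (units m :: 'a fls set) \<le> card (digits 0 (int m) :: 'a fls set)"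
    by (rule card_mono) (auto simp: units_def)
  then show ?thesis by (simp add: card_digits)
qed

lemma thetas_vball: "t \<in> thetas n m th0 \<Longrightarrow> th0 \<in> vball 1 \<Longrightarrow> 1 \<le> m \<Longrightarrow> t \<in> vball 1"
  using vball_cong[of t th0 1] by (auto simp: thetas_def dest: vball_mono[where j = 1])

lemma trans_subset:
  assumes "unitO u" "unitO u'" "th \<in> vball 1" "th' \<in> vball 1" "m \<le> 2 * n"
  shows "transporter n m (u, th) (u', th') \<subseteq> digits (int m - 2 * int n) 1 \<times> digits (int m - 2 * int n) 1 \<times>
    digits (int m - 2 * int n) 1 \<times> digits (int m - 2 * int n) 1"
proof
  fix g assume g: "g \<in> transporter n m (u, th) (u', th')"
  obtain p q r s where ge: "g = (p, q, r, s)" by (cases g)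
  have k: "int m - 2 * int n \<le> 0" using assms(5) by simp
  have q: "q \<in> vball (int m - 2 * int n)" using g by (auto simp: ge transporter_def)
  have "p \<in> vball (int m - 2 * int n)" "r \<in> vball (int m - 2 * int n)" "s \<in> vball (int m - 2 * int n)"
    using trans_vball[OF g[unfolded ge] q k assms(1-4)] by auto
  then show "g \<in> digits (int m - 2 * int n) 1 \<times> digits (int m - 2 * int n) 1 \<times>
    digits (int m - 2 * int n) 1 \<times> digits (int m - 2 * int n) 1"
    using g q by (auto simp: ge digits_def transporter_def SL2R_def inR_iff_low)
qed

lemma trans_SL2R: "g \<in> transporter n m x y \<Longrightarrow> g \<in> SL2R"
  by (cases x; cases y) (auto simp: transporter_def)

text \<open>Orbit and stabilizer: multiplication by \<open>minv g0\<close> on either side identifies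
  the transporter with the stabilizer of the source or of the target.\<close>

lemma card_trans:
  assumes U: "unitO u" "unitO u'" and g0: "g0 \<in> transporter n m (u, th) (u', th')"
  shows "card (transporter n m (u, th) (u', th')) = card (transporter n m (u, th) (u, th))"
    and "card (transporter n m (u, th) (u', th')) = card (transporter n m (u', th') (u', th'))"
proof -
  have i0: "minv g0 \<in> transporter n m (u', th') (u, th)" using g0 by (rule trans_minv)
  have S0: "g0 \<in> SL2R" using g0 by (rule trans_SL2R)
  have 1: "mmul (minv g0) g \<in> transporter n m (u, th) (u, th)" "mmul g (minv g0) \<in> transporter n m (u', th') (u', th')"
    if "g \<in> transporter n m (u, th) (u', th')" for g
    using trans_comp[OF that i0] trans_comp[OF i0 that] U by blast+
  have 2: "mmul g0 g \<in> transporter n m (u, th) (u', th')" if "g \<in> transporter n m (u, th) (u, th)" for g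
    using trans_comp[OF that g0] U by blast
  have 3: "mmul g g0 \<in> transporter n m (u, th) (u', th')" if "g \<in> transporter n m (u', th') (u', th')" for g
    using trans_comp[OF g0 that] U by blast
  have "bij_betw (mmul (minv g0)) (transporter n m (u, th) (u', th')) (transporter n m (u, th) (u, th))"
    by (rule bij_betw_byWitness[where f' = "mmul g0"])
       (intro ballI image_subsetI mmul_minv[OF S0] 1 2, assumption?)+
  then show "card (transporter n m (u, th) (u', th')) = card (transporter n m (u, th) (u, th))"
    by (rule bij_betw_same_card)
  have "bij_betw (\<lambda>g. mmul g (minv g0)) (transporter n m (u, th) (u', th')) (transporter n m (u', th') (u', th'))"
    by (rule bij_betw_byWitness[where f' = "\<lambda>g. mmul g g0"])
       (intro ballI image_subsetI mmul_minv[OF S0] 1 3, assumption?)+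
  then show "card (transporter n m (u, th) (u', th')) = card (transporter n m (u', th') (u', th'))"
    by (rule bij_betw_same_card)
qed

text \<open>The entry \<open>A = p + q * th\<close> gives \<open>u'\<close> as \<open>u * A\<close>
  modulo \<open>X^m\<close>, and \<open>th'\<close> is the Moebius image
  \<open>(r + s * th) / A\<close>. Hence one matrix contributes at most one target for every
  source.\<close>

lemma trans_target_unique:
  assumes "g \<in> transporter n m (u, th) (u', th')" "g \<in> transporter n m (u, th) (u'', th'')"
    and U: "unitO u" "unitO u'" and m: "1 \<le> m"
    and "u' \<in> low (int m)" "u'' \<in> low (int m)" "th' \<in> low (int m + 2 * int n)" "th'' \<in> low (int m + 2 * int n)"
  shows "u' = u''" "th' = th''"
proof -
  obtain p q r s where ge: "g = (p, q, r, s)" by (cases g)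
  define A where "A = p + q * th"
  have A: "A - u' / u \<in> vball (int m)" "A - u'' / u \<in> vball (int m)"
    and C: "r + s * th - th' * A \<in> vball (int m + 2 * int n)" "r + s * th - th'' * A \<in> vball (int m + 2 * int n)"
    using assms(1,2) by (auto simp: ge transporter_def A_def)
  have "u' / u - u'' / u \<in> vball (int m)" using vball_diff[OF A(2,1)] by simp
  then have "(u' - u'') / u \<in> vball (int m)" by (simp add: diff_divide_distrib)
  then have "u' - u'' \<in> vball (int m)" using vball_unit_divide[OF U(1)] by simp
  then show "u' = u''" using assms low_diff low_vball_eq_0[of "u' - u''" "int m"] by auto
  have AU: "unitO A" by (rule unitO_cong[OF unitO_divide[OF U(2,1)] A(1)]) (use m in simp)
  have "A * (th' - th'') \<in> vball (int m + 2 * int n)" using vball_diff[OF C(2,1)] by (simp add: algebra_simps)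
  then have "th' - th'' \<in> vball (int m + 2 * int n)" using vball_unit_mult[OF AU] by simp
  then show "th' = th''" using assms low_diff low_vball_eq_0[of "th' - th''" "int m + 2 * int n"] by auto
qed

lemma unitO_divide_vball: "unitO x \<Longrightarrow> q \<noteq> 0 \<Longrightarrow> k \<le> - fls_subdegree q \<Longrightarrow> x / q \<in> vball k"
  by (auto simp: vball_iff fls_subdegree_divide unitO_def)

text \<open>If the upper right entry \<open>q\<close> is not too small, the number of admissible \<open>(\<theta>, \<theta>')\<close> does not depend on
  \<open>(u, u')\<close>; this is the source of all cancellation.\<close>

lemma trans_count_indep:
  fixes p q r s th0 :: "'a::{finite,field} fls"
  assumes m: "1 \<le> m" and q: "q \<notin> vball (1 - int m)"
  obtains k where "\<And>u u'. unitO u \<Longrightarrow> unitO u' \<Longrightarrow>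
    card {(t, t') \<in> thetas n m th0 \<times> thetas n m th0. (p, q, r, s) \<in> transporter n m (u, t) (u', t')} = k"
proof -
  define l where "l = - fls_subdegree q"
  have q0: "q \<noteq> 0" using q by auto
  have l: "l \<ge> int m" using q q0 by (auto simp: vball_iff l_def)
  show ?thesis
  \<comment> \<open>The entries \<open>p + q * t\<close> and \<open>s - t' * q\<close> are units
    while \<open>|q| \<ge> CARD('a)^m\<close>. Dividing by \<open>q\<close> shows that
    \<open>t\<close> and \<open>t'\<close> agree with \<open>- p / q\<close> and
    \<open>s / q\<close> up to level \<open>m\<close>, whatever \<open>u\<close> and
    \<open>u'\<close> are. Whether they lie near \<open>th0\<close> is thus decided by the matrix
    alone.\<close>
  proof (cases "(p, q, r, s) \<in> SL2R \<and> q \<in> vball (int m - 2 * int n) \<and>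
      p / q + th0 \<in> vball (int m) \<and> s / q - th0 \<in> vball (int m)")
    case False
    have empty: "{(t, t') \<in> thetas n m th0 \<times> thetas n m th0. (p, q, r, s) \<in> transporter n m (u, t) (u', t')} = {}"
      if U: "unitO u" "unitO u'" for u u'
    proof (rule ccontr)
      assume "\<not> ?thesis"
      then obtain t t' where t: "t \<in> thetas n m th0" "t' \<in> thetas n m th0" "(p, q, r, s) \<in> transporter n m (u, t) (u', t')"
        by auto
      have AD: "p + q * t - u' / u \<in> vball (int m)" "s - t' * q - u / u' \<in> vball (int m)" using t by (auto simp: transporter_def)
      have AU: "unitO (p + q * t)" by (rule unitO_cong[OF _ AD(1)]) (use U m in \<open>auto intro: unitO_divide\<close>)
      have DU: "unitO (s - t' * q)" by (rule unitO_cong[OF _ AD(2)]) (use U m in \<open>auto intro: unitO_divide\<close>)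
      have "(p + q * t) / q \<in> vball (int m)" "(s - t' * q) / q \<in> vball (int m)"
        using AU DU q0 l by (auto simp: l_def intro!: unitO_divide_vball)
      then have 1: "p / q + t \<in> vball (int m)" "s / q - t' \<in> vball (int m)" using q0 by (auto simp: field_simps)
      have 2: "t - th0 \<in> vball (int m)" "t' - th0 \<in> vball (int m)" using t by (auto simp: thetas_def)
      have "p / q + th0 \<in> vball (int m)" using vball_diff[OF 1(1) 2(1)] by simp
      moreover have "s / q - th0 \<in> vball (int m)" using vball_add[OF 1(2) 2(2)] by simp
      ultimately show False using False t(3) by (auto simp: transporter_def)
    qed
    show ?thesis by (rule that[of 0]) (simp only: empty card.empty)
  next
    case True
    then have l2: "l \<le> 2 * int n - int m" using q0 by (auto simp: vball_iff l_def)
    have det: "p * s - q * r = 1" using True by (auto simp: SL2R_def)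
    \<comment> \<open>The congruence for \<open>p + q * t\<close> confines \<open>t\<close> to a
      ball of level \<open>m + l\<close> whose centre, but not its size, depends on \<open>u\<close>
      and \<open>u'\<close>; then \<open>t'\<close> is the Moebius image of
      \<open>t\<close>.\<close>
    have "card {(t, t') \<in> thetas n m th0 \<times> thetas n m th0. (p, q, r, s) \<in> transporter n m (u, t) (u', t')}
        = CARD('a) ^ nat (2 * int n - l)" if U: "unitO u" "unitO u'" for u u'
    proof -
      let ?N = "int m + 2 * int n"
      let ?A = "{t \<in> low ?N. t - (u' / u - p) / q \<in> vball (int m + l)}"
      let ?f = "\<lambda>t. (t, cutoff ?N ((r + s * t) / (p + q * t)))"
      have uu: "unitO (u' / u)" "unitO (u / u')" using U by (auto intro: unitO_divide)
      have uu0: "u \<noteq> 0" "u' \<noteq> 0" using U by (auto simp: unitO_def)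
      have A_iff: "t - (u' / u - p) / q \<in> vball (int m + l) \<longleftrightarrow> p + q * t - u' / u \<in> vball (int m)" for t
      proof -
        have "t - (u' / u - p) / q = (p + q * t - u' / u) / q" using q0 by (simp add: field_simps)
        then show ?thesis using q0 by (simp add: vball_divide_iff l_def)
      qed
      have "{(t, t') \<in> thetas n m th0 \<times> thetas n m th0. (p, q, r, s) \<in> transporter n m (u, t) (u', t')} = ?f ` ?A"
      proof (intro set_eqI iffI)
        fix z assume "z \<in> {(t, t') \<in> thetas n m th0 \<times> thetas n m th0. (p, q, r, s) \<in> transporter n m (u, t) (u', t')}"
        then obtain t t' where z: "z = (t, t')" "t \<in> thetas n m th0" "t' \<in> thetas n m th0"
          "(p, q, r, s) \<in> transporter n m (u, t) (u', t')" by auto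
        have Av: "p + q * t - u' / u \<in> vball (int m)" using z by (auto simp: transporter_def)
        have tA: "t \<in> ?A" using z Av by (auto simp: A_iff thetas_def)
        have AU: "unitO (p + q * t)" by (rule unitO_cong[OF uu(1) Av]) (use m in simp)
        have "(r + s * t - t' * (p + q * t)) / (p + q * t) \<in> vball ?N"
          using z vball_unit_divide[OF AU] by (auto simp: transporter_def)
        then have "(r + s * t) / (p + q * t) - t' \<in> vball ?N" using AU by (simp add: unitO_def diff_divide_distrib)
        then have "cutoff ?N ((r + s * t) / (p + q * t)) = t'" using z by (intro cutoff_unique) (auto simp: thetas_def)
        then show "z \<in> ?f ` ?A" using tA z by auto
      next
        fix z assume "z \<in> ?f ` ?A"
        then obtain t where t: "t \<in> ?A" and z: "z = ?f t" by auto
        define A where "A = p + q * t"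
        define t1 where "t1 = (r + s * t) / A"
        define t' where "t' = cutoff ?N t1"
        have Av: "A - u' / u \<in> vball (int m)" using t unfolding A_def by (auto simp: A_iff)
        have AU: "unitO A" by (rule unitO_cong[OF uu(1) Av]) (use m in simp)
        have A0: "A \<noteq> 0" using AU by (simp add: unitO_def)
        have t't1: "t1 - t' \<in> vball ?N" by (simp add: t'_def diff_cutoff)
        have "A / q \<in> vball (int m)" using AU q0 l by (intro unitO_divide_vball) (auto simp: l_def)
        then have "p / q + t \<in> vball (int m)" using q0 by (simp add: A_def field_simps)
        then have "t - th0 \<in> vball (int m)" using vball_diff[of "p / q + t" "int m" "p / q + th0"] True by simp
        then have tT: "t \<in> thetas n m th0" using t by (auto simp: thetas_def)
        \<comment> \<open>The determinant forces the lower diagonal entry to be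
          \<open>1 / A\<close>, so its congruence follows from the one for \<open>A\<close>.\<close>
        have "A * (s - t1 * q) = p * s - q * r" using A0 by (simp add: t1_def field_simps) (simp add: A_def algebra_simps)
        then have sA: "s - t1 * q = 1 / A" using A0 det by (simp add: field_simps)
        have "(1 / A) / q \<in> vball (int m)" using q0 l unitO_divide[OF unitO_1 AU]
          by (intro unitO_divide_vball) (auto simp: l_def)
        then have "s / q - t1 \<in> vball (int m)" using q0 sA by (simp add: field_simps flip: sA)
        then have "t1 - th0 \<in> vball (int m)" using vball_diff[of "s / q - th0" "int m" "s / q - t1"] True by simp
        moreover have "t' - t1 \<in> vball (int m)" using t't1 vball_minus_commute vball_mono[of _ ?N "int m"] by auto
        ultimately have "t' - th0 \<in> vball (int m)" using vball_diff_trans by blast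
        then have t'T: "t' \<in> thetas n m th0" by (simp add: thetas_def t'_def)
        have "r + s * t - t' * A = A * (t1 - t')" using A0 by (simp add: t1_def field_simps)
        then have C: "r + s * t - t' * A \<in> vball ?N" using t't1 vball_unit_mult[OF AU] by simp
        have "1 / A - u / u' = (u / u') * ((u' / u - A) / A)" using A0 uu0 by (simp add: field_simps)
        also have "\<dots> \<in> vball (int m)"
          using Av vball_minus_commute[of A "u' / u"] by (simp only: vball_unit_mult[OF uu(2)] vball_unit_divide[OF AU])
        finally have "1 / A - u / u' \<in> vball (int m)" .
        moreover have "(t1 - t') * q \<in> vball (int m)" using t't1 True by (intro vball_mult_le[of _ ?N _ "int m - 2 * int n"]) auto
        ultimately have "(1 / A - u / u') + (t1 - t') * q \<in> vball (int m)" by (rule vball_add)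
        then have D: "s - t' * q - u / u' \<in> vball (int m)" by (simp add: algebra_simps flip: sA)
        have "(p, q, r, s) \<in> transporter n m (u, t) (u', t')"
          using True Av D C unfolding transporter_def A_def by simp
        then show "z \<in> {(t, t') \<in> thetas n m th0 \<times> thetas n m th0. (p, q, r, s) \<in> transporter n m (u, t) (u', t')}"
          using tT t'T z by (simp add: t'_def t1_def A_def)
      qed
      moreover have "inj_on ?f ?A" by (auto intro: inj_onI)
      moreover have "nat (?N - (int m + l)) = nat (2 * int n - l)" by simp
      ultimately show ?thesis using l2 by (simp add: card_image card_low_near)
    qed
    then show ?thesis using that by blast
  qed
qed

text \<open>The bound counts at most \<open>CARD('a)^(2n + m)\<close> sources in \<open>S\<close>,
  at most \<open>CARD('a)^(4m)\<close> matrices with all entries of degree below \<open>m\<close>,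
  and \<open>K\<^sup>2\<close> for each pair. All other matrices cancel by the mean zero
  hypothesis.\<close>

lemma mats_mean_zero_bound:
  fixes \<psi> :: "'a::{finite,field} fls \<Rightarrow> real" and be0 th0 :: "'a fls"
  assumes m: "1 \<le> m" "m \<le> 2 * n" "v \<le> int m" and th0: "th0 \<in> vball 1"
    and cong: "\<And>u w. unitO u \<Longrightarrow> unitO w \<Longrightarrow> u - w \<in> vball (int m) \<Longrightarrow> \<psi> u = \<psi> w"
    and bound: "\<And>u. unitO u \<Longrightarrow> \<bar>\<psi> u\<bar> \<le> K"
    and mean: "(\<Sum>u\<in>units m. \<psi> u) = 0"
  defines "G \<equiv> {(a, b, c, d) \<in> mats v n. b / a - be0 \<in> vball (int m) \<and> c / a - th0 \<in> vball (int m)}"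
  shows "(\<Sum>(a, b, c, d)\<in>G. \<psi> (a * fls_X_intpow (int n)))\<^sup>2 \<le> K\<^sup>2 * real CARD('a) ^ (2 * n + 5 * m)"
proof -
  define S where "S = (units m :: 'a fls set) \<times> thetas n m th0"
  define \<Phi> where "\<Phi> = (\<lambda>(u, t :: 'a fls). \<psi> u)"
  define E where "E x y \<longleftrightarrow> transporter n m x y \<noteq> {}" for x y :: "'a fls \<times> 'a fls"
  define k where "k x = real (card (transporter n m x x))" for x :: "'a fls \<times> 'a fls"
  define f where "f = (\<lambda>(a :: 'a fls, b :: 'a fls, c, d :: 'a fls). (cutoff (int m) (a * fls_X_intpow (int n)), cutoff (int m + 2 * int n) (c / a)))"
  define D where "D = (digits (int m - 2 * int n) 1 :: 'a fls set)"
  define D' where "D' = (digits (1 - int m) 1 :: 'a fls set)"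
  have finS: "finite S" by (simp add: S_def)
  have S_D: "unitO (fst x)" "snd x \<in> vball 1" "fst x \<in> low (int m)" "snd x \<in> low (int m + 2 * int n)"
      "snd x - th0 \<in> vball (int m)" if "x \<in> S" for x
    using that thetas_vball[OF _ th0 m(1)] by (auto simp: S_def units_def thetas_def digits_def)
  have sub: "transporter n m x y \<subseteq> D \<times> D \<times> D \<times> D" if "x \<in> S" "y \<in> S" for x y
    using trans_subset[of "fst x" "fst y" "snd x" "snd y" m n] S_D[OF that(1)] S_D[OF that(2)] m by (simp add: D_def)
  have finD: "finite (D \<times> D \<times> D \<times> D)" by (simp add: D_def)
  have fint: "finite (transporter n m x y)" if "x \<in> S" "y \<in> S" for x y
    using finite_subset[OF sub[OF that] finD] .
  have idt: "(1, 0, 0, 1) \<in> transporter n m x x" if "x \<in> S" for x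
    using trans_id[of "fst x" "fst x" m "snd x" "snd x" n] S_D[OF that] by simp
  have card_eq: "real (card (transporter n m x y)) = (if E x y then k x else 0)" if "x \<in> S" "y \<in> S" for x y
    using card_trans(1)[of "fst x" "fst y" _ n m "snd x" "snd y"] S_D[OF that(1)] S_D[OF that(2)]
    by (auto simp: E_def k_def)
  \<comment> \<open>The map \<open>f\<close> sends a matrix to its coset. It is injective on
    \<open>G\<close> by \<open>mats_rigid\<close>, and by \<open>mats_trans\<close> and
    \<open>trans_mats\<close> its image is a full class of \<open>E\<close> in \<open>S\<close>, so
    the sum over \<open>G\<close> is a class sum.\<close>
  have lower: "(\<Sum>(a, b, c, d)\<in>G. \<psi> (a * fls_X_intpow (int n)))\<^sup>2
      \<le> (\<Sum>x\<in>S. \<Sum>y\<in>S. (if E x y then k x else 0) * \<Phi> x * \<Phi> y)"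
    if ne: "G \<noteq> {}"
  proof -
    obtain a b c d where M0: "(a, b, c, d) \<in> G" using ne by auto
    have fS: "f M \<in> S" "\<Phi> (f M) = (case M of (a, b, c, d) \<Rightarrow> \<psi> (a * fls_X_intpow (int n)))" if "M \<in> G" for M
    proof -
      obtain a b c d where Me: "M = (a, b, c, d)" by (cases M)
      have a: "a \<in> Rdeg n" and c: "c / a - th0 \<in> vball (int m)" using that by (auto simp: Me G_def mats_def)
      let ?u = "a * fls_X_intpow (int n)"
      have u: "unitO ?u" using X_unit[OF a] .
      have cu: "unitO (cutoff (int m) ?u)" using unitO_cong[OF u cutoff_diff] m by simp
      then have "cutoff (int m) ?u \<in> units m" using cutoff_digits[OF unitO_vball[OF u]] by (simp add: units_def)
      moreover have "cutoff (int m + 2 * int n) (c / a) - th0 \<in> vball (int m)"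
        using vball_diff_trans[OF vball_mono[OF cutoff_diff] c] by simp
      ultimately show "f M \<in> S" by (simp add: f_def Me S_def thetas_def)
      show "\<Phi> (f M) = (case M of (a, b, c, d) \<Rightarrow> \<psi> (a * fls_X_intpow (int n)))"
        using cong[OF cu u cutoff_diff] by (simp add: \<Phi>_def f_def Me)
    qed
    have inj: "inj_on f G"
    proof (rule inj_onI)
      fix M M' assume M: "M \<in> G" "M' \<in> G" "f M = f M'"
      obtain a b c d where Me: "M = (a, b, c, d)" by (cases M)
      obtain a' b' c' d' where Me': "M' = (a', b', c', d')" by (cases M')
      have "b' / a' - b / a \<in> vball (int m)"
        using M vball_diff[of "b' / a' - be0" "int m" "b / a - be0"] by (auto simp: Me Me' G_def)
      moreover have "c' / a' - c / a \<in> vball (int m + 2 * int n)"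
        "a' * fls_X_intpow (int n) - a * fls_X_intpow (int n) \<in> vball (int m)"
        using M by (auto simp: Me Me' f_def cutoff_eq_iff vball_minus_commute)
      ultimately show "M = M'" using M m mats_rigid[of a b c d v n a' b' c' d' m] by (auto simp: Me Me' G_def)
    qed
    have img: "f ` G = {y \<in> S. E (f (a, b, c, d)) y}"
    proof (intro set_eqI iffI)
      fix y assume "y \<in> f ` G"
      then obtain M' where M': "M' \<in> G" "y = f M'" by auto
      obtain a' b' c' d' where Me': "M' = (a', b', c', d')" by (cases M')
      have b: "b' / a' - b / a \<in> vball (int m)"
        using M0 M' vball_diff[of "b' / a' - be0" "int m" "b / a - be0"] by (auto simp: Me' G_def)
      have a: "a \<in> Rdeg n" "a' \<in> Rdeg n" using M0 M' by (auto simp: Me' G_def mats_def)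
      have "mmul (a', b', c', d') (minv (a, b, c, d))
        \<in> transporter n m (a * fls_X_intpow (int n), c / a) (a' * fls_X_intpow (int n), c' / a')"
        by (rule mats_trans) (use M0 M' b in \<open>auto simp: Me' G_def\<close>)
      then have "mmul (a', b', c', d') (minv (a, b, c, d)) \<in> transporter n m (f (a, b, c, d)) (f M')"
        unfolding f_def Me' case_prod_conv
        by (rule trans_cong)
           (use a X_unit unitO_cong[OF _ cutoff_diff, of _ "int m"] diff_cutoff m in \<open>auto\<close>)
      then show "y \<in> {y \<in> S. E (f (a, b, c, d)) y}" using fS(1)[OF M'(1)] M' by (auto simp: E_def)
    next
      fix y assume y: "y \<in> {y \<in> S. E (f (a, b, c, d)) y}"
      obtain u t where ye: "y = (u, t)" by (cases y)
      have yS: "y \<in> S" using y by simp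
      obtain g where g: "g \<in> transporter n m (f (a, b, c, d)) y" using y by (auto simp: E_def)
      have M0m: "(a, b, c, d) \<in> mats v n" using M0 by (simp add: G_def)
      have a: "a \<in> Rdeg n" using M0 by (auto simp: G_def mats_def)
      have u: "unitO u" "t \<in> vball 1" "u \<in> low (int m)" "t \<in> low (int m + 2 * int n)" "t - th0 \<in> vball (int m)"
        using S_D[OF yS] by (auto simp: ye)
      have cu: "unitO (cutoff (int m) (a * fls_X_intpow (int n)))"
        using unitO_cong[OF X_unit[OF a] cutoff_diff] m by simp
      have "g \<in> transporter n m (a * fls_X_intpow (int n), c / a) (u, t)"
        using g unfolding f_def case_prod_conv ye
        by (rule trans_cong) (use X_unit[OF a] cu u cutoff_diff in auto)
      then obtain a' b' c' d' where *: "mmul g (a, b, c, d) = (a', b', c', d')" "(a', b', c', d') \<in> mats v n"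
          "a' * fls_X_intpow (int n) - u \<in> vball (int m)" "c' / a' - t \<in> vball (int m + 2 * int n)"
          "b' / a' - b / a \<in> vball (int m)"
        using trans_mats[OF M0m _ u(1,2) m(1,3)] by metis
      have "b / a - be0 \<in> vball (int m)" using M0 by (simp add: G_def)
      then have "b' / a' - be0 \<in> vball (int m)" using vball_diff_trans[OF *(5)] by simp
      moreover have "c' / a' - th0 \<in> vball (int m)" using vball_diff_trans[OF vball_mono[OF *(4)] u(5)] by simp
      ultimately have "(a', b', c', d') \<in> G" using * by (simp add: G_def)
      moreover have "f (a', b', c', d') = y" using * u by (simp add: f_def ye cutoff_unique)
      ultimately show "y \<in> f ` G" by (intro image_eqI[of _ _ "(a', b', c', d')"]) auto
    qed
    have "(\<Sum>(a, b, c, d)\<in>G. \<psi> (a * fls_X_intpow (int n))) = (\<Sum>M\<in>G. \<Phi> (f M))"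
      by (rule sum.cong) (auto simp: fS(2))
    also have "\<dots> = (\<Sum>y\<in>{y \<in> S. E (f (a, b, c, d)) y}. \<Phi> y)"
      unfolding img[symmetric] by (simp add: sum.reindex[OF inj] o_def)
    finally have eq: "(\<Sum>(a, b, c, d)\<in>G. \<psi> (a * fls_X_intpow (int n))) = (\<Sum>y\<in>{y \<in> S. E (f (a, b, c, d)) y}. \<Phi> y)" .
    show ?thesis unfolding eq
    proof (rule class_energy[OF finS])
      fix x assume x: "x \<in> S"
      show "E x x" using idt[OF x] by (auto simp: E_def)
      have "card (transporter n m x x) > 0" using idt[OF x] fint[OF x x] by (auto simp: card_gt_0_iff)
      then show "1 \<le> k x" by (simp add: k_def)
    next
      fix x y assume "x \<in> S" "y \<in> S" "E x y"
      then show "E y x" using trans_minv[of _ n m "fst x" "snd x" "fst y" "snd y"] by (auto simp: E_def)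
    next
      fix x y z assume "x \<in> S" "y \<in> S" "z \<in> S" "E x y" "E y z"
      then show "E x z" using trans_comp[of _ n m "fst x" "snd x" "fst y" "snd y" _ "fst z" "snd z"] S_D
        unfolding E_def prod.collapse by blast
    next
      fix x y assume xy: "x \<in> S" "y \<in> S" "E x y"
      then show "k x = k y" using card_trans[of "fst x" "fst y" _ n m "snd x" "snd y"] S_D
        by (auto simp: E_def k_def)
    next
      show "f (a, b, c, d) \<in> S" using fS(1)[OF M0] .
    qed
  qed
  \<comment> \<open>The weight \<open>k x\<close> is the number of matrices moving \<open>x\<close>
    to \<open>y\<close>; exchanging the sums fixes the matrix and lets the pair vary.\<close>
  define h where "h g = (\<Sum>x\<in>S. \<Sum>y\<in>S. if g \<in> transporter n m x y then \<Phi> x * \<Phi> y else 0)" for g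
  have "(\<Sum>x\<in>S. \<Sum>y\<in>S. (if E x y then k x else 0) * \<Phi> x * \<Phi> y)
      = (\<Sum>x\<in>S. \<Sum>y\<in>S. \<Sum>g\<in>D \<times> D \<times> D \<times> D. if g \<in> transporter n m x y then \<Phi> x * \<Phi> y else 0)"
  proof (intro sum.cong refl)
    fix x y assume xy: "x \<in> S" "y \<in> S"
    have "{g \<in> D \<times> D \<times> D \<times> D. g \<in> transporter n m x y} = transporter n m x y" using sub[OF xy] by blast
    then show "(if E x y then k x else 0) * \<Phi> x * \<Phi> y
      = (\<Sum>g\<in>D \<times> D \<times> D \<times> D. if g \<in> transporter n m x y then \<Phi> x * \<Phi> y else 0)"
      using finD by (simp add: sum.inter_filter[symmetric] flip: card_eq[OF xy])
  qed
  also have "\<dots> = (\<Sum>x\<in>S. \<Sum>g\<in>D \<times> D \<times> D \<times> D. \<Sum>y\<in>S. if g \<in> transporter n m x y then \<Phi> x * \<Phi> y else 0)"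
    by (intro sum.cong refl sum.swap)
  also have "\<dots> = (\<Sum>g\<in>D \<times> D \<times> D \<times> D. h g)" unfolding h_def by (rule sum.swap)
  also have "\<dots> \<le> (\<Sum>g\<in>D \<times> D \<times> D \<times> D. if g \<in> D' \<times> D' \<times> D' \<times> D' then K\<^sup>2 * real (card S) else 0)"
  proof (rule sum_mono)
    fix g :: "'a mat"
    obtain p q r s where ge: "g = (p, q, r, s)" by (cases g)
    show "h g \<le> (if g \<in> D' \<times> D' \<times> D' \<times> D' then K\<^sup>2 * real (card S) else 0)"
    proof (cases "q \<in> vball (1 - int m)")
      case False
      obtain k where k: "\<And>u u'. unitO u \<Longrightarrow> unitO u' \<Longrightarrow>
        card {(t, t') \<in> thetas n m th0 \<times> thetas n m th0. g \<in> transporter n m (u, t) (u', t')} = k"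
        using trans_count_indep[OF m(1) False, where n = n and p = p and r = r and s = s and ?th0.0 = th0] by (auto simp: ge)
      let ?T = "thetas n m th0"
      have "h g = (\<Sum>u\<in>units m. \<Sum>t\<in>?T. \<Sum>u'\<in>units m. \<Sum>t'\<in>?T. if g \<in> transporter n m (u, t) (u', t') then \<psi> u * \<psi> u' else 0)"
        unfolding h_def S_def sum.cartesian_product' \<Phi>_def case_prod_conv by (rule refl)
      also have "\<dots> = (\<Sum>u\<in>units m. \<Sum>u'\<in>units m. \<Sum>t\<in>?T. \<Sum>t'\<in>?T. if g \<in> transporter n m (u, t) (u', t') then \<psi> u * \<psi> u' else 0)"
        by (intro sum.cong refl sum.swap)
      \<comment> \<open>With the same number \<open>k\<close> of admissible second coordinates for
        every \<open>(u, u')\<close>, the sum becomes a product of two sums of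
        \<open>\<psi>\<close>, each of which vanishes.\<close>
      also have "\<dots> = (\<Sum>u\<in>units m. \<Sum>u'\<in>units m. real k * (\<psi> u * \<psi> u'))"
      proof (intro sum.cong refl)
        fix u u' :: "'a fls" assume "u \<in> units m" "u' \<in> units m"
        moreover have "{z \<in> ?T \<times> ?T. g \<in> transporter n m (u, fst z) (u', snd z)}
            = {(t, t') \<in> ?T \<times> ?T. g \<in> transporter n m (u, t) (u', t')}" by auto
        ultimately have k': "card {z \<in> ?T \<times> ?T. g \<in> transporter n m (u, fst z) (u', snd z)} = k"
          using k[of u u'] by (simp only: units_def mem_Collect_eq)
        have "(\<Sum>t\<in>?T. \<Sum>t'\<in>?T. if g \<in> transporter n m (u, t) (u', t') then \<psi> u * \<psi> u' else 0)
          = (\<Sum>z\<in>?T \<times> ?T. if g \<in> transporter n m (u, fst z) (u', snd z) then \<psi> u * \<psi> u' else 0)"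
          by (simp add: sum.cartesian_product case_prod_beta)
        also have "\<dots> = real k * (\<psi> u * \<psi> u')" by (simp add: sum.inter_filter[symmetric] k' del: mem_Sigma_iff)
        finally show "(\<Sum>t\<in>?T. \<Sum>t'\<in>?T. if g \<in> transporter n m (u, t) (u', t') then \<psi> u * \<psi> u' else 0) = real k * (\<psi> u * \<psi> u')" .
      qed
      also have "\<dots> = real k * ((\<Sum>u\<in>units m. \<psi> u) * (\<Sum>u'\<in>units m. \<psi> u'))"
        by (subst sum_product) (simp add: sum_distrib_left)
      finally have "h g = 0" by (simp add: mean)
      then show ?thesis by simp
    next
      case True
      show ?thesis
      proof (cases "g \<in> D' \<times> D' \<times> D' \<times> D'")
        case False
        have "g \<notin> transporter n m x y" if "x \<in> S" "y \<in> S" for x y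
        proof
          assume g: "g \<in> transporter n m x y"
          have "p \<in> vball (1 - int m)" "r \<in> vball (1 - int m)" "s \<in> vball (1 - int m)"
            using trans_vball[of p q r s n m "fst x" "snd x" "fst y" "snd y" "1 - int m"] g True m
              S_D[OF that(1)] S_D[OF that(2)] by (auto simp: ge)
          then have "g \<in> D' \<times> D' \<times> D' \<times> D'" using True trans_SL2R[OF g]
            by (auto simp: ge D'_def digits_def SL2R_def inR_iff_low)
          then show False using False by simp
        qed
        then have "h g = 0" unfolding h_def by (intro sum.neutral ballI) simp
        then show ?thesis using False by simp
      next
        case True
        have "(\<Sum>y\<in>S. if g \<in> transporter n m x y then \<Phi> x * \<Phi> y else 0) \<le> K\<^sup>2" if x: "x \<in> S" for x
        proof -
          have le: "\<Phi> x * \<Phi> y \<le> K\<^sup>2" if "y \<in> S" for y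
          proof -
            have "\<bar>\<Phi> x\<bar> \<le> K" "\<bar>\<Phi> y\<bar> \<le> K" using bound S_D(1)[OF x] S_D(1)[OF that] by (auto simp: \<Phi>_def case_prod_beta)
            then have "\<bar>\<Phi> x\<bar> * \<bar>\<Phi> y\<bar> \<le> K * K" by (intro mult_mono) auto
            then show ?thesis by (simp add: power2_eq_square abs_mult[symmetric])
          qed
          show ?thesis
          proof (cases "\<exists>y\<in>S. g \<in> transporter n m x y")
            case True
            then obtain y where y: "y \<in> S" "g \<in> transporter n m x y" by auto
            have uniq: "z = y" if "z \<in> S" "g \<in> transporter n m x z" for z
              using trans_target_unique[of g n m "fst x" "snd x" "fst z" "snd z" "fst y" "snd y",
                  unfolded prod.collapse, OF that(2) y(2)] m(1) S_D[OF x] S_D[OF y(1)] S_D[OF that(1)]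
              unfolding prod_eq_iff by blast
            have "(\<Sum>z\<in>S. if g \<in> transporter n m x z then \<Phi> x * \<Phi> z else 0) = (\<Sum>z\<in>S. if z = y then \<Phi> x * \<Phi> z else 0)"
            proof (intro sum.cong refl)
              fix z assume "z \<in> S"
              then have "g \<in> transporter n m x z \<longleftrightarrow> z = y" using uniq[of z] y by blast
              then show "(if g \<in> transporter n m x z then \<Phi> x * \<Phi> z else 0) = (if z = y then \<Phi> x * \<Phi> z else 0)"
                by simp
            qed
            then show ?thesis using le[OF y(1)] y finS by simp
          next
            case False
            then have "(\<Sum>y\<in>S. if g \<in> transporter n m x y then \<Phi> x * \<Phi> y else 0) = 0" by (intro sum.neutral) auto
            then show ?thesis by simp
          qed
        qed
        then have "h g \<le> (\<Sum>x\<in>S. K\<^sup>2)" unfolding h_def by (rule sum_mono)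
        then show ?thesis using True by (simp add: mult.commute)
      qed
    qed
  qed
  also have "\<dots> = real (card {g \<in> D \<times> D \<times> D \<times> D. g \<in> D' \<times> D' \<times> D' \<times> D'}) * (K\<^sup>2 * real (card S))"
    using finD by (simp add: sum.inter_filter[symmetric] del: mem_Sigma_iff)
  also have "\<dots> \<le> real CARD('a) ^ (4 * m) * (K\<^sup>2 * real (card S))"
  proof -
    have "card {g \<in> D \<times> D \<times> D \<times> D. g \<in> D' \<times> D' \<times> D' \<times> D'} \<le> card (D' \<times> D' \<times> D' \<times> D')"
      by (rule card_mono) (auto simp: D'_def)
    also have "\<dots> = CARD('a) ^ (m + (m + (m + m)))"
      by (simp add: card_cartesian_product D'_def card_digits power_add)
    also have "m + (m + (m + m)) = 4 * m" by simp
    finally show ?thesis by (intro mult_right_mono) (auto simp flip: of_nat_power)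
  qed
  also have "\<dots> \<le> real CARD('a) ^ (4 * m) * (K\<^sup>2 * (real CARD('a) ^ m * real CARD('a) ^ (2 * n)))"
  proof -
    have "card S \<le> CARD('a) ^ m * CARD('a) ^ (2 * n)"
      unfolding S_def card_cartesian_product card_thetas by (intro mult_right_mono card_units_le) simp
    then have "real (card S) \<le> real CARD('a) ^ m * real CARD('a) ^ (2 * n)"
      by (simp flip: of_nat_power of_nat_mult)
    then show ?thesis by (intro mult_left_mono) auto
  qed
  also have "\<dots> = K\<^sup>2 * real CARD('a) ^ (2 * n + 5 * m)"
    by (simp add: power_add[symmetric] algebra_simps)
  finally have upper: "(\<Sum>x\<in>S. \<Sum>y\<in>S. (if E x y then k x else 0) * \<Phi> x * \<Phi> y) \<le> K\<^sup>2 * real CARD('a) ^ (2 * n + 5 * m)" .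
  show ?thesis
  proof (cases "G = {}")
    case True then show ?thesis by simp
  next
    case False then show ?thesis using lower upper by linarith
  qed
qed

section \<open>Dirichlet approximation\<close>

lemma Rdeg_cong: "x \<in> Rdeg n \<Longrightarrow> inR y \<Longrightarrow> y - x \<in> vball (1 - int n) \<Longrightarrow> y \<in> Rdeg n"
  using vball_cong[of y x "1 - int n"] vball_cong[of y x "- int n"] vball_mono[of "y - x" "1 - int n" "- int n"]
  by (auto simp: Rdeg_eq digits_def inR_iff_low)

lemma Rdeg_vball: "x \<in> Rdeg n \<Longrightarrow> x \<in> vball k \<longleftrightarrow> k \<le> - int n"
  by (auto simp: Rdeg_def vball_iff)

lemma Rdeg_mult: "x \<in> Rdeg i \<Longrightarrow> y \<in> Rdeg j \<Longrightarrow> x * y \<in> Rdeg (i + j)"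
  by (auto simp: Rdeg_def inR_mult)

text \<open>Pigeonhole: there are \<open>CARD('a)^(k + 1)\<close> polynomials \<open>s\<close> of
  degree at most \<open>k\<close>, but only \<open>CARD('a)^k\<close> possible digits of
  \<open>s * be\<close> at the positions 1 to \<open>k\<close>. Cancelling a common factor of the
  difference \<open>s\<close> and its numerator \<open>r\<close> preserves both inequalities, and a
  constant makes the denominator monic.\<close>

lemma dirichlet_exists:
  fixes be :: "'a::{finite,field} fls"
  obtains s r where "inR s" "inR r" "monic s" "s \<in> vball (- int k)" "cop s r" "s * be - r \<in> vball (int k + 1)"
proof -
  let ?D = "digits (- int k) 1 :: 'a fls set" and ?E = "digits 1 (int k + 1) :: 'a fls set"
  let ?f = "\<lambda>s. cutoff (int k + 1) (s * be - cutoff 1 (s * be))"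
  have "nat (1 + int k) = Suc k" "nat (int k + 1 - 1) = k" by auto
  then have "card ?E < card ?D" using card_field_ge_2[where 'a='a] by (simp add: card_digits)
  moreover have "?f ` ?D \<subseteq> ?E" by (auto intro!: cutoff_digits diff_cutoff)
  ultimately have "\<not> inj_on ?f ?D" using card_inj_on_le[of ?f ?D ?E] by auto
  then obtain s1 s2 where s12: "s1 \<in> ?D" "s2 \<in> ?D" "s1 \<noteq> s2" "?f s1 = ?f s2" by (auto simp: inj_on_def)
  define s where "s = s1 - s2"
  define r where "r = cutoff 1 (s1 * be) - cutoff 1 (s2 * be)"
  have sr: "inR s" "inR r" "s \<noteq> 0" "s \<in> vball (- int k)"
    using s12 by (auto simp: s_def r_def digits_def inR_iff_low intro: low_diff vball_diff)
  have "(s1 * be - cutoff 1 (s1 * be)) - (s2 * be - cutoff 1 (s2 * be)) \<in> vball (int k + 1)"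
    using s12(4) by (simp only: cutoff_eq_iff)
  then have srb: "s * be - r \<in> vball (int k + 1)" by (simp add: s_def r_def algebra_simps)
  obtain g s' r' where g: "inR g" "monic g" "inR s'" "inR r'" "s = g * s'" "r = g * r'" "cop s' r'"
    using gcd_factor[OF sr(1,3,2)] by blast
  have g0: "g \<noteq> 0" "s' \<noteq> 0" using g sr by auto
  have gd: "fls_subdegree g \<le> 0" using inR_subdegree_le g by blast
  have s'v: "s' \<in> vball (- int k)" using sr(4) g0 gd by (simp add: g(5) vball_iff)
  have "g * (s' * be - r') \<in> vball (int k + 1)" using srb by (simp add: g algebra_simps)
  then have s'b: "s' * be - r' \<in> vball (int k + 1)"
    using g0 gd vball_mult_iff[of g] vball_mono[of _ "int k + 1 - fls_subdegree g" "int k + 1"] by auto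
  define l where "l = fls_nth s' (fls_subdegree s')"
  have l0: "l \<noteq> 0" using g0 by (simp add: l_def)
  define w where "w = (fls_const (inverse l) :: 'a fls)"
  define w' where "w' = (fls_const l :: 'a fls)"
  have ww': "w * w' = 1" using l0 by (simp add: w_def w'_def fls_const_mult_const)
  have wU: "unitO w" using l0 by (simp add: w_def unitO_def)
  have "monic (w * s')" using lead_mult[of w s'] l0 g0 by (simp add: monic_def w_def l_def)
  moreover have "w * s' \<in> vball (- int k)" using s'v vball_unit_mult[OF wU] by simp
  moreover have "w * s' * be - w * r' \<in> vball (int k + 1)"
    using s'b vball_unit_mult[OF wU, of "s' * be - r'"] by (simp add: algebra_simps)
  moreover have "cop (w * s') (w * r')"
  proof -
    obtain x y where xy: "inR x" "inR y" "s' * x + r' * y = 1" using g(7) by (auto simp: cop_def)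
    have "w * s' * (w' * x) + w * r' * (w' * y) = w * w' * (s' * x + r' * y)" by (simp add: algebra_simps)
    then have "w * s' * (w' * x) + w * r' * (w' * y) = 1" using ww' xy by simp
    moreover have "inR (w' * x)" "inR (w' * y)" using xy by (auto simp: w'_def intro!: inR_intros)
    ultimately show ?thesis unfolding cop_def by blast
  qed
  moreover have "inR (w * s')" "inR (w * r')" using g by (auto simp: w_def intro!: inR_intros)
  ultimately show ?thesis using that by blast
qed

text \<open>The cross difference \<open>s * r' - s' * r\<close> has absolute value at most
  \<open>CARD('a)^(k - (k + 1))\<close>, so it vanishes. The approximation balls are therefore
  disjoint and partition the field, which avoids any treatment of overlaps.\<close>

lemma dirichlet_unique:
  assumes "inR s" "inR r" "monic s" "s \<in> vball (- int k)" "cop s r" "s * be - r \<in> vball (int k + 1)"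
    and "inR s'" "inR r'" "monic s'" "s' \<in> vball (- int k)" "cop s' r'" "s' * be - r' \<in> vball (int k + 1)"
  shows "s = s'" "r = r'"
proof -
  have "s' * (s * be - r) - s * (s' * be - r') \<in> vball 1"
    by (rule vball_diff[OF vball_mult_le[OF assms(10,6)] vball_mult_le[OF assms(4,12)]]) auto
  then have "s * r' - s' * r \<in> vball 1" by (simp add: algebra_simps)
  then have "s * r' - s' * r = 0" using assms by (intro inR_vball1) (auto intro!: inR_intros)
  then have "s * r' = s' * r" by simp
  then show "s = s'" "r = r'" using cop_proportional_eq[of s r s' r'] assms by auto
qed

lemma complete_basis:
  assumes "cop s r" "inR s" "inR r" "s \<noteq> 0"
  obtains s2 r2 where "(s, r, s2, r2) \<in> SL2R" "s2 / s \<in> vball 1"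
proof -
  obtain x y where xy: "inR x" "inR y" "s * x + r * y = 1" using assms(1) by (auto simp: cop_def)
  define c where "c = cutoff 1 (- y / s)"
  have "s * (x - c * r) - r * (- y - c * s) = 1" using xy(3) by (simp add: algebra_simps)
  moreover have "inR (x - c * r)" "inR (- y - c * s)" using xy assms by (auto simp: c_def intro!: inR_intros)
  ultimately have "(s, r, - y - c * s, x - c * r) \<in> SL2R" using assms by (simp add: SL2R_def)
  moreover have "(- y - c * s) / s = - y / s - c" using assms(4) by (simp add: field_simps)
  then have "(- y - c * s) / s \<in> vball 1" by (simp add: c_def diff_cutoff del: minus_divide_left)
  ultimately show ?thesis using that by blast
qed

text \<open>The condition is \<open>t * d = 1\<close> modulo \<open>e\<close>, so
  \<open>t = t0 + e * w\<close> with the reduced solution \<open>t0\<close>. As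
  \<open>|t0| < |e|\<close> and \<open>i < N\<close>, the degree of \<open>t\<close> is
  \<open>N\<close> exactly when \<open>w\<close> has degree \<open>N - i\<close>.\<close>

lemma card_bezout_fibre:
  fixes e d :: "'a::{finite,field} fls"
  assumes ed: "(e, d) \<in> red_pairs 1 i" and N: "i < N"
  shows "real (card {t \<in> Rdeg N. \<exists>c. inR c \<and> t * d - e * c = 1}) = (real CARD('a) - 1) * real CARD('a) ^ (N - i)"
proof -
  have e: "e \<in> Rdeg i" "inR d" "cop e d" using ed by (auto simp: red_pairs_def frac_pairs_def)
  have e0: "e \<noteq> 0" "inR e" "fls_subdegree e = - int i" using e by (auto simp: Rdeg_def)
  obtain x y where xy: "inR x" "inR y" "e * x + d * y = 1" using e by (auto simp: cop_def)
  define z where "z = cutoff 1 (y / e)"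
  define t0 where "t0 = y - e * z"
  define c0 where "c0 = - x - d * z"
  have zR: "inR z" by (simp add: z_def)
  have t0R: "inR t0" "inR c0" using xy e e0 zR by (auto simp: t0_def c0_def intro!: inR_intros)
  have t0c0: "t0 * d - e * c0 = 1" using xy(3) by (simp add: t0_def c0_def algebra_simps)
  have "t0 / e = y / e - z" using e0 by (simp add: t0_def field_simps)
  then have t0e: "t0 \<in> vball (1 - int i)" using e0 vball_divide_iff[of e t0 1] by (simp add: z_def diff_cutoff)
  have "{t \<in> Rdeg N. \<exists>c. inR c \<and> t * d - e * c = 1} = (\<lambda>w. t0 + e * w) ` Rdeg (N - i)"
  proof (intro set_eqI iffI)
    fix t assume "t \<in> {t \<in> Rdeg N. \<exists>c. inR c \<and> t * d - e * c = 1}"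
    then obtain c where t: "t \<in> Rdeg N" "inR c" "t * d - e * c = 1" by auto
    have tR: "inR t" using t by (simp add: Rdeg_def)
    have "e * (c - c0) = (t - t0) * d" using t(3) t0c0 by (simp add: algebra_simps)
    then obtain w where w: "inR w" "t - t0 = e * w"
      using cop_dvd_of_proportional[OF e(3)] t t0R tR by (metis inR_diff)
    have "e * w \<in> Rdeg N"
    proof (rule Rdeg_cong[OF t(1)])
      show "inR (e * w)" using w e0 by (auto intro: inR_intros)
      have "e * w - t = - t0" using w(2) by (simp add: algebra_simps)
      then show "e * w - t \<in> vball (1 - int N)" using t0e N by (auto intro: vball_mono)
    qed
    then have "w \<in> Rdeg (N - i)" using w(1) e0 N by (auto simp: Rdeg_def of_nat_diff)
    then show "t \<in> (\<lambda>w. t0 + e * w) ` Rdeg (N - i)" using w(2) by (intro image_eqI[of _ _ w]) (auto simp: algebra_simps)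
  next
    fix t assume "t \<in> (\<lambda>w. t0 + e * w) ` Rdeg (N - i)"
    then obtain w where w: "w \<in> Rdeg (N - i)" "t = t0 + e * w" by auto
    have wR: "inR w" using w by (simp add: Rdeg_def)
    have ew: "e * w \<in> Rdeg N" using Rdeg_mult[OF e(1) w(1)] N by simp
    have "t \<in> Rdeg N"
    proof (rule Rdeg_cong[OF ew])
      show "inR t" using w(2) t0R e0 wR by (auto intro!: inR_intros)
      show "t - e * w \<in> vball (1 - int N)" using w(2) t0e N by (auto intro: vball_mono)
    qed
    moreover have "t * d - e * (c0 + d * w) = 1" using t0c0 w(2) by (simp add: algebra_simps)
    moreover have "inR (c0 + d * w)" using t0R e wR by (auto intro!: inR_intros)
    ultimately show "t \<in> {t \<in> Rdeg N. \<exists>c. inR c \<and> t * d - e * c = 1}" by blast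
  qed
  moreover have "inj_on (\<lambda>w. t0 + e * w) (Rdeg (N - i))" using e0 by (auto intro: inj_onI)
  ultimately show ?thesis by (simp add: card_image card_Rdeg)
qed

section \<open>Matrices counted through their first rows\<close>

lemma finite_mats: "finite (mats v n :: 'a::{finite,field} mat set)"
proof (rule finite_subset)
  let ?f = "\<lambda>((a, b), c). (a, b, c, (1 + b * c) / a :: 'a fls)"
  show "mats v n \<subseteq> ?f ` (frac_pairs v n \<times> digits (1 - int n) 1)"
  proof
    fix M :: "'a mat" assume M: "M \<in> mats v n"
    obtain a b c d where Me: "M = (a, b, c, d)" by (cases M)
    have a: "a \<in> Rdeg n" "a \<noteq> 0" "inR b" "inR c" "b / a \<in> vball v" "c / a \<in> vball 1" "a * d - b * c = 1"
      using M by (auto simp: Me mats_def Rdeg_def SL2R_def)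
    have "d = (1 + b * c) / a" using a by (simp add: field_simps)
    moreover have "c \<in> digits (1 - int n) 1" using a Rdeg_vball_divide[OF a(1)] by (simp add: digits_def inR_iff_low)
    moreover have "(a, b) \<in> frac_pairs v n" using a by (simp add: frac_pairs_def)
    ultimately show "M \<in> ?f ` (frac_pairs v n \<times> digits (1 - int n) 1)"
      by (intro image_eqI[of _ _ "((a, b), c)"]) (auto simp: Me)
  qed
qed (simp add: finite_frac_pairs)

text \<open>Bezout supplies a second row. Two second rows differ by a multiple of the first, and
  \<open>|c / a| < 1\<close> excludes every nonzero multiple.\<close>

lemma mats_bij: "bij_betw (\<lambda>(a, b, c, d). (a, b)) (mats v n :: 'a::{finite,field} mat set) (red_pairs v n)"
  unfolding bij_betw_def
proof
  show "inj_on (\<lambda>(a, b, c, d). (a, b)) (mats v n :: 'a mat set)"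
  proof (rule inj_onI)
    fix M M' :: "'a mat"
    assume M: "M \<in> mats v n" "M' \<in> mats v n" "(case M of (a, b, c, d) \<Rightarrow> (a, b)) = (case M' of (a, b, c, d) \<Rightarrow> (a, b))"
    obtain a b c d where Me: "M = (a, b, c, d)" by (cases M)
    obtain c' d' where Me': "M' = (a, b, c', d')" using M(3) by (cases M') (auto simp: Me)
    have R: "inR a" "inR b" "inR c" "inR c'" "inR d" "inR d'" "a \<noteq> 0" "c / a \<in> vball 1" "c' / a \<in> vball 1"
      "a * d - b * c = 1" "a * d' - b * c' = 1"
      using M by (auto simp: Me Me' mats_def SL2R_def Rdeg_def)
    have "cop a b" unfolding cop_def using R by (intro exI[of _ d] exI[of _ "- c"]) (auto intro: inR_intros)
    moreover have "a * (d - d') = (c - c') * b" using R(10,11) by (simp add: algebra_simps)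
    ultimately obtain w where w: "inR w" "c - c' = a * w"
      using cop_dvd_of_proportional R by (metis inR_diff)
    have "w = c / a - c' / a" using w(2) R(7) by (simp add: field_simps)
    then have "w = 0" using w(1) R by (intro inR_vball1) (auto intro: vball_diff)
    then have "c = c'" using w by simp
    then have "a * d = a * d'" using R(10,11) by (simp add: algebra_simps)
    then show "M = M'" using R(7) \<open>c = c'\<close> by (simp add: Me Me')
  qed
  show "(\<lambda>(a, b, c, d). (a, b)) ` (mats v n :: 'a mat set) = red_pairs v n"
  proof (intro set_eqI iffI)
    fix p assume "p \<in> (\<lambda>(a, b, c, d). (a, b)) ` (mats v n :: 'a mat set)"
    then obtain a b c d where p: "p = (a, b)" "(a, b, c, d) \<in> mats v n" by auto
    then have R: "inR a" "inR b" "inR c" "inR d" "a \<in> Rdeg n" "b / a \<in> vball v" "a * d - b * c = 1"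
      by (auto simp: mats_def SL2R_def)
    have "cop a b" unfolding cop_def using R by (intro exI[of _ d] exI[of _ "- c"]) (auto intro: inR_intros)
    then show "p \<in> red_pairs v n" using R p by (simp add: red_pairs_def frac_pairs_def)
  next
    fix p assume "p \<in> (red_pairs v n :: ('a fls \<times> 'a fls) set)"
    then obtain a b where p: "p = (a, b)" "a \<in> Rdeg n" "inR b" "b / a \<in> vball v" "cop a b"
      by (auto simp: red_pairs_def frac_pairs_def)
    have a: "inR a" "a \<noteq> 0" using p by (auto simp: Rdeg_def)
    obtain c d where "(a, b, c, d) \<in> SL2R" "c / a \<in> vball 1" using complete_basis[OF p(5) a(1) p(3) a(2)] by blast
    then have "(a, b, c, d) \<in> mats v n" using p by (simp add: mats_def)
    then show "p \<in> (\<lambda>(a, b, c, d). (a, b)) ` (mats v n :: 'a mat set)"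
      using p(1) by (intro image_eqI[of _ _ "(a, b, c, d)"]) auto
  qed
qed

lemma mats_sum_beta:
  fixes h :: "'a::{finite,field} fls \<Rightarrow> real"
  assumes h: "\<And>x y. x \<in> vball v \<Longrightarrow> y \<in> vball v \<Longrightarrow> x - y \<in> vball (int m) \<Longrightarrow> h x = h y"
    and v: "v \<le> int m" and n: "m \<le> n" "1 \<le> n"
  shows "(\<Sum>(a, b, c, d)\<in>mats v n. h (b / a)) =
    (real CARD('a) - 1)\<^sup>2 * real CARD('a) ^ (2 * n - m) * (\<Sum>y\<in>digits v (int m). h y)"
proof -
  have "(\<Sum>(a, b, c, d)\<in>mats v n. h (b / a)) = (\<Sum>(a, b)\<in>red_pairs v n. h (b / a))"
    using sum.reindex_bij_betw[OF mats_bij, of "\<lambda>(a, b). h (b / a)" v n] by (simp add: case_prod_beta)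
  then show ?thesis using red_sum[of v m h n, OF h v n] by simp
qed

text \<open>Every matrix whose \<open>b / a\<close> is close to \<open>r / s\<close> is a product of a smaller matrix \<open>(t, e; c', d')\<close>
  and a fixed completion of \<open>(s, r)\<close>. There \<open>c / a\<close> is extremely close to \<open>d' / e\<close>, and \<open>t\<close> runs through
  complete residue systems modulo \<open>e\<close>.\<close>

lemma dirichlet_ball_sum:
  fixes \<phi> :: "'a::{finite,field} fls \<Rightarrow> real"
  assumes sr: "s \<in> Rmonic j" "inR r" "cop s r" "r / s \<in> vball v" and jk: "j \<le> k"
    and n: "k + m \<le> n" and m: "1 \<le> m" and v: "v \<le> 1"
    and \<phi>: "\<And>x y. x \<in> vball 1 \<Longrightarrow> y \<in> vball 1 \<Longrightarrow> x - y \<in> vball (int m) \<Longrightarrow> \<phi> x = \<phi> y"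
  shows "(\<Sum>(a, b, c, d)\<in>{(a, b, c, d) \<in> mats v n. s * (b / a) - r \<in> vball (int k + 1)}. \<phi> (c / a))
    = (\<Sum>i<n - k. (real CARD('a) - 1) * real CARD('a) ^ (n - j - i) * (\<Sum>(e, d)\<in>red_pairs 1 i. \<phi> (d / e)))"
proof -
  let ?M = "{(a, b, c, d) \<in> mats v n. s * (b / a) - r \<in> vball (int k + 1)}"
  let ?F = "\<lambda>e d. {t \<in> Rdeg (n - j). \<exists>c. inR c \<and> t * d - e * c = 1}"
  let ?T = "SIGMA i:{..<n - k}. SIGMA p:red_pairs 1 i. ?F (fst p) (snd p)"
  have s: "inR s" "s \<noteq> 0" "fls_subdegree s = - int j" using sr by (auto simp: Rmonic_def Rdeg_def)
  obtain s2 r2 where N: "(s, r, s2, r2) \<in> SL2R" and s2: "s2 / s \<in> vball 1"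
    using complete_basis[OF sr(3) s(1) sr(2) s(2)] by blast
  have s2v: "s2 \<in> vball (1 - int j)" using s2 s vball_divide_iff[of s s2 1] by simp
  have NR: "inR s2" "inR r2" and Ndet: "s * r2 - r * s2 = 1" using N by (auto simp: SL2R_def)
  let ?g = "\<lambda>(i :: nat, (e, d), t). mmul (t, e, (t * d - 1) / e, d) (s, r, s2, r2)"
  let ?h = "\<lambda>M. case mmul M (minv (s, r, s2, r2)) of (t, e, c, d) \<Rightarrow> (nat (- fls_subdegree e), (e, d), t)"
  \<comment> \<open>Writing the matrix as \<open>(t, e; c', d')\<close> times the fixed completion
    of \<open>(s, r)\<close>, the determinant of the left factor gives
    \<open>c * e - d' * a = - s\<close>.\<close>
  have key: "c / a - d' / e = - s / (a * e)"
    if "a = t * s + e * s2" "c = c' * s + d' * s2" "t * d' - e * c' = 1" "a \<noteq> 0" "e \<noteq> 0" for a c t e c' d'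
  proof -
    have "c * e - d' * a = - s * (t * d' - e * c')" by (simp add: that(1,2) algebra_simps)
    then have "c * e - d' * a = - s" using that(3) by simp
    moreover have "c / a - d' / e = (c * e - d' * a) / (a * e)" using that(4,5) by (simp add: field_simps)
    ultimately show ?thesis by simp
  qed
  \<comment> \<open>The valuation is at least \<open>n - j\<close>, and \<open>j \<le> k\<close>
    with \<open>k + m \<le> n\<close> makes this at least \<open>m\<close>, even for constant
    \<open>e\<close>.\<close>
  have small: "s / (a * e) \<in> vball (int m)" if "a \<in> Rdeg n" "inR e" "e \<noteq> 0" for a e
  proof -
    have "a \<noteq> 0" "fls_subdegree a = - int n" using that by (auto simp: Rdeg_def)
    then show ?thesis using that s inR_subdegree_le[OF that(2)] jk n
      by (simp add: vball_iff fls_subdegree_divide)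
  qed
  have fwd: "?h M \<in> ?T \<and> ?g (?h M) = M \<and> (case ?h M of (i, (e, d'), t) \<Rightarrow> case M of (a, b, c, d) \<Rightarrow> \<phi> (c / a) = \<phi> (d' / e))"
    if M: "M \<in> ?M" for M
  proof -
    obtain a b c d where Me: "M = (a, b, c, d)" by (cases M)
    have MM: "(a, b, c, d) \<in> mats v n" and sb: "s * (b / a) - r \<in> vball (int k + 1)" using M by (auto simp: Me)
    have SM: "M \<in> SL2R" and a: "a \<in> Rdeg n" "c / a \<in> vball 1" using MM by (auto simp: Me mats_def)
    have a0: "a \<noteq> 0" "inR a" "fls_subdegree a = - int n" using a by (auto simp: Rdeg_def)
    obtain t e c' d' where Q: "mmul M (minv (s, r, s2, r2)) = (t, e, c', d')"
      by (cases "mmul M (minv (s, r, s2, r2))")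
    have SQ: "(t, e, c', d') \<in> SL2R" using SL2R_mmul[OF SM SL2R_minv[OF N]] by (simp only: Q)
    have prod: "mmul (t, e, c', d') (s, r, s2, r2) = M" using mmul_minv(2)[OF N, of M] by (simp only: Q)
    then have ae: "a = t * s + e * s2" "c = c' * s + d' * s2" by (auto simp: Me)
    have e: "e = s * b - r * a" using Q by (simp add: Me algebra_simps)
    have R: "inR t" "inR e" "inR c'" "inR d'" and det: "t * d' - e * c' = 1" using SQ by (auto simp: SL2R_def)
    have "e / a = s * (b / a) - r" using a0 by (simp add: e field_simps)
    then have ea: "e \<in> vball (int k + 1 - int n)" using sb a0 vball_divide_iff[of a e "int k + 1"] by simp
    \<comment> \<open>The correction \<open>e * s2\<close> has degree below \<open>n\<close>, so
      \<open>t * s\<close> has the degree of \<open>a\<close>, and this fixes the degree of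
      \<open>t\<close> as \<open>n - j\<close>.\<close>
    have "t * s - a = - (e * s2)" by (simp add: ae)
    moreover have "e * s2 \<in> vball (1 - int n)" by (rule vball_mult_le[OF ea s2v]) (use jk in simp)
    ultimately have "t * s \<in> Rdeg n" using R s by (intro Rdeg_cong[OF a(1)]) (auto intro: inR_intros)
    then have tn: "t \<in> Rdeg (n - j)" using R s jk n by (auto simp: Rdeg_def of_nat_diff)
    \<comment> \<open>If \<open>e\<close> were zero, \<open>t\<close> would be a unit of the
      polynomial ring, whereas its degree \<open>n - j\<close> is at least
      \<open>m \<ge> 1\<close>.\<close>
    have e0: "e \<noteq> 0"
    proof
      assume "e = 0"
      then have td: "t * d' = 1" using det by simp
      then have "d' \<noteq> 0" "t \<noteq> 0" by auto
      then have "fls_subdegree t + fls_subdegree d' = 0" using fls_subdegree_mult[of t d'] td by simp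
      then have "fls_subdegree t \<ge> 0" using inR_subdegree_le[OF R(4)] by simp
      then show False using tn jk n m by (auto simp: Rdeg_def of_nat_diff)
    qed
    define i where "i = nat (- fls_subdegree e)"
    have ei: "e \<in> Rdeg i" using R e0 inR_subdegree_le[OF R(2)] by (simp add: Rdeg_def i_def)
    have i: "i < n - k" using ea ei n m Rdeg_vball[OF ei] by auto
    have cd: "c / a - d' / e \<in> vball (int m)"
      using key[OF ae det a0(1) e0] small[OF a(1) R(2) e0] by (simp del: minus_divide_left)
    then have de: "d' / e \<in> vball 1" using vball_cong[OF vball_mono[OF cd, of 1]] a m by simp
    have "cop e d'" unfolding cop_def using R det by (intro exI[of _ "- c'"] exI[of _ t]) (auto intro: inR_intros simp: algebra_simps)
    then have "(e, d') \<in> red_pairs 1 i" using ei R de by (simp add: red_pairs_def frac_pairs_def)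
    moreover have "t \<in> ?F e d'" using tn R det by blast
    ultimately have "(i, (e, d'), t) \<in> ?T" using i by simp
    moreover have hM: "?h M = (i, (e, d'), t)" by (simp only: Q case_prod_conv i_def)
    moreover have "c' = (t * d' - 1) / e" using det e0 by (simp add: field_simps)
    then have "?g (i, (e, d'), t) = M" using prod by simp
    moreover have "\<phi> (c / a) = \<phi> (d' / e)" using \<phi>[OF a(2) de cd] .
    ultimately show ?thesis by (simp only: hM Me case_prod_conv simp_thms)
  qed
  have bwd: "?g z \<in> ?M \<and> ?h (?g z) = z" if z: "z \<in> ?T" for z
  proof -
    obtain i e d' t where ze: "z = (i, (e, d'), t)" by (cases z) auto
    have i: "i < n - k" and ed: "(e, d') \<in> red_pairs 1 i" and tn: "t \<in> Rdeg (n - j)" using z by (auto simp: ze)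
    obtain c' where c': "inR c'" "t * d' - e * c' = 1" using z by (auto simp: ze)
    have e: "e \<in> Rdeg i" "inR d'" "d' / e \<in> vball 1" using ed by (auto simp: red_pairs_def frac_pairs_def)
    have e0: "e \<noteq> 0" "inR e" "fls_subdegree e = - int i" using e by (auto simp: Rdeg_def)
    have tR: "inR t" using tn by (simp add: Rdeg_def)
    have c'e: "(t * d' - 1) / e = c'" using c' e0 by (simp add: field_simps)
    have SQ: "(t, e, c', d') \<in> SL2R" using c' e e0 tR by (simp add: SL2R_def)
    define a where "a = t * s + e * s2"
    define b where "b = t * r + e * r2"
    define c where "c = c' * s + d' * s2"
    define d where "d = c' * r + d' * r2"
    have gz: "?g z = (a, b, c, d)" by (simp only: ze case_prod_conv c'e mmul.simps a_def b_def c_def d_def)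
    have SM: "(a, b, c, d) \<in> SL2R" using SL2R_mmul[OF SQ N] by (simp add: a_def b_def c_def d_def)
    have tsn: "t * s \<in> Rdeg n" using Rdeg_mult[OF tn, of s j] sr(1) jk n by (auto simp: Rmonic_def)
    have "e * s2 \<in> vball (1 - int n)"
      by (rule vball_mult_le[of _ "- int i" _ "1 - int j"]) (use e0 s2v jk i in \<open>auto simp: vball_iff\<close>)
    then have an: "a \<in> Rdeg n" using SM by (intro Rdeg_cong[OF tsn]) (auto simp: SL2R_def a_def)
    have a0: "a \<noteq> 0" "fls_subdegree a = - int n" using an by (auto simp: Rdeg_def)
    have "s * b - r * a = e * (s * r2 - r * s2)" by (simp add: a_def b_def algebra_simps)
    then have sbr: "s * (b / a) - r = e / a" using a0 Ndet by (simp add: field_simps)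
    have sb: "s * (b / a) - r \<in> vball (int k + 1)"
      unfolding sbr using a0 e0 i by (simp add: vball_iff fls_subdegree_divide)
    have "b / a - r / s = (s * (b / a) - r) / s" using s by (simp add: field_simps)
    then have "b / a - r / s \<in> vball 1" using sb s vball_divide_iff[of s _ 1] by (auto intro: vball_mono)
    then have ba: "b / a \<in> vball v" using vball_cong[OF vball_mono[OF _ v]] sr(4) by blast
    have "c / a - d' / e \<in> vball (int m)"
      using key[OF a_def c_def c'(2) a0(1) e0(1)] small[OF an e0(2,1)] by (simp del: minus_divide_left)
    then have "c / a \<in> vball 1" using vball_cong[OF vball_mono[of _ "int m" 1]] e(3) m by auto
    then have "(a, b, c, d) \<in> mats v n" using SM an ba by (simp add: mats_def)
    then have "?g z \<in> ?M" unfolding gz using sb by simp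
    moreover have "mmul (?g z) (minv (s, r, s2, r2)) = (t, e, c', d')"
      unfolding ze prod.case c'e using mmul_minv(1)[OF N] .
    then have "?h (?g z) = z" using e0 by (simp only: case_prod_conv ze) simp
    ultimately show ?thesis by blast
  qed
  have bij: "bij_betw ?h ?M ?T"
  proof (rule bij_betw_byWitness[where f' = ?g])
    show "\<forall>M\<in>?M. ?g (?h M) = M" by (intro ballI conjunct1[OF conjunct2[OF fwd]])
    show "\<forall>z\<in>?T. ?h (?g z) = z" by (intro ballI conjunct2[OF bwd])
    show "?h ` ?M \<subseteq> ?T" by (intro image_subsetI conjunct1[OF fwd])
    show "?g ` ?T \<subseteq> ?M" by (intro image_subsetI conjunct1[OF bwd])
  qed
  let ?w = "\<lambda>z :: ('a fls \<times> 'a fls) \<times> 'a fls. \<phi> (snd (fst z) / fst (fst z))"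
  have "(\<Sum>(a, b, c, d)\<in>?M. \<phi> (c / a)) = (\<Sum>M\<in>?M. ?w (snd (?h M)))"
  proof (rule sum.cong[OF refl])
    fix M assume "M \<in> ?M"
    then show "(case M of (a, b, c, d) \<Rightarrow> \<phi> (c / a)) = ?w (snd (?h M))"
      using fwd[of M] by (auto simp: case_prod_beta)
  qed
  also have "\<dots> = (\<Sum>z\<in>?T. ?w (snd z))"
    by (rule sum.reindex_bij_betw[OF bij, of "\<lambda>z. ?w (snd z)"])
  also have "\<dots> = (\<Sum>(i, z)\<in>?T. ?w z)" by (simp add: case_prod_beta)
  also have "\<dots> = (\<Sum>i<n - k. \<Sum>z\<in>(SIGMA p:red_pairs 1 i. ?F (fst p) (snd p)). ?w z)"
    by (rule sum.Sigma[symmetric]) (auto simp: finite_red_pairs intro!: finite_SigmaI)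
  also have "\<dots> = (\<Sum>i<n - k. \<Sum>p\<in>red_pairs 1 i. \<Sum>t\<in>?F (fst p) (snd p). \<phi> (snd p / fst p))"
  proof (rule sum.cong[OF refl])
    fix i
    show "(\<Sum>z\<in>(SIGMA p:red_pairs 1 i. ?F (fst p) (snd p)). ?w z)
      = (\<Sum>p\<in>red_pairs 1 i. \<Sum>t\<in>?F (fst p) (snd p). \<phi> (snd p / fst p))"
      by (subst sum.Sigma) (auto simp: finite_red_pairs case_prod_beta)
  qed
  also have "\<dots> = (\<Sum>i<n - k. \<Sum>p\<in>red_pairs 1 i. (real CARD('a) - 1) * real CARD('a) ^ (n - j - i) * \<phi> (snd p / fst p))"
  proof (intro sum.cong refl)
    fix i and p :: "'a fls \<times> 'a fls" assume i: "i \<in> {..<n - k}" and p: "p \<in> red_pairs 1 i"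
    have "real (card (?F (fst p) (snd p))) = (real CARD('a) - 1) * real CARD('a) ^ (n - j - i)"
      using card_bezout_fibre[of "fst p" "snd p" i "n - j"] p i jk by simp
    then show "(\<Sum>t\<in>?F (fst p) (snd p). \<phi> (snd p / fst p)) = (real CARD('a) - 1) * real CARD('a) ^ (n - j - i) * \<phi> (snd p / fst p)"
      by simp
  qed
  finally show ?thesis by (simp add: sum_distrib_left case_prod_beta)
qed

section \<open>Equidistribution of matrices\<close>

lemma card_red_pairs_le: "real (card (red_pairs 1 i :: ('a::{finite,field} fls \<times> 'a fls) set)) \<le> real CARD('a) ^ (2 * i + 1)"
proof -
  have "(red_pairs 1 i :: ('a fls \<times> 'a fls) set) \<subseteq> digits (- int i) 1 \<times> digits (1 - int i) 1"
    by (auto simp: red_pairs_def frac_pairs_def Rdeg_vball_divide Rdeg_eq digits_def inR_iff_low)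
  then have "card (red_pairs 1 i :: ('a fls \<times> 'a fls) set) \<le> card (digits (- int i) 1 \<times> digits (1 - int i) 1 :: ('a fls \<times> 'a fls) set)"
    by (rule card_mono[rotated]) simp
  also have "\<dots> = CARD('a) ^ Suc i * CARD('a) ^ i"
  proof -
    have "nat (1 - - int i) = Suc i" "nat (1 - (1 - int i)) = i" by auto
    then show ?thesis by (simp add: card_cartesian_product card_digits)
  qed
  also have "\<dots> = CARD('a) ^ (2 * i + 1)" by (simp add: power_add mult_2)
  finally show ?thesis by (simp only: of_nat_le_iff flip: of_nat_power)
qed

text \<open>The centres of the Dirichlet balls of order \<open>m\<close> that cover
  \<open>vball v\<close>. A centre lies at distance below 1 from the points that it approximates,
  hence in \<open>vball v\<close> itself because \<open>v \<le> 1\<close>.\<close>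

definition approximants :: "int \<Rightarrow> nat \<Rightarrow> ('a::{finite,field} fls \<times> 'a fls) set" where
  "approximants v m = {(s, r). \<exists>j\<le>m. s \<in> Rmonic j \<and> inR r \<and> cop s r \<and> r / s \<in> vball v}"

lemma approximants_subset:
  "0 \<le> v \<Longrightarrow> approximants v m \<subseteq> digits (- int m) 1 \<times> digits (- int m) 1"
  by (auto simp: approximants_def Rmonic_def digits_def inR_iff_low Rdeg_vball Rdeg_vball_divide intro: vball_mono)
     (auto simp: Rdeg_def inR_iff_low)

lemma approximant_ex1:
  fixes be :: "'a::{finite,field} fls"
  assumes "be \<in> vball v" "v \<le> 1"
  shows "\<exists>!p. p \<in> approximants v m \<and> fst p * be - snd p \<in> vball (int m + 1)"
proof -
  obtain s r where sr: "inR s" "inR r" "monic s" "s \<in> vball (- int m)" "cop s r" "s * be - r \<in> vball (int m + 1)"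
    using dirichlet_exists[of m be] by blast
  have s0: "s \<noteq> 0" using sr by (auto simp: monic_def)
  have sd: "fls_subdegree s \<le> 0" using sr inR_subdegree_le by blast
  define j where "j = nat (- fls_subdegree s)"
  have j: "s \<in> Rmonic j" "j \<le> m" using sr s0 sd by (auto simp: Rmonic_def Rdeg_def j_def vball_iff)
  have "be - r / s = (s * be - r) / s" using s0 by (simp add: field_simps)
  then have "be - r / s \<in> vball 1" using sr(6) s0 sd vball_divide_iff[of s "s * be - r" 1] by (auto intro: vball_mono)
  then have "r / s \<in> vball v" using vball_cong[OF vball_mono[OF _ assms(2)]] assms(1) by blast
  then have "(s, r) \<in> approximants v m" using sr j by (auto simp: approximants_def)
  moreover have "p = (s, r)" if p: "p \<in> approximants v m" "fst p * be - snd p \<in> vball (int m + 1)" for p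
  proof -
    obtain s' r' where pe: "p = (s', r')" by (cases p)
    have "inR s'" "inR r'" "monic s'" "s' \<in> vball (- int m)" "cop s' r'"
      using p(1) by (auto simp: pe approximants_def Rmonic_def Rdeg_def vball_iff)
    then show ?thesis using dirichlet_unique[of s' r' m be s r] sr p(2) by (simp add: pe)
  qed
  moreover have "fst (s, r) * be - snd (s, r) \<in> vball (int m + 1)" using sr(6) by simp
  ultimately show ?thesis by blast
qed

text \<open>The loss comes from at most \<open>CARD('a)^(2m + 2)\<close> approximants and, in each
  of their balls, from the few factors whose entry \<open>e\<close> has degree below
  \<open>m\<close>. For larger degrees the fractions \<open>d / e\<close> are exactly
  equidistributed at level \<open>m\<close>.\<close>

lemma theta_mean_zero_bound:
  fixes \<phi> :: "'a::{finite,field} fls \<Rightarrow> 'a fls \<Rightarrow> real"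
  assumes m: "1 \<le> m" "2 * m \<le> n" and v: "0 \<le> v" "v \<le> 1"
    and cong: "\<And>x x' y y'. x \<in> vball v \<Longrightarrow> x' \<in> vball v \<Longrightarrow> y \<in> vball 1 \<Longrightarrow> y' \<in> vball 1 \<Longrightarrow>
      x - x' \<in> vball (int m) \<Longrightarrow> y - y' \<in> vball (int m) \<Longrightarrow> \<phi> x y = \<phi> x' y'"
    and bound: "\<And>x y. x \<in> vball v \<Longrightarrow> y \<in> vball 1 \<Longrightarrow> \<bar>\<phi> x y\<bar> \<le> K"
    and mean: "\<And>x. x \<in> vball v \<Longrightarrow> (\<Sum>y\<in>digits 1 (int m). \<phi> x y) = 0"
  shows "\<bar>\<Sum>(a, b, c, d)\<in>mats v n. \<phi> (b / a) (c / a)\<bar> \<le> K * real CARD('a) ^ (n + 4 * m + 3)"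
proof -
  let ?P = "approximants v m :: ('a fls \<times> 'a fls) set"
  let ?q = "real CARD('a)"
  define F where "F = (\<lambda>(a, b, c, d :: 'a fls). \<phi> (b / a) (c / a))"
  define A where "A p = {(a, b, c, d) \<in> mats v n. fst p * (b / a) - snd p \<in> vball (int m + 1)}" for p :: "'a fls \<times> 'a fls"
  have q2: "?q \<ge> 2" using card_field_ge_2[where 'a='a] by simp
  have K0: "K \<ge> 0" using bound[of 0 0] by simp
  have finP: "finite ?P" using approximants_subset[OF v(1), of m] by (rule finite_subset) simp
  have cardP: "real (card ?P) \<le> ?q ^ (2 * m + 2)"
  proof -
    have "card ?P \<le> card (digits (- int m) 1 \<times> digits (- int m) 1 :: ('a fls \<times> 'a fls) set)"
      by (rule card_mono[OF _ approximants_subset[OF v(1)]]) simp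
    also have "\<dots> = CARD('a) ^ Suc m * CARD('a) ^ Suc m"
    proof -
      have "nat (1 - - int m) = Suc m" by auto
      then show ?thesis by (simp add: card_cartesian_product card_digits)
    qed
    also have "\<dots> = CARD('a) ^ (2 * m + 2)" by (simp add: power_add mult_2)
    finally show ?thesis by (simp only: of_nat_le_iff flip: of_nat_power)
  qed
  have "(\<Sum>M\<in>mats v n. F M) = (\<Sum>M\<in>mats v n. \<Sum>p\<in>?P. if M \<in> A p then F M else 0)"
  proof (rule sum.cong[OF refl])
    fix M :: "'a mat" assume M: "M \<in> mats v n"
    obtain a b c d where Me: "M = (a, b, c, d)" by (cases M)
    have "b / a \<in> vball v" using M by (simp add: Me mats_def)
    then obtain p where p: "p \<in> ?P" "fst p * (b / a) - snd p \<in> vball (int m + 1)"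
      and uniq: "\<And>p'. p' \<in> ?P \<Longrightarrow> fst p' * (b / a) - snd p' \<in> vball (int m + 1) \<Longrightarrow> p' = p"
      using approximant_ex1[of "b / a" v m] v(2) by blast
    have "(\<Sum>p'\<in>?P. if M \<in> A p' then F M else 0) = (\<Sum>p'\<in>?P. if p' = p then F M else 0)"
    proof (rule sum.cong[OF refl])
      fix p' assume p': "p' \<in> ?P"
      have "M \<in> A p' \<longleftrightarrow> fst p' * (b / a) - snd p' \<in> vball (int m + 1)" using M by (simp add: A_def Me)
      also have "\<dots> \<longleftrightarrow> p' = p" using uniq[OF p'] p by blast
      finally show "(if M \<in> A p' then F M else 0) = (if p' = p then F M else 0)" by simp
    qed
    then show "F M = (\<Sum>p\<in>?P. if M \<in> A p then F M else 0)" using finP p(1) by simp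
  qed
  also have "\<dots> = (\<Sum>p\<in>?P. \<Sum>M\<in>mats v n. if M \<in> A p then F M else 0)" by (rule sum.swap)
  also have "\<dots> = (\<Sum>p\<in>?P. \<Sum>M\<in>A p. F M)"
  proof (rule sum.cong[OF refl])
    fix p
    have "{M \<in> mats v n. M \<in> A p} = A p" by (auto simp: A_def)
    then show "(\<Sum>M\<in>mats v n. if M \<in> A p then F M else 0) = (\<Sum>M\<in>A p. F M)"
      by (simp add: sum.inter_filter[OF finite_mats, symmetric])
  qed
  finally have split: "(\<Sum>M\<in>mats v n. F M) = (\<Sum>p\<in>?P. \<Sum>M\<in>A p. F M)" .
  have each: "\<bar>\<Sum>M\<in>A p. F M\<bar> \<le> K * ?q ^ (n + 2 * m + 1)" if pP: "p \<in> ?P" for p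
  proof -
    obtain s r where pe: "p = (s, r)" by (cases p)
    obtain j where j: "j \<le> m" "s \<in> Rmonic j" "inR r" "cop s r" "r / s \<in> vball v"
      using pP by (auto simp: pe approximants_def)
    have s0: "s \<noteq> 0" "fls_subdegree s = - int j" using j by (auto simp: Rmonic_def Rdeg_def)
    have "(\<Sum>M\<in>A p. F M) = (\<Sum>(a, b, c, d)\<in>A p. \<phi> (r / s) (c / a))"
    proof (rule sum.cong[OF refl])
      fix M assume M: "M \<in> A p"
      obtain a b c d where Me: "M = (a, b, c, d)" by (cases M)
      have *: "b / a \<in> vball v" "c / a \<in> vball 1" "s * (b / a) - r \<in> vball (int m + 1)"
        using M by (auto simp: Me A_def pe mats_def)
      have "b / a - r / s = (s * (b / a) - r) / s" using s0 by (simp add: field_simps)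
      \<comment> \<open>On a Dirichlet ball \<open>b / a\<close> equals \<open>r / s\<close> to
        level \<open>m\<close>, so the first argument of \<open>\<phi>\<close> can be
        frozen.\<close>
      then have "b / a - r / s \<in> vball (int m)"
        using *(3) s0 vball_divide_iff[of s _ "int m"] by (auto intro: vball_mono)
      then have "\<phi> (b / a) (c / a) = \<phi> (r / s) (c / a)" using cong[OF *(1) j(5) *(2) *(2)] by simp
      then show "F M = (case M of (a, b, c, d) \<Rightarrow> \<phi> (r / s) (c / a))" by (simp add: F_def Me)
    qed
    also have "\<dots> = (\<Sum>i<n - m. (?q - 1) * ?q ^ (n - j - i) * (\<Sum>(e, d)\<in>red_pairs 1 i. \<phi> (r / s) (d / e)))"
      unfolding A_def pe fst_conv snd_conv
    proof (rule dirichlet_ball_sum[OF j(2-5) j(1) _ m(1) v(2)])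
      show "m + m \<le> n" using m by simp
      show "\<phi> (r / s) x = \<phi> (r / s) y" if "x \<in> vball 1" "y \<in> vball 1" "x - y \<in> vball (int m)" for x y
        using cong[OF j(5) j(5) that(1,2) _ that(3)] by simp
    qed
    finally have eq: "(\<Sum>M\<in>A p. F M) = \<dots>" .
    have summand: "\<bar>(?q - 1) * ?q ^ (n - j - i) * (\<Sum>(e, d)\<in>red_pairs 1 i. \<phi> (r / s) (d / e))\<bar>
        \<le> (if i < m then K * ?q ^ (n + m + 1) else 0)" if i: "i < n - m" for i
    \<comment> \<open>For \<open>m \<le> i\<close> the exact formula \<open>red_sum\<close> applies
      and the mean over the digits is zero; below \<open>m\<close> the terms are bounded by counting
      pairs.\<close>
    proof (cases "i < m")
      case True
      have "\<bar>\<Sum>(e, d)\<in>red_pairs 1 i. \<phi> (r / s) (d / e)\<bar> \<le> (\<Sum>(e, d)\<in>(red_pairs 1 i :: ('a fls \<times> 'a fls) set). K)"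
      proof (rule order_trans[OF sum_abs sum_mono])
        fix z :: "'a fls \<times> 'a fls" assume "z \<in> red_pairs 1 i"
        then show "\<bar>case z of (e, d) \<Rightarrow> \<phi> (r / s) (d / e)\<bar> \<le> (case z of (e, d) \<Rightarrow> K)"
          using bound[OF j(5)] by (auto simp: red_pairs_def frac_pairs_def)
      qed
      also have "\<dots> = real (card (red_pairs 1 i :: ('a fls \<times> 'a fls) set)) * K" by (simp add: case_prod_beta)
      also have "\<dots> \<le> ?q ^ (2 * i + 1) * K" using card_red_pairs_le K0 by (rule mult_right_mono)
      finally have 1: "\<bar>\<Sum>(e, d)\<in>red_pairs 1 i. \<phi> (r / s) (d / e)\<bar> \<le> ?q ^ (2 * i + 1) * K" .
      have "\<bar>(?q - 1) * ?q ^ (n - j - i) * (\<Sum>(e, d)\<in>red_pairs 1 i. \<phi> (r / s) (d / e))\<bar>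
          \<le> ?q * ?q ^ (n - j - i) * (?q ^ (2 * i + 1) * K)"
        unfolding abs_mult by (intro mult_mono 1) (use q2 in auto)
      also have "\<dots> = K * ?q ^ (1 + (n - j - i) + (2 * i + 1))" by (simp add: power_add)
      also have "\<dots> \<le> K * ?q ^ (n + m + 1)"
        using K0 q2 True i by (intro mult_left_mono power_increasing) auto
      finally show ?thesis using True by simp
    next
      case False
      have "(\<Sum>(e, d)\<in>red_pairs 1 i. \<phi> (r / s) (d / e)) =
        (?q - 1)\<^sup>2 * ?q ^ (2 * i - m) * (\<Sum>y\<in>digits 1 (int m). \<phi> (r / s) y)"
      proof (rule red_sum)
        show "\<phi> (r / s) x = \<phi> (r / s) y" if "x \<in> vball 1" "y \<in> vball 1" "x - y \<in> vball (int m)" for x y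
          using cong[OF j(5) j(5) that(1,2) _ that(3)] by simp
      qed (use False m in auto)
      then show ?thesis using mean[OF j(5)] False by simp
    qed
    have "\<bar>\<Sum>M\<in>A p. F M\<bar> \<le> (\<Sum>i<n - m. if i < m then K * ?q ^ (n + m + 1) else 0)"
      unfolding eq by (rule order_trans[OF sum_abs sum_mono]) (use summand in auto)
    also have "\<dots> = real (card {i \<in> {..<n - m}. i < m}) * (K * ?q ^ (n + m + 1))"
      by (simp add: sum.inter_filter[symmetric])
    also have "\<dots> \<le> ?q ^ m * (K * ?q ^ (n + m + 1))"
    proof (rule mult_right_mono)
      have "card {i \<in> {..<n - m}. i < m} \<le> card {..<m}" by (rule card_mono) auto
      \<comment> \<open>The number of surviving terms is absorbed into a power of the field order
        through \<open>m \<le> 2 ^ m\<close>.\<close>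
      also have "\<dots> \<le> 2 ^ m" by (simp add: less_imp_le)
      also have "\<dots> \<le> CARD('a) ^ m" using card_field_ge_2[where 'a='a] by (rule power_mono) simp
      finally show "real (card {i \<in> {..<n - m}. i < m}) \<le> ?q ^ m" by (simp flip: of_nat_power)
    qed (use K0 q2 in auto)
    also have "\<dots> = K * ?q ^ (n + 2 * m + 1)" by (simp add: power_add mult_2)
    finally show ?thesis .
  qed
  have "\<bar>\<Sum>M\<in>mats v n. F M\<bar> \<le> (\<Sum>p\<in>?P. K * ?q ^ (n + 2 * m + 1))"
    unfolding split by (rule order_trans[OF sum_abs sum_mono]) (use each in auto)
  also have "\<dots> = real (card ?P) * (K * ?q ^ (n + 2 * m + 1))" by simp
  also have "\<dots> \<le> ?q ^ (2 * m + 2) * (K * ?q ^ (n + 2 * m + 1))"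
    using cardP K0 by (intro mult_right_mono) auto
  also have "\<dots> = K * ?q ^ ((2 * m + 2) + (n + 2 * m + 1))" by (simp only: power_add mult_ac)
  also have "(2 * m + 2) + (n + 2 * m + 1) = n + 4 * m + 3" by simp
  finally show ?thesis by (simp add: F_def)
qed

lemma units_eq: "m \<ge> 1 \<Longrightarrow> units m = digits 0 (int m) - digits 1 (int m)"
  by (auto simp: units_def unitO_iff digits_def)

lemma card_units: "m \<ge> 1 \<Longrightarrow> real (card (units m :: 'a::{finite,field} fls set)) = (real CARD('a) - 1) * real CARD('a) ^ (m - 1)"
proof -
  assume m: "m \<ge> 1"
  have sub: "digits 1 (int m) \<subseteq> (digits 0 (int m) :: 'a fls set)" by (auto simp: digits_def intro: vball_mono)
  have n: "nat (int m - 1) = m - 1" using m by simp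
  obtain k where k: "m = Suc k" using m by (cases m) auto
  have "card (units m :: 'a fls set) = CARD('a) ^ m - CARD('a) ^ (m - 1)"
    unfolding units_eq[OF m] by (subst card_Diff_subset[OF _ sub]) (auto simp: card_digits n)
  moreover have "CARD('a) ^ (m - 1) \<le> CARD('a) ^ m" by (simp add: k)
  ultimately show ?thesis by (simp add: of_nat_diff algebra_simps k)
qed

lemma abs_mean_le:
  fixes f :: "'b \<Rightarrow> real"
  assumes "\<And>x. x \<in> A \<Longrightarrow> \<bar>f x\<bar> \<le> K" "K \<ge> 0"
  shows "\<bar>(\<Sum>x\<in>A. f x) / real (card A)\<bar> \<le> K"
proof (cases "card A = 0")
  case False
  have "\<bar>\<Sum>x\<in>A. f x\<bar> \<le> (\<Sum>x\<in>A. K)" by (rule order_trans[OF sum_abs sum_mono]) (use assms in auto)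
  then show ?thesis using False by (simp add: field_simps)
qed (use assms in auto)

text \<open>Telescoping through conditional means: \<open>f1\<close> averages over \<open>u\<close>,
  and \<open>f2\<close> averages \<open>f1\<close> over \<open>c / a\<close>. Then
  \<open>\<phi> - f1\<close> has mean zero in \<open>u\<close>, \<open>f1 - f2\<close> has mean zero
  in \<open>c / a\<close>, and \<open>f2\<close> depends on \<open>b / a\<close> alone, where the
  count is exact and produces the main term.\<close>

lemma mats_equidistribution:
  fixes \<phi> :: "'a::{finite,field} fls \<Rightarrow> 'a fls \<Rightarrow> 'a fls \<Rightarrow> real"
  assumes m: "1 \<le> m" "2 * m \<le> n" and v: "0 \<le> v" "v \<le> 1"
    and cong: "\<And>u u' x x' y y'. unitO u \<Longrightarrow> unitO u' \<Longrightarrow> x \<in> vball v \<Longrightarrow> x' \<in> vball v \<Longrightarrow> y \<in> vball 1 \<Longrightarrow> y' \<in> vball 1 \<Longrightarrow>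
      u - u' \<in> vball (int m) \<Longrightarrow> x - x' \<in> vball (int m) \<Longrightarrow> y - y' \<in> vball (int m) \<Longrightarrow> \<phi> u x y = \<phi> u' x' y'"
    and bound: "\<And>u x y. unitO u \<Longrightarrow> x \<in> vball v \<Longrightarrow> y \<in> vball 1 \<Longrightarrow> \<bar>\<phi> u x y\<bar> \<le> K"
  shows "\<bar>(\<Sum>(a, b, c, d)\<in>mats v n. \<phi> (a * fls_X_intpow (int n)) (b / a) (c / a))
      - (real CARD('a) - 1) * real CARD('a) ^ (2 * n + 2) / real CARD('a) ^ (3 * m)
        * (\<Sum>u\<in>units m. \<Sum>x\<in>digits v (int m). \<Sum>y\<in>digits 1 (int m). \<phi> u x y)\<bar>
    \<le> 4 * K * real CARD('a) ^ (n + 5 * m + 3)"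
proof -
  let ?q = "real CARD('a)" and ?X = "fls_X_intpow (int n) :: 'a fls"
  let ?U = "units m :: 'a fls set" and ?D = "digits v (int m) :: 'a fls set" and ?E = "digits 1 (int m) :: 'a fls set"
  have q2: "?q \<ge> 2" using card_field_ge_2[where 'a='a] by simp
  have K0: "K \<ge> 0" using bound[of 1 0 0] by simp
  have vm: "v \<le> int m" using m v by simp
  have UD: "unitO u" "u \<in> low (int m)" if "u \<in> ?U" for u using that by (auto simp: units_def digits_def)
  have DD: "x \<in> vball v" "x \<in> low (int m)" if "x \<in> ?D" for x using that by (auto simp: digits_def)
  have ED: "y \<in> vball 1" "y \<in> low (int m)" if "y \<in> ?E" for y using that by (auto simp: digits_def)
  define f1 where "f1 x y = (\<Sum>u\<in>?U. \<phi> u x y) / real (card ?U)" for x y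
  define f2 where "f2 x = (\<Sum>y\<in>?E. f1 x y) / real (card ?E)" for x
  have cU: "real (card ?U) = (?q - 1) * ?q ^ (m - 1)" using card_units[OF m(1)] .
  have cU0: "real (card ?U) > 0" unfolding cU using q2 by simp
  have "nat (int m - 1) = m - 1" using m by simp
  then have cE: "real (card ?E) = ?q ^ (m - 1)" by (simp add: card_digits)
  have f1_cong: "f1 x y = f1 x' y'" if "x \<in> vball v" "x' \<in> vball v" "y \<in> vball 1" "y' \<in> vball 1"
    "x - x' \<in> vball (int m)" "y - y' \<in> vball (int m)" for x x' y y'
    unfolding f1_def using that cong[of _ _ x x' y y'] UD(1)
    by (intro arg_cong2[where f = "(/)"] sum.cong refl) auto
  have f1_bound: "\<bar>f1 x y\<bar> \<le> K" if "x \<in> vball v" "y \<in> vball 1" for x y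
    unfolding f1_def by (rule abs_mean_le) (use bound UD K0 that in auto)
  have f2_cong: "f2 x = f2 x'" if "x \<in> vball v" "x' \<in> vball v" "x - x' \<in> vball (int m)" for x x'
    unfolding f2_def using that f1_cong[of x x'] ED(1)
    by (intro arg_cong2[where f = "(/)"] sum.cong refl) auto
  have f2_bound: "\<bar>f2 x\<bar> \<le> K" if "x \<in> vball v" for x
    unfolding f2_def by (rule abs_mean_le) (use f1_bound ED K0 that in auto)

  define F where "F = (\<lambda>(a, b, c, d :: 'a fls). \<phi> (a * ?X) (b / a) (c / a) - f1 (b / a) (c / a))"
  define G where "G = (\<lambda>(x0 :: 'a fls, y0). {(a, b, c, d) \<in> mats v n. b / a - x0 \<in> vball (int m) \<and> c / a - y0 \<in> vball (int m)})"
  \<comment> \<open>On one cell of level \<open>m\<close> for \<open>(b / a, c / a)\<close> only the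
    dependence on \<open>u\<close> remains. The at most \<open>CARD('a)^(2m)\<close> cells then turn
    \<open>3 * m\<close> into \<open>5 * m\<close>.\<close>
  have each: "\<bar>\<Sum>M\<in>G (x0, y0). F M\<bar> \<le> 2 * K * ?q ^ (n + 3 * m)" if xy: "x0 \<in> ?D" "y0 \<in> ?E" for x0 y0
  proof -
    define \<psi> where "\<psi> u = \<phi> u x0 y0 - f1 x0 y0" for u
    have x0: "x0 \<in> vball v" and y0: "y0 \<in> vball 1" using DD ED xy by auto
    have "(\<Sum>M\<in>G (x0, y0). F M) = (\<Sum>(a, b, c, d)\<in>G (x0, y0). \<psi> (a * ?X))"
    proof (rule sum.cong[OF refl])
      fix M assume M: "M \<in> G (x0, y0)"
      obtain a b c d where Me: "M = (a, b, c, d)" by (cases M)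
      have *: "b / a \<in> vball v" "c / a \<in> vball 1" "b / a - x0 \<in> vball (int m)" "c / a - y0 \<in> vball (int m)" "a \<in> Rdeg n"
        using M by (auto simp: Me G_def mats_def)
      have u: "unitO (a * ?X)" using X_unit[OF *(5)] .
      have "\<phi> (a * ?X) (b / a) (c / a) = \<phi> (a * ?X) x0 y0" using cong[OF u u *(1) x0 *(2) y0] * by simp
      moreover have "f1 (b / a) (c / a) = f1 x0 y0" using f1_cong[OF *(1) x0 *(2) y0 *(3,4)] .
      ultimately show "F M = (case M of (a, b, c, d) \<Rightarrow> \<psi> (a * ?X))" by (simp add: F_def Me \<psi>_def)
    qed
    then have "(\<Sum>M\<in>G (x0, y0). F M)\<^sup>2 = (\<Sum>(a, b, c, d)\<in>G (x0, y0). \<psi> (a * ?X))\<^sup>2" by simp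
    also have "\<dots> \<le> (2 * K)\<^sup>2 * ?q ^ (2 * n + 5 * m)"
      unfolding G_def case_prod_conv
    proof (rule mats_mean_zero_bound[OF m(1) _ vm y0])
      show "m \<le> 2 * n" using m by simp
      show "\<psi> u = \<psi> w" if "unitO u" "unitO w" "u - w \<in> vball (int m)" for u w
        using cong[OF that(1,2) x0 x0 y0 y0] that by (simp add: \<psi>_def)
      show "\<bar>\<psi> u\<bar> \<le> 2 * K" if "unitO u" for u
        using bound[OF that x0 y0] f1_bound[OF x0 y0] by (simp add: \<psi>_def)
      show "(\<Sum>u\<in>units m. \<psi> u) = 0" using cU0 by (simp add: \<psi>_def sum_subtractf f1_def)
    qed
    \<comment> \<open>The exponent \<open>5 * m\<close> is rounded up to \<open>6 * m\<close>, so
      that the bound is a perfect square.\<close>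
    also have "\<dots> \<le> (2 * K)\<^sup>2 * ?q ^ (2 * (n + 3 * m))"
      using q2 by (intro mult_left_mono power_increasing) auto
    also have "\<dots> = (2 * K * ?q ^ (n + 3 * m))\<^sup>2" by (simp only: power_mult_distrib power_mult[symmetric] mult.commute)
    finally have "\<bar>\<Sum>M\<in>G (x0, y0). F M\<bar> \<le> \<bar>2 * K * ?q ^ (n + 3 * m)\<bar>" by (simp only: abs_le_square_iff)
    then show ?thesis using K0 by simp
  qed
  have part1: "\<bar>\<Sum>M\<in>mats v n. F M\<bar> \<le> 2 * K * ?q ^ (n + 5 * m)"
  proof -
    let ?c = "\<lambda>(a, b, c, d :: 'a fls). (cutoff (int m) (b / a), cutoff (int m) (c / a))"
    have "(\<Sum>M\<in>mats v n. F M) = (\<Sum>p\<in>?D \<times> ?E. \<Sum>M\<in>{M \<in> mats v n. ?c M = p}. F M)"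
    proof (rule sum.group[symmetric])
      show "?c ` mats v n \<subseteq> ?D \<times> ?E" by (auto simp: mats_def intro: cutoff_digits)
    qed (simp_all add: finite_mats)
    also have "\<dots> = (\<Sum>p\<in>?D \<times> ?E. \<Sum>M\<in>G p. F M)"
    proof (intro sum.cong refl)
      fix p assume "p \<in> ?D \<times> ?E"
      then obtain x0 y0 where p: "p = (x0, y0)" "x0 \<in> low (int m)" "y0 \<in> low (int m)" using DD ED by auto
      have "cutoff (int m) x = x0 \<longleftrightarrow> x - x0 \<in> vball (int m)" "cutoff (int m) x = y0 \<longleftrightarrow> x - y0 \<in> vball (int m)" for x
        using cutoff_unique[of x0 "int m" x] cutoff_unique[of y0 "int m" x] p diff_cutoff[of x "int m"] by auto
      then show "{M \<in> mats v n. ?c M = p} = G p" by (auto simp: G_def p)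
    qed
    also have "\<bar>\<dots>\<bar> \<le> (\<Sum>p\<in>?D \<times> ?E. 2 * K * ?q ^ (n + 3 * m))"
      by (rule order_trans[OF sum_abs sum_mono]) (use each in auto)
    also have "\<dots> = real (card ?D) * real (card ?E) * (2 * K * ?q ^ (n + 3 * m))"
      by (simp add: card_cartesian_product)
    also have "\<dots> \<le> ?q ^ m * ?q ^ m * (2 * K * ?q ^ (n + 3 * m))"
    proof (intro mult_right_mono mult_mono)
      show "real (card ?D) \<le> ?q ^ m" using v q2 by (auto simp: card_digits intro!: power_increasing)
      show "real (card ?E) \<le> ?q ^ m" using q2 by (auto simp: card_digits intro!: power_increasing)
    qed (use K0 in auto)
    also have "\<dots> = 2 * K * ?q ^ (m + m + (n + 3 * m))" by (simp only: power_add mult_ac)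
    also have "m + m + (n + 3 * m) = n + 5 * m" by simp
    finally show ?thesis .
  qed

  define F2 where "F2 x y = f1 x y - f2 x" for x y
  have part2: "\<bar>\<Sum>(a, b, c, d)\<in>mats v n. F2 (b / a) (c / a)\<bar> \<le> 2 * K * ?q ^ (n + 4 * m + 3)"
  proof (rule theta_mean_zero_bound[OF m v])
    show "F2 x y = F2 x' y'" if "x \<in> vball v" "x' \<in> vball v" "y \<in> vball 1" "y' \<in> vball 1"
      "x - x' \<in> vball (int m)" "y - y' \<in> vball (int m)" for x x' y y'
      unfolding F2_def using f1_cong[OF that] f2_cong[OF that(1,2,5)] by simp
    show "\<bar>F2 x y\<bar> \<le> 2 * K" if "x \<in> vball v" "y \<in> vball 1" for x y
      using f1_bound[OF that] f2_bound[OF that(1)] by (simp add: F2_def)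
    show "(\<Sum>y\<in>?E. F2 x y) = 0" if "x \<in> vball v" for x
      using q2 by (simp add: F2_def sum_subtractf f2_def cE)
  qed

  have part3: "(\<Sum>(a, b, c, d)\<in>mats v n. f2 (b / a)) = (?q - 1)\<^sup>2 * ?q ^ (2 * n - m) * (\<Sum>x\<in>?D. f2 x)"
    using mats_sum_beta[of v m f2 n, OF f2_cong vm] m by simp
  have "(\<Sum>x\<in>?D. f2 x) = (\<Sum>x\<in>?D. \<Sum>y\<in>?E. \<Sum>u\<in>?U. \<phi> u x y) / (real (card ?U) * real (card ?E))"
    by (simp add: f2_def f1_def sum_divide_distrib)
  also have "(\<Sum>x\<in>?D. \<Sum>y\<in>?E. \<Sum>u\<in>?U. \<phi> u x y) = (\<Sum>x\<in>?D. \<Sum>u\<in>?U. \<Sum>y\<in>?E. \<phi> u x y)"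
    by (intro sum.cong refl sum.swap)
  also have "\<dots> = (\<Sum>u\<in>?U. \<Sum>x\<in>?D. \<Sum>y\<in>?E. \<phi> u x y)" by (rule sum.swap)
  finally have s2: "(\<Sum>x\<in>?D. f2 x) = (\<Sum>u\<in>?U. \<Sum>x\<in>?D. \<Sum>y\<in>?E. \<phi> u x y) / ((?q - 1) * ?q ^ (m - 1) * ?q ^ (m - 1))"
    unfolding cU cE .
  have coef: "(?q - 1)\<^sup>2 * ?q ^ (2 * n - m) / ((?q - 1) * ?q ^ (m - 1) * ?q ^ (m - 1)) = (?q - 1) * ?q ^ (2 * n + 2) / ?q ^ (3 * m)"
  proof -
    have "?q ^ (2 * n - m) * ?q ^ (3 * m) = ?q ^ (2 * n + 2) * (?q ^ (m - 1) * ?q ^ (m - 1))"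
    proof -
      have "2 * n - m + 3 * m = 2 * n + 2 + (m - 1 + (m - 1))" using m by simp
      then show ?thesis by (simp only: power_add[symmetric])
    qed
    then show ?thesis using q2 by (simp add: field_simps power2_eq_square)
  qed
  have main: "(\<Sum>(a, b, c, d)\<in>mats v n. f2 (b / a)) = (?q - 1) * ?q ^ (2 * n + 2) / ?q ^ (3 * m)
      * (\<Sum>u\<in>?U. \<Sum>x\<in>?D. \<Sum>y\<in>?E. \<phi> u x y)"
    unfolding part3 s2 coef[symmetric] by (simp only: times_divide_eq_left times_divide_eq_right)
  have "(\<Sum>(a, b, c, d)\<in>mats v n. \<phi> (a * ?X) (b / a) (c / a))
    = (\<Sum>M\<in>mats v n. F M) + (\<Sum>(a, b, c, d)\<in>mats v n. F2 (b / a) (c / a)) + (\<Sum>(a, b, c, d)\<in>mats v n. f2 (b / a))"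
    unfolding sum.distrib[symmetric] by (rule sum.cong) (auto simp: F_def F2_def)
  then have "\<bar>(\<Sum>(a, b, c, d)\<in>mats v n. \<phi> (a * ?X) (b / a) (c / a)) - (\<Sum>(a, b, c, d)\<in>mats v n. f2 (b / a))\<bar>
    \<le> 2 * K * ?q ^ (n + 5 * m) + 2 * K * ?q ^ (n + 4 * m + 3)"
    using part1 part2 by linarith
  also have "\<dots> \<le> 2 * K * ?q ^ (n + 5 * m + 3) + 2 * K * ?q ^ (n + 5 * m + 3)"
  proof (rule add_mono)
    show "2 * K * ?q ^ (n + 5 * m) \<le> 2 * K * ?q ^ (n + 5 * m + 3)"
      by (rule mult_left_mono[OF power_increasing]) (use K0 q2 in auto)
    show "2 * K * ?q ^ (n + 4 * m + 3) \<le> 2 * K * ?q ^ (n + 5 * m + 3)"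
      by (rule mult_left_mono[OF power_increasing]) (use K0 q2 in auto)
  qed
  finally show ?thesis unfolding main by simp
qed

section \<open>Reduction of the sum over primitive vectors\<close>

lemma powi_le_powi_iff: "1 < (q::real) \<Longrightarrow> q powi a \<le> q powi b \<longleftrightarrow> a \<le> b"
  by (metis linorder_not_le power_int_increasing power_int_strict_increasing less_imp_le)

lemma card_field_gt_1: "1 < real CARD('a::{finite,field})"
  using card_field_ge_2[where 'a='a] by simp

lemma kabs_nonneg: "0 \<le> kabs x"
  by (simp add: kabs_def)

lemma kabs_eq_0_iff: "kabs (x :: 'a::{finite,field} fls) = 0 \<longleftrightarrow> x = 0"
  using card_field_gt_1[where 'a='a] by (simp add: kabs_def)

lemma kabs_le_iff: "kabs (x :: 'a::{finite,field} fls) \<le> real CARD('a) powi (- k) \<longleftrightarrow> x \<in> vball k"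
  using card_field_gt_1[where 'a='a] by (cases "x = 0") (auto simp: kabs_def vball_iff powi_le_powi_iff)

lemma kabs_le_kabs_iff: "y \<noteq> 0 \<Longrightarrow> kabs (x :: 'a::{finite,field} fls) \<le> kabs y \<longleftrightarrow> x / y \<in> vball 0"
  using kabs_le_iff[of x "fls_subdegree y"] vball_divide_iff[of y x 0] by (simp add: kabs_def)

lemma kabs_less_kabs_iff: "y \<noteq> 0 \<Longrightarrow> kabs (x :: 'a::{finite,field} fls) < kabs y \<longleftrightarrow> x / y \<in> vball 1"
proof (cases "x = 0")
  case False
  assume y: "y \<noteq> 0"
  have "kabs x < kabs y \<longleftrightarrow> \<not> kabs y \<le> kabs x" by auto
  also have "\<dots> \<longleftrightarrow> y / x \<notin> vball 0" using kabs_le_kabs_iff[OF False, of y] by simp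
  also have "\<dots> \<longleftrightarrow> x / y \<in> vball 1" using False y by (auto simp: vball_iff fls_subdegree_divide)
  finally show ?thesis .
qed (auto simp: kabs_def)

lemma knorm_le_iff: "knorm (v :: 'a::{finite,field} fls \<times> 'a fls) \<le> real CARD('a) powi (- k) \<longleftrightarrow> fst v \<in> vball k \<and> snd v \<in> vball k"
  by (simp add: knorm_def kabs_le_iff)

lemma kabs_eq_iff: "kabs (x :: 'a::{finite,field} fls) = real CARD('a) powi (- k) \<longleftrightarrow> x \<in> vball k \<and> x \<notin> vball (k + 1)"
proof
  assume "kabs x = real CARD('a) powi (- k)"
  then show "x \<in> vball k \<and> x \<notin> vball (k + 1)"
    using kabs_le_iff[of x k] kabs_le_iff[of x "k + 1"]
      powi_le_powi_iff[OF card_field_gt_1[where 'a='a], of "- k" "- (k + 1)"] by simp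
next
  assume "x \<in> vball k \<and> x \<notin> vball (k + 1)"
  then have "x \<noteq> 0" "fls_subdegree x = k" by (auto simp: vball_iff)
  then show "kabs x = real CARD('a) powi (- k)" by (simp add: kabs_def)
qed

lemma knorm_eq_iff: "knorm (v :: 'a::{finite,field} fls \<times> 'a fls) = real CARD('a) powi (- k) \<longleftrightarrow>
    fst v \<in> vball k \<and> snd v \<in> vball k \<and> (fst v \<notin> vball (k + 1) \<or> snd v \<notin> vball (k + 1))"
  using kabs_eq_iff[of "fst v" k] kabs_eq_iff[of "snd v" k] kabs_le_iff[of "fst v" k] kabs_le_iff[of "snd v" k]
  by (auto simp: knorm_def max_def)

lemma sphere1_iff: "v \<in> sphere1 \<longleftrightarrow> fst v \<in> vball 0 \<and> snd v \<in> vball 0 \<and> (unitO (fst v) \<or> unitO (snd v))"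
  using knorm_eq_iff[of v 0] by (auto simp: sphere1_def unitO_iff)

lemma powi_neg_neg_nat: "real CARD('a::{finite,field}) ^ n = real CARD('a) powi (- (- int n))"
  by simp

lemma Rdeg_iff: "a \<in> Rdeg n \<longleftrightarrow> inR a \<and> a \<in> vball (- int n) \<and> a \<notin> vball (1 - int n)"
  by (auto simp: Rdeg_eq digits_def inR_iff_low)

lemma cop_sym: "cop a b \<longleftrightarrow> cop b a"
  unfolding cop_def by (metis add.commute)

text \<open>The sphere of radius \<open>CARD('a)^n\<close> is cut along
  \<open>|a| \<ge> |b|\<close>, the case distinction of \<open>zz\<close>; the strict inequality on
  the swapped side makes the union disjoint.\<close>

lemma primitive_vectors_eq:
  "{v \<in> Rprim. knorm v = real CARD('a) ^ n} = red_pairs 0 n \<union> prod.swap ` (red_pairs 1 n :: ('a::{finite,field} fls \<times> 'a fls) set)"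
proof (intro set_eqI)
  fix v :: "'a fls \<times> 'a fls"
  obtain a b where v: "v = (a, b)" by (cases v)
  have "v \<in> prod.swap ` (red_pairs 1 n :: ('a fls \<times> 'a fls) set) \<longleftrightarrow> (b, a) \<in> red_pairs 1 n"
    unfolding v by (metis image_iff prod.swap_def swap_swap fst_conv snd_conv)
  moreover have "v \<in> {v \<in> Rprim. knorm v = real CARD('a) ^ n} \<longleftrightarrow> inR a \<and> inR b \<and> cop a b \<and>
    a \<in> vball (- int n) \<and> b \<in> vball (- int n) \<and> (a \<notin> vball (1 - int n) \<or> b \<notin> vball (1 - int n))"
    unfolding powi_neg_neg_nat mem_Collect_eq knorm_eq_iff by (auto simp: v Rprim_def cop_def)
  moreover have "(a, b) \<in> red_pairs 0 n \<longleftrightarrow> inR a \<and> inR b \<and> cop a b \<and>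
    a \<in> vball (- int n) \<and> b \<in> vball (- int n) \<and> a \<notin> vball (1 - int n)"
    using Rdeg_vball_divide[of a n b 0] unfolding red_pairs_def frac_pairs_def Rdeg_iff by auto
  moreover have "(b, a) \<in> red_pairs 1 n \<longleftrightarrow> inR a \<and> inR b \<and> cop a b \<and>
    a \<in> vball (1 - int n) \<and> b \<in> vball (- int n) \<and> b \<notin> vball (1 - int n)"
    using Rdeg_vball_divide[of b n a 1] cop_sym[of a b] unfolding red_pairs_def frac_pairs_def Rdeg_iff by auto
  ultimately show "v \<in> {v \<in> Rprim. knorm v = real CARD('a) ^ n} \<longleftrightarrow>
      v \<in> red_pairs 0 n \<union> prod.swap ` (red_pairs 1 n :: ('a fls \<times> 'a fls) set)"
    using vball_mono[of a "1 - int n" "- int n"] by (auto simp: v)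
qed

lemma dir_eq:
  fixes v :: "'a::{finite,field} fls \<times> 'a fls"
  assumes "knorm v = real CARD('a) ^ n"
  shows "dir v = (fst v * fls_X_intpow (int n), snd v * fls_X_intpow (int n))"
proof -
  have "1 < real CARD('a)" using card_field_ge_2[where 'a='a] by simp
  then have "log (real CARD('a)) (knorm v) = real n" by (simp add: assms log_nat_power)
  then show ?thesis by (simp add: dir_def Let_def)
qed

lemma ww_obtain:
  assumes "cop a b"
  obtains x y where "inR x" "inR y" "a * x + b * y = 1" "ww (a, b) = (- y, x)"
proof -
  let ?p = "SOME p. inR (fst p) \<and> inR (snd p) \<and> fst (a, b) * fst p + snd (a, b) * snd p = 1"
  obtain x y where "inR x" "inR y" "a * x + b * y = 1" using assms by (auto simp: cop_def)
  then have "\<exists>p. inR (fst p) \<and> inR (snd p) \<and> fst (a, b) * fst p + snd (a, b) * snd p = 1"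
    by (intro exI[of _ "(x, y)"]) simp
  from someI_ex[OF this]
  have "inR (fst ?p) \<and> inR (snd ?p) \<and> fst (a, b) * fst ?p + snd (a, b) * snd ?p = 1" .
  then have "inR (fst ?p)" "inR (snd ?p)" "a * fst ?p + b * snd ?p = 1" by auto
  moreover have "ww (a, b) = (- snd ?p, fst ?p)" by (simp add: ww_def case_prod_beta Let_def)
  ultimately show ?thesis using that by blast
qed

text \<open>If \<open>|y| < |x|\<close> held in \<open>a * x + b * y = 1\<close>, then
  \<open>a * x\<close> would dominate and have absolute value above 1, as \<open>n \<ge> 1\<close>.
  So the larger entry of \<open>ww (a, b)\<close> is \<open>- y\<close>. Comparison of the two
  Bezout relations gives \<open>c + y\<close> divisible by \<open>a\<close>, which makes the ratio
  independent of the chosen solution modulo polynomials.\<close>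

lemma zz_ratio_fst:
  assumes M: "(a, b, c, d) \<in> mats 0 n" and n: "1 \<le> n"
  obtains r where "inR r" "zz (ww (a, b)) / zz (a, b) = c / a + r"
proof -
  have R: "inR a" "inR b" "inR c" "inR d" "a * d - b * c = 1" and a: "a \<in> Rdeg n" "b / a \<in> vball 0"
    using M by (auto simp: mats_def SL2R_def)
  have a0: "a \<noteq> 0" "fls_subdegree a = - int n" using a by (auto simp: Rdeg_def)
  have cop: "cop a b" unfolding cop_def using R by (intro exI[of _ d] exI[of _ "- c"]) (auto intro: inR_intros)
  obtain x y where xy: "inR x" "inR y" "a * x + b * y = 1" "ww (a, b) = (- y, x)" using ww_obtain[OF cop] by blast
  have "kabs x \<le> kabs (- y)"
  proof (rule ccontr)
    assume "\<not> ?thesis"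
    then have less: "kabs (- y) < kabs x" by simp
    then have x0: "x \<noteq> 0" using kabs_nonneg[of "- y"] kabs_eq_0_iff[of x] by linarith
    have y: "y / x \<in> vball 1" using less kabs_less_kabs_iff[OF x0, of "- y"] by simp
    have "(b / a) * (y / x) \<in> vball 1" using a y by (intro vball_mult_0)
    moreover have "1 / (a * x) \<in> vball 1"
      using a0 x0 inR_subdegree_le[OF xy(1)] n by (simp add: vball_iff fls_subdegree_divide)
    ultimately have "1 / (a * x) - (b / a) * (y / x) \<in> vball 1" by (intro vball_diff)
    moreover have "1 / (a * x) - (b / a) * (y / x) = (a * x + b * y - b * y) / (a * x)"
      unfolding xy(3) by (simp add: diff_divide_distrib)
    moreover have "\<dots> = 1" using a0 x0 by simp
    ultimately show False by simp
  qed
  then have "zz (ww (a, b)) = - y" by (simp add: xy zz_def)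
  moreover have "zz (a, b) = a" using a kabs_le_kabs_iff[OF a0(1), of b] by (simp add: zz_def)
  moreover have "a * (d - x) = (c + y) * b" using R(5) xy(3) by (simp add: algebra_simps)
  then obtain w where w: "inR w" "c + y = a * w"
    using cop_dvd_of_proportional[OF cop] R xy by (metis inR_diff inR_add)
  have "- y / a = c / a + (- w)" using a0 w(2) by (simp add: field_simps)
  ultimately show ?thesis using that[of "- w"] w inR_uminus by metis
qed

text \<open>Here \<open>b * y\<close> must dominate if \<open>|x| \<le> |y|\<close>, so the larger
  entry of \<open>ww (a, b)\<close> is strictly \<open>x\<close>. The sign changes since swapping
  the columns reverses the determinant: now \<open>x + c\<close> is divisible by
  \<open>b\<close>.\<close>

lemma zz_ratio_snd:
  assumes M: "(b, a, c, d) \<in> mats 1 n" and n: "1 \<le> n"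
  obtains r where "inR r" "zz (ww (a, b)) / zz (a, b) = - c / b + r"
proof -
  have R: "inR a" "inR b" "inR c" "inR d" "b * d - a * c = 1" and b: "b \<in> Rdeg n" "a / b \<in> vball 1"
    using M by (auto simp: mats_def SL2R_def)
  have b0: "b \<noteq> 0" "fls_subdegree b = - int n" using b by (auto simp: Rdeg_def)
  have cop: "cop b a" unfolding cop_def using R by (intro exI[of _ d] exI[of _ "- c"]) (auto intro: inR_intros)
  then have cop': "cop a b" by (simp add: cop_sym)
  obtain x y where xy: "inR x" "inR y" "a * x + b * y = 1" "ww (a, b) = (- y, x)" using ww_obtain[OF cop'] by blast
  have "\<not> kabs x \<le> kabs (- y)"
  proof
    assume le: "kabs x \<le> kabs (- y)"
    have y0: "y \<noteq> 0"
    proof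
      assume "y = 0"
      then have "kabs x = 0" using le kabs_nonneg[of x] kabs_eq_0_iff[of "- y"] by simp
      then have "x = 0" by (simp add: kabs_eq_0_iff)
      then show False using \<open>y = 0\<close> xy(3) by simp
    qed
    have x: "x / y \<in> vball 0" using le kabs_le_kabs_iff[of "- y" x] y0 by simp
    have "(a / b) * (x / y) \<in> vball 1" using b x by (intro vball_mult_0)
    moreover have "1 / (b * y) \<in> vball 1"
      using b0 y0 inR_subdegree_le[OF xy(2)] n by (simp add: vball_iff fls_subdegree_divide)
    ultimately have "1 / (b * y) - (a / b) * (x / y) \<in> vball 1" by (intro vball_diff)
    moreover have "1 / (b * y) - (a / b) * (x / y) = (a * x + b * y - a * x) / (b * y)"
      unfolding xy(3) by (simp add: diff_divide_distrib)
    moreover have "\<dots> = 1" using b0 y0 by simp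
    ultimately show False by simp
  qed
  then have "zz (ww (a, b)) = x" by (simp add: xy zz_def)
  moreover have "kabs a < kabs b" using b kabs_less_kabs_iff[OF b0(1), of a] by simp
  then have "zz (a, b) = b" by (simp add: zz_def)
  moreover have "b * (d - y) = (x + c) * a" using R(5) xy(3) by (simp add: algebra_simps)
  then obtain w where w: "inR w" "x + c = b * w"
    using cop_dvd_of_proportional[OF cop] R xy by (metis inR_diff inR_add)
  have "x = b * w - c" using w(2) by (simp add: algebra_simps)
  then have "x / b = - c / b + w" using b0 by (simp add: field_simps)
  ultimately show ?thesis using that[of w] w by metis
qed

lemma Lambda_eq_mats_sum:
  fixes F :: "'a::{finite,field} fls \<times> 'a fls \<Rightarrow> 'a fls \<Rightarrow> real"
  assumes per: "\<And>u x r. inR r \<Longrightarrow> F u (x + r) = F u x" and n: "1 \<le> n"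
  shows "Lambda n F = 1 / (real CARD('a) ^ 2 * (real CARD('a) - 1)) * real CARD('a) powi (- 2 * int n) *
    ((\<Sum>(a, b, c, d)\<in>mats 0 n. F (a * fls_X_intpow (int n), b * fls_X_intpow (int n)) (c / a)) +
     (\<Sum>(a, b, c, d)\<in>mats 1 n. F (b * fls_X_intpow (int n), a * fls_X_intpow (int n)) (- c / a)))"
proof -
  let ?X = "fls_X_intpow (int n) :: 'a fls"
  let ?f = "\<lambda>v. F (dir v) (zz (ww v) / zz v)"
  let ?S = "prod.swap ` (red_pairs 1 n :: ('a fls \<times> 'a fls) set)"
  have disj: "red_pairs 0 n \<inter> ?S = {}"
  proof (rule ccontr)
    assume "\<not> ?thesis"
    then obtain a b where "(a, b) \<in> red_pairs 0 n" "(b, a) \<in> (red_pairs 1 n :: ('a fls \<times> 'a fls) set)" by auto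
    then show False by (auto simp: red_pairs_def frac_pairs_def Rdeg_vball_divide Rdeg_vball)
  qed
  have kn: "knorm v = real CARD('a) ^ n" if "v \<in> red_pairs 0 n \<union> ?S" for v :: "'a fls \<times> 'a fls"
    using that unfolding primitive_vectors_eq[symmetric] by simp
  have "(\<Sum>v\<in>{v\<in>Rprim. knorm v = real CARD('a) ^ n}. ?f v) = (\<Sum>v\<in>red_pairs 0 n. ?f v) + (\<Sum>v\<in>?S. ?f v)"
    unfolding primitive_vectors_eq by (rule sum.union_disjoint) (use disj in \<open>auto intro: finite_imageI simp: finite_red_pairs\<close>)
  also have "(\<Sum>v\<in>red_pairs 0 n. ?f v) = (\<Sum>M\<in>mats 0 n. ?f (case M of (a, b, c, d) \<Rightarrow> (a, b)))"
    by (rule sum.reindex_bij_betw[OF mats_bij, symmetric])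
  also have "\<dots> = (\<Sum>(a, b, c, d)\<in>mats 0 n. F (a * ?X, b * ?X) (c / a))"
  proof (rule sum.cong[OF refl])
    fix M :: "'a mat" assume M: "M \<in> mats 0 n"
    obtain a b c d where Me: "M = (a, b, c, d)" by (cases M)
    have "(a, b) \<in> red_pairs 0 n" using mats_bij[of 0 n] M by (force simp: Me bij_betw_def)
    then have "dir (a, b) = (a * ?X, b * ?X)" using dir_eq[of "(a, b)" n] kn by simp
    moreover obtain r where r: "inR r" "zz (ww (a, b)) / zz (a, b) = c / a + r"
      using zz_ratio_fst[of a b c d n] M n by (auto simp: Me)
    ultimately show "?f (case M of (a, b, c, d) \<Rightarrow> (a, b)) = (case M of (a, b, c, d) \<Rightarrow> F (a * ?X, b * ?X) (c / a))"
      by (simp add: Me per)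
  qed
  also have "(\<Sum>v\<in>?S. ?f v) = (\<Sum>v\<in>red_pairs 1 n. ?f (prod.swap v))"
    by (rule sum.reindex_cong[of prod.swap]) (auto simp: inj_on_def)
  also have "\<dots> = (\<Sum>M\<in>mats 1 n. ?f (prod.swap (case M of (a, b, c, d) \<Rightarrow> (a, b))))"
    by (rule sum.reindex_bij_betw[OF mats_bij, symmetric])
  also have "\<dots> = (\<Sum>(a, b, c, d)\<in>mats 1 n. F (b * ?X, a * ?X) (- c / a))"
  proof (rule sum.cong[OF refl])
    fix M :: "'a mat" assume M: "M \<in> mats 1 n"
    obtain a b c d where Me: "M = (a, b, c, d)" by (cases M)
    have "(a, b) \<in> red_pairs 1 n" using mats_bij[of 1 n] M by (force simp: Me bij_betw_def)
    then have "(b, a) \<in> ?S" by (auto simp: image_iff intro!: bexI[of _ "(a, b)"])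
    then have "dir (b, a) = (b * ?X, a * ?X)" using dir_eq[of "(b, a)" n] kn by simp
    moreover obtain r where r: "inR r" "zz (ww (b, a)) / zz (b, a) = - c / a + r"
      using zz_ratio_snd[of a b c d n] M n by (auto simp: Me)
    ultimately show "?f (prod.swap (case M of (a, b, c, d) \<Rightarrow> (a, b))) = (case M of (a, b, c, d) \<Rightarrow> F (b * ?X, a * ?X) (- c / a))"
      by (simp only: Me case_prod_conv swap_simp per)
  qed
  finally show ?thesis unfolding Lambda_def by simp
qed

section \<open>Riemann sums at level \<open>m\<close> and averages over primitive vectors\<close>

text \<open>The Riemann sum of \<open>int_prod\<close> over cells of level \<open>m\<close>, each of
  Haar measure \<open>CARD('a)^(- 3m)\<close>. It is the common target of the arithmetic averages
  and of the integrals.\<close>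

definition digit_mean :: "nat \<Rightarrow> ('a::{finite,field} fls \<times> 'a fls \<Rightarrow> 'a fls \<Rightarrow> real) \<Rightarrow> real" where
  "digit_mean m F = (\<Sum>x\<in>digits 0 (int m). \<Sum>y\<in>digits 0 (int m). \<Sum>z\<in>digits 1 (int m).
     if unitO x \<or> unitO y then F (x, y) z else 0) / real CARD('a) ^ (3 * m)"

lemma digit_mean_split:
  fixes F :: "'a::{finite,field} fls \<times> 'a fls \<Rightarrow> 'a fls \<Rightarrow> real"
  assumes m: "1 \<le> m"
  shows "digit_mean m F = ((\<Sum>u\<in>units m. \<Sum>w\<in>digits 0 (int m). \<Sum>z\<in>digits 1 (int m). F (u, w) z) +
    (\<Sum>u\<in>units m. \<Sum>w\<in>digits 1 (int m). \<Sum>z\<in>digits 1 (int m). F (w, u) z)) / real CARD('a) ^ (3 * m)"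
proof -
  let ?D = "digits 0 (int m) :: 'a fls set" and ?E = "digits 1 (int m) :: 'a fls set" and ?U = "units m :: 'a fls set"
  let ?g = "\<lambda>x y. \<Sum>z\<in>?E. if unitO x \<or> unitO y then F (x, y) z else 0"
  have D: "?D = ?U \<union> ?E" and disj: "?U \<inter> ?E = {}"
    using units_eq[OF m, where 'a='a] by (auto simp: digits_def intro: vball_mono)
  have U: "unitO x" if "x \<in> ?U" for x using that by (simp add: units_def)
  have E: "\<not> unitO x" if "x \<in> ?E" for x using that by (simp add: digits_def unitO_iff)
  have sum_D: "(\<Sum>x\<in>?D. h x) = (\<Sum>x\<in>?U. h x) + (\<Sum>x\<in>?E. h x)" for h :: "'a fls \<Rightarrow> real"
    unfolding D by (rule sum.union_disjoint) (use disj in auto)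
  have "(\<Sum>x\<in>?D. \<Sum>y\<in>?D. ?g x y) = (\<Sum>x\<in>?U. \<Sum>y\<in>?D. ?g x y) + (\<Sum>x\<in>?E. \<Sum>y\<in>?D. ?g x y)"
    by (rule sum_D)
  also have "(\<Sum>x\<in>?U. \<Sum>y\<in>?D. ?g x y) = (\<Sum>u\<in>?U. \<Sum>w\<in>?D. \<Sum>z\<in>?E. F (u, w) z)"
    by (intro sum.cong refl) (simp add: U)
  also have "(\<Sum>x\<in>?E. \<Sum>y\<in>?D. ?g x y) = (\<Sum>x\<in>?E. \<Sum>y\<in>?U. \<Sum>z\<in>?E. F (x, y) z)"
  proof (rule sum.cong[OF refl])
    fix x assume x: "x \<in> ?E"
    have "(\<Sum>y\<in>?E. ?g x y) = 0" using E x by (intro sum.neutral ballI) simp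
    moreover have "(\<Sum>y\<in>?U. ?g x y) = (\<Sum>y\<in>?U. \<Sum>z\<in>?E. F (x, y) z)"
      by (intro sum.cong refl) (simp add: U)
    ultimately show "(\<Sum>y\<in>?D. ?g x y) = (\<Sum>y\<in>?U. \<Sum>z\<in>?E. F (x, y) z)" using sum_D[of "?g x"] by simp
  qed
  also have "\<dots> = (\<Sum>u\<in>?U. \<Sum>w\<in>?E. \<Sum>z\<in>?E. F (w, u) z)" by (rule sum.swap)
  finally show ?thesis unfolding digit_mean_def by simp
qed

text \<open>Multiplication by a unit preserves Haar measure, seen on cells. It is needed because
  matrices give the coordinates \<open>(u, b / a)\<close>, while the direction is
  \<open>(u, u * (b / a))\<close>.\<close>

lemma unit_mult_digits_bij:
  assumes u: "unitO u" shows "bij_betw (\<lambda>x. cutoff k (u * x)) (digits j k) (digits j k)"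
proof -
  have u': "unitO (1 / u)" using u unitO_divide unitO_1 by blast
  have u0: "u \<noteq> 0" using u by (simp add: unitO_def)
  have inv: "cutoff k (w * cutoff k (w' * x)) = x" if "unitO w" "w * w' = 1" "x \<in> digits j k" for w w' x
  proof (rule cutoff_unique)
    have "w * (cutoff k (w' * x) - w' * x) \<in> vball k" using vball_unit_mult[OF that(1)] cutoff_diff by blast
    moreover have "w * (cutoff k (w' * x) - w' * x) = w * cutoff k (w' * x) - (w * w') * x" by (simp add: algebra_simps)
    ultimately show "w * cutoff k (w' * x) - x \<in> vball k" using that by simp
  qed (use that in \<open>simp add: digits_def\<close>)
  have into: "cutoff k (w * x) \<in> digits j k" if "unitO w" "x \<in> digits j k" for w x
    using that vball_unit_mult[OF that(1)] by (intro cutoff_digits) (simp add: digits_def)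
  show ?thesis
    by (rule bij_betw_byWitness[where f' = "\<lambda>x. cutoff k (1 / u * x)"])
       (use inv[OF u, of "1 / u"] inv[OF u', of u] into[OF u] into[OF u'] u0 in auto)
qed

lemma uminus_digits_bij: "bij_betw uminus (digits j k) (digits j k)"
  by (rule bij_betw_byWitness[where f' = uminus]) (auto simp: digits_def intro: low_uminus)

lemma abs_sum_diff_le:
  fixes f g :: "'b \<Rightarrow> real"
  assumes "\<And>x. x \<in> A \<Longrightarrow> \<bar>f x - g x\<bar> \<le> e"
  shows "\<bar>(\<Sum>x\<in>A. f x) - (\<Sum>x\<in>A. g x)\<bar> \<le> real (card A) * e"
proof -
  have "\<bar>\<Sum>x\<in>A. f x - g x\<bar> \<le> (\<Sum>x\<in>A. e)" by (rule order_trans[OF sum_abs sum_mono]) (use assms in auto)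
  then show ?thesis by (simp add: sum_subtractf)
qed

lemma card_mats_le:
  assumes "v \<le> 1" "0 \<le> v" "1 \<le> n"
  shows "real (card (mats v n :: 'a::{finite,field} mat set)) \<le> real CARD('a) ^ (2 * n + 2)"
proof -
  let ?q = "real CARD('a)"
  have q: "1 < ?q" by (rule card_field_gt_1)
  have "real (card (mats v n :: 'a mat set)) = (\<Sum>(a, b, c, d)\<in>(mats v n :: 'a mat set). 1)"
    by (simp add: case_prod_beta)
  also have "\<dots> = (?q - 1)\<^sup>2 * ?q ^ (2 * n - 1) * (\<Sum>y\<in>(digits v (int 1) :: 'a fls set). 1)"
    using mats_sum_beta[of v 1 "\<lambda>_. 1" n] assms by simp
  also have "\<dots> \<le> ?q\<^sup>2 * ?q ^ (2 * n - 1) * ?q"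
  proof (intro mult_mono)
    show "(?q - 1)\<^sup>2 \<le> ?q\<^sup>2" using q by (intro power_mono) auto
    have "nat (1 - v) \<le> 1" using assms by simp
    then have "?q ^ nat (1 - v) \<le> ?q ^ 1" using q by (intro power_increasing) auto
    then show "(\<Sum>y\<in>(digits v (int 1) :: 'a fls set). 1) \<le> ?q" by (simp add: card_digits)
  qed (use q in auto)
  also have "\<dots> = ?q ^ (2 + (2 * n - 1) + 1)" by (simp only: power_add power_one_right)
  also have "2 + (2 * n - 1) + 1 = 2 * n + 2" using assms by simp
  finally show ?thesis .
qed

text \<open>Rounding the arguments to level \<open>m\<close> leaves the sum over digits unchanged
  and moves each of the at most \<open>CARD('a)^(2n + 2)\<close> terms by at most
  \<open>\<eta>\<close>.\<close>

lemma mats_equidistribution_osc: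
  fixes \<phi> :: "'a::{finite,field} fls \<Rightarrow> 'a fls \<Rightarrow> 'a fls \<Rightarrow> real"
  assumes m: "1 \<le> m" "2 * m \<le> n" and v: "0 \<le> v" "v \<le> 1"
    and osc: "\<And>u u' x x' y y'. unitO u \<Longrightarrow> unitO u' \<Longrightarrow> x \<in> vball v \<Longrightarrow> x' \<in> vball v \<Longrightarrow> y \<in> vball 1 \<Longrightarrow> y' \<in> vball 1 \<Longrightarrow>
      u - u' \<in> vball (int m) \<Longrightarrow> x - x' \<in> vball (int m) \<Longrightarrow> y - y' \<in> vball (int m) \<Longrightarrow> \<bar>\<phi> u x y - \<phi> u' x' y'\<bar> \<le> \<eta>"
    and bound: "\<And>u x y. unitO u \<Longrightarrow> x \<in> vball v \<Longrightarrow> y \<in> vball 1 \<Longrightarrow> \<bar>\<phi> u x y\<bar> \<le> K"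
  shows "\<bar>(\<Sum>(a, b, c, d)\<in>mats v n. \<phi> (a * fls_X_intpow (int n)) (b / a) (c / a))
      - (real CARD('a) - 1) * real CARD('a) ^ (2 * n + 2) / real CARD('a) ^ (3 * m)
        * (\<Sum>u\<in>units m. \<Sum>x\<in>digits v (int m). \<Sum>y\<in>digits 1 (int m). \<phi> u x y)\<bar>
    \<le> 4 * K * real CARD('a) ^ (n + 5 * m + 3) + \<eta> * real CARD('a) ^ (2 * n + 2)"
proof -
  let ?q = "real CARD('a)" and ?X = "fls_X_intpow (int n) :: 'a fls" and ?c = "cutoff (int m) :: 'a fls \<Rightarrow> 'a fls"
  define \<phi>' where "\<phi>' u x y = \<phi> (?c u) (?c x) (?c y)" for u x y
  have \<eta>0: "\<eta> \<ge> 0" using osc[of 1 1 0 0 0 0] by simp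
  have cu: "unitO (?c u)" if "unitO u" for u using unitO_cong[OF that cutoff_diff] m by simp
  have "\<bar>(\<Sum>(a, b, c, d)\<in>mats v n. \<phi>' (a * ?X) (b / a) (c / a))
      - (?q - 1) * ?q ^ (2 * n + 2) / ?q ^ (3 * m)
        * (\<Sum>u\<in>units m. \<Sum>x\<in>digits v (int m). \<Sum>y\<in>digits 1 (int m). \<phi>' u x y)\<bar>
    \<le> 4 * K * ?q ^ (n + 5 * m + 3)"
  proof (rule mats_equidistribution[OF m v])
    fix u u' x x' y y' :: "'a fls"
    assume "u - u' \<in> vball (int m)" "x - x' \<in> vball (int m)" "y - y' \<in> vball (int m)"
    then have "?c u = ?c u'" "?c x = ?c x'" "?c y = ?c y'" by (simp_all only: cutoff_eq_iff)
    then show "\<phi>' u x y = \<phi>' u' x' y'" by (simp add: \<phi>'_def)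
  next
    fix u x y :: "'a fls" assume "unitO u" "x \<in> vball v" "y \<in> vball 1"
    then show "\<bar>\<phi>' u x y\<bar> \<le> K" unfolding \<phi>'_def by (intro bound cu cutoff_vball)
  qed
  moreover have "(\<Sum>u\<in>units m. \<Sum>x\<in>digits v (int m). \<Sum>y\<in>digits 1 (int m). \<phi>' u x y)
      = (\<Sum>u\<in>units m. \<Sum>x\<in>digits v (int m). \<Sum>y\<in>digits 1 (int m). \<phi> u x y)"
    by (intro sum.cong refl) (simp add: \<phi>'_def units_def digits_def cutoff_id)
  moreover have "\<bar>(\<Sum>(a, b, c, d)\<in>mats v n. \<phi> (a * ?X) (b / a) (c / a))
      - (\<Sum>(a, b, c, d)\<in>mats v n. \<phi>' (a * ?X) (b / a) (c / a))\<bar> \<le> real (card (mats v n :: 'a mat set)) * \<eta>"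
  proof (rule abs_sum_diff_le)
    fix M :: "'a mat" assume M: "M \<in> mats v n"
    obtain a b c d where Me: "M = (a, b, c, d)" by (cases M)
    have *: "unitO (a * ?X)" "b / a \<in> vball v" "c / a \<in> vball 1" using M X_unit[of a n] by (auto simp: Me mats_def)
    have "\<bar>\<phi> (a * ?X) (b / a) (c / a) - \<phi>' (a * ?X) (b / a) (c / a)\<bar> \<le> \<eta>"
      unfolding \<phi>'_def by (intro osc cu cutoff_vball diff_cutoff *)
    then show "\<bar>(case M of (a, b, c, d) \<Rightarrow> \<phi> (a * ?X) (b / a) (c / a)) - (case M of (a, b, c, d) \<Rightarrow> \<phi>' (a * ?X) (b / a) (c / a))\<bar> \<le> \<eta>"
      by (simp add: Me)
  qed
  moreover have "real (card (mats v n :: 'a mat set)) * \<eta> \<le> ?q ^ (2 * n + 2) * \<eta>"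
    using card_mats_le[of v n, where 'a='a] v m \<eta>0 by (intro mult_right_mono) auto
  ultimately show ?thesis by (simp only: mult.commute[of \<eta>])
qed

lemma Lambda_coeff:
  "1 / (real CARD('a::{finite,field}) ^ 2 * (real CARD('a) - 1)) * real CARD('a) powi (- 2 * int n)
    = 1 / ((real CARD('a) - 1) * real CARD('a) ^ (2 * n + 2))"
proof -
  let ?q = "real CARD('a)"
  have "?q powi (- 2 * int n) = 1 / ?q ^ (2 * n)"
    by (simp add: power_int_minus field_simps power_int_mult power_mult)
  then show ?thesis by (simp only: power_add) (simp add: mult_ac)
qed

lemma Lambda_coeff_le:
  "1 / ((real CARD('a::{finite,field}) - 1) * real CARD('a) ^ (2 * n + 2)) \<le> 1 / real CARD('a) ^ (2 * n + 2)"
proof -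
  have "(real CARD('a) - 1) * real CARD('a) ^ (2 * n + 2) \<ge> 1 * real CARD('a) ^ (2 * n + 2)"
    using card_field_ge_2[where 'a='a] by (intro mult_right_mono) auto
  then show ?thesis using card_field_gt_1[where 'a='a] by (intro divide_left_mono) auto
qed

text \<open>Of the \<open>4 * \<eta>\<close>, one half comes from rounding in the sums over the two
  halves of the plane, the other from replacing \<open>u * x\<close> by its truncation in the change
  of coordinates.\<close>

lemma Lambda_near_digit_mean:
  fixes F :: "'a::{finite,field} fls \<times> 'a fls \<Rightarrow> 'a fls \<Rightarrow> real"
  assumes m: "1 \<le> m" "2 * m \<le> n"
    and per: "\<And>u x r. inR r \<Longrightarrow> F u (x + r) = F u x"
    and bound: "\<And>u x. u \<in> sphere1 \<Longrightarrow> x \<in> vball 1 \<Longrightarrow> \<bar>F u x\<bar> \<le> K"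
    and osc: "\<And>u u' x x'. u \<in> sphere1 \<Longrightarrow> u' \<in> sphere1 \<Longrightarrow> x \<in> vball 1 \<Longrightarrow> x' \<in> vball 1 \<Longrightarrow>
      fst u - fst u' \<in> vball (int m) \<Longrightarrow> snd u - snd u' \<in> vball (int m) \<Longrightarrow> x - x' \<in> vball (int m) \<Longrightarrow>
      \<bar>F u x - F u' x'\<bar> \<le> \<eta>"
  shows "\<bar>Lambda n F - digit_mean m F\<bar> \<le> 4 * \<eta> + 8 * K * real CARD('a) ^ (5 * m + 1) / real CARD('a) ^ n"
proof -
  let ?q = "real CARD('a)" and ?X = "fls_X_intpow (int n) :: 'a fls"
  let ?U = "units m :: 'a fls set" and ?D = "\<lambda>v. digits v (int m) :: 'a fls set" and ?E = "digits 1 (int m) :: 'a fls set"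
  have q: "1 < ?q" by (rule card_field_gt_1)
  have sph: "(1, 0) \<in> (sphere1 :: ('a fls \<times> 'a fls) set)" by (simp add: sphere1_iff)
  have \<eta>0: "\<eta> \<ge> 0" using osc[OF sph sph, of 0 0] by simp
  have K0: "K \<ge> 0" using bound[OF sph, of 0] by simp
  \<comment> \<open>With \<open>u = a Y^(-n)\<close> and \<open>x = b / a\<close> the entries of the
    direction are \<open>u\<close> and \<open>u * x\<close>; \<open>p1\<close> describes the half
    with swapped entries and reversed sign of \<open>c\<close>.\<close>
  define p0 p1 where "p0 u x y = F (u, u * x) y" and "p1 u x y = F (u * x, u) (- y)" for u x y
  define \<kappa> where "\<kappa> = 1 / (?q ^ 2 * (?q - 1)) * ?q powi (- 2 * int n)"
  have \<kappa>: "\<kappa> = 1 / ((?q - 1) * ?q ^ (2 * n + 2))"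
    unfolding \<kappa>_def by (rule Lambda_coeff)
  have \<kappa>0: "\<kappa> > 0" unfolding \<kappa> using q by simp
  let ?T0 = "\<Sum>(a, b, c, d)\<in>mats 0 n. p0 (a * ?X) (b / a) (c / a)"
  let ?T1 = "\<Sum>(a, b, c, d)\<in>mats 1 n. p1 (a * ?X) (b / a) (c / a)"
  let ?S0 = "\<Sum>u\<in>?U. \<Sum>x\<in>?D 0. \<Sum>y\<in>?E. p0 u x y" and ?S1 = "\<Sum>u\<in>?U. \<Sum>x\<in>?D 1. \<Sum>y\<in>?E. p1 u x y"
  have "(\<Sum>(a, b, c, d)\<in>mats 0 n. F (a * ?X, b * ?X) (c / a)) = ?T0"
    by (rule sum.cong[OF refl]) (auto simp: p0_def mats_def Rdeg_def field_simps)
  moreover have "(\<Sum>(a, b, c, d)\<in>mats 1 n. F (b * ?X, a * ?X) (- c / a)) = ?T1"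
    by (rule sum.cong[OF refl]) (auto simp: p1_def mats_def Rdeg_def field_simps)
  ultimately have L: "Lambda n F = \<kappa> * (?T0 + ?T1)"
    using Lambda_eq_mats_sum[of F n, OF per] m by (simp only: \<kappa>_def)
  let ?err = "4 * K * ?q ^ (n + 5 * m + 3) + \<eta> * ?q ^ (2 * n + 2)"
  let ?C = "(?q - 1) * ?q ^ (2 * n + 2) / ?q ^ (3 * m)"
  have sphere_u: "(u, x) \<in> sphere1" "(x, u) \<in> sphere1" if "unitO u" "x \<in> vball 0" for u x :: "'a fls"
    using that unitO_vball[OF that(1)] by (auto simp: sphere1_iff)
  have mult_cong: "u * x - u' * x' \<in> vball (int m)"
    if "unitO u" "x' \<in> vball 0" "u - u' \<in> vball (int m)" "x - x' \<in> vball (int m)" for u u' x x' :: "'a fls"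
  proof -
    have "u * x - u' * x' = u * (x - x') + (u - u') * x'" by (simp add: algebra_simps)
    also have "\<dots> \<in> vball (int m)" using that unitO_vball[OF that(1)]
      by (intro vball_add vball_mult_0(1)[of u] vball_mult_0(2)[of "u - u'"])
    finally show ?thesis .
  qed
  have ux: "u * x \<in> vball k" if "unitO u" "x \<in> vball k" for u x :: "'a fls" and k
    using that vball_unit_mult by blast
  have E0: "\<bar>?T0 - ?C * ?S0\<bar> \<le> ?err"
  proof (rule mats_equidistribution_osc[OF m])
    fix u u' x x' y y' :: "'a fls"
    assume *: "unitO u" "unitO u'" "x \<in> vball 0" "x' \<in> vball 0" "y \<in> vball 1" "y' \<in> vball 1"
      "u - u' \<in> vball (int m)" "x - x' \<in> vball (int m)" "y - y' \<in> vball (int m)"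
    show "\<bar>p0 u x y - p0 u' x' y'\<bar> \<le> \<eta>" unfolding p0_def
      by (rule osc) (use * sphere_u ux mult_cong[of u x' u' x] in auto)
  next
    fix u x y :: "'a fls" assume *: "unitO u" "x \<in> vball 0" "y \<in> vball 1"
    then show "\<bar>p0 u x y\<bar> \<le> K" unfolding p0_def by (intro bound sphere_u ux)
  qed auto
  have E1: "\<bar>?T1 - ?C * ?S1\<bar> \<le> ?err"
  proof (rule mats_equidistribution_osc[OF m])
    fix u u' x x' y y' :: "'a fls"
    assume *: "unitO u" "unitO u'" "x \<in> vball 1" "x' \<in> vball 1" "y \<in> vball 1" "y' \<in> vball 1"
      "u - u' \<in> vball (int m)" "x - x' \<in> vball (int m)" "y - y' \<in> vball (int m)"
    then have **: "x \<in> vball 0" "x' \<in> vball 0" by (auto intro: vball_mono)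
    have "- y - - y' = - (y - y')" by simp
    then have "- y - - y' \<in> vball (int m)" using *(9) by (simp only: vball_uminus_iff)
    then show "\<bar>p1 u x y - p1 u' x' y'\<bar> \<le> \<eta>" unfolding p1_def
      by (intro osc) (use * ** sphere_u ux mult_cong[of u x' u' x] in auto)
  next
    fix u x y :: "'a fls" assume *: "unitO u" "x \<in> vball 1" "y \<in> vball 1"
    then have "x \<in> vball 0" by (auto intro: vball_mono)
    with * show "\<bar>p1 u x y\<bar> \<le> K" unfolding p1_def by (intro bound sphere_u ux vball_uminus)
  qed auto
  have "\<bar>\<kappa> * (?T0 + ?T1) - \<kappa> * ?C * (?S0 + ?S1)\<bar> = \<kappa> * \<bar>(?T0 - ?C * ?S0) + (?T1 - ?C * ?S1)\<bar>"
  proof -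
    have "\<kappa> * (?T0 + ?T1) - \<kappa> * ?C * (?S0 + ?S1) = \<kappa> * ((?T0 - ?C * ?S0) + (?T1 - ?C * ?S1))" by (simp only: algebra_simps)
    then show ?thesis using \<kappa>0 by (simp only: abs_mult abs_of_pos)
  qed
  also have "\<dots> \<le> \<kappa> * (?err + ?err)"
    using E0 E1 \<kappa>0 by (intro mult_left_mono order_trans[OF abs_triangle_ineq] add_mono) auto
  also have "\<kappa> * (?err + ?err) = (8 * K * ?q ^ (n + 5 * m + 3)) * \<kappa> + (2 * \<eta> * ?q ^ (2 * n + 2)) * \<kappa>"
    by (simp only: algebra_simps)
  also have "\<dots> \<le> 8 * K * ?q ^ (5 * m + 1) / ?q ^ n + 2 * \<eta>"
  proof (rule add_mono)
    have "\<kappa> \<le> 1 / ?q ^ (2 * n + 2)" unfolding \<kappa> by (rule Lambda_coeff_le)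
    then have le: "z * \<kappa> \<le> z / ?q ^ (2 * n + 2)" if "z \<ge> 0" for z
      using mult_left_mono[OF _ that, of \<kappa> "1 / ?q ^ (2 * n + 2)"] by simp
    have "(8 * K * ?q ^ (n + 5 * m + 3)) * \<kappa> \<le> 8 * K * ?q ^ (n + 5 * m + 3) / ?q ^ (2 * n + 2)"
      using K0 q by (intro le) auto
    also have "\<dots> = 8 * K * ?q ^ (5 * m + 1) / ?q ^ n"
    proof -
      have "?q ^ (n + 5 * m + 3) * ?q ^ n = ?q ^ (5 * m + 1) * ?q ^ (2 * n + 2)"
      proof -
        have "n + 5 * m + 3 + n = 5 * m + 1 + (2 * n + 2)" by simp
        then show ?thesis by (simp only: power_add[symmetric])
      qed
      then show ?thesis using q by (simp add: field_simps)
    qed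
    finally show "(8 * K * ?q ^ (n + 5 * m + 3)) * \<kappa> \<le> 8 * K * ?q ^ (5 * m + 1) / ?q ^ n" .
    show "(2 * \<eta> * ?q ^ (2 * n + 2)) * \<kappa> \<le> 2 * \<eta>" using le[of "2 * \<eta> * ?q ^ (2 * n + 2)"] \<eta>0 q by simp
  qed
  also have "\<kappa> * ?C = 1 / ?q ^ (3 * m)" unfolding \<kappa> using q by simp
  finally have part1: "\<bar>Lambda n F - (?S0 + ?S1) / ?q ^ (3 * m)\<bar> \<le> 8 * K * ?q ^ (5 * m + 1) / ?q ^ n + 2 * \<eta>"
    unfolding L by simp

  \<comment> \<open>Passage from the coordinates \<open>(u, x)\<close> to \<open>(u, w)\<close> with
    \<open>w\<close> the truncation of \<open>u * x\<close>, which for fixed \<open>u\<close> is a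
    permutation of the digits.\<close>
  let ?R0 = "\<Sum>u\<in>?U. \<Sum>w\<in>?D 0. \<Sum>z\<in>?E. F (u, w) z" and ?R1 = "\<Sum>u\<in>?U. \<Sum>w\<in>?D 1. \<Sum>z\<in>?E. F (w, u) z"
  have cardle: "real (card ?U) * (real (card (?D v)) * (real (card ?E) * \<eta>)) \<le> ?q ^ (3 * m) * \<eta>" if "v \<ge> 0" for v
  proof -
    have "real (card ?U) \<le> ?q ^ m" using card_units_le[of m, where 'a='a] by (simp flip: of_nat_power)
    moreover have "real (card (?D v)) \<le> ?q ^ m" "real (card ?E) \<le> ?q ^ m"
      using that q by (auto simp: card_digits intro!: power_increasing)
    ultimately have "real (card ?U) * (real (card (?D v)) * (real (card ?E) * \<eta>)) \<le> ?q ^ m * (?q ^ m * (?q ^ m * \<eta>))"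
      using \<eta>0 by (intro mult_mono) auto
    also have "\<dots> = ?q ^ (m + m + m) * \<eta>" by (simp only: power_add mult.assoc)
    also have "m + m + m = 3 * m" by simp
    finally show ?thesis .
  qed
  have UD: "unitO u" if "u \<in> ?U" for u using that by (simp add: units_def)
  have "?R0 = (\<Sum>u\<in>?U. \<Sum>x\<in>?D 0. \<Sum>z\<in>?E. F (u, cutoff (int m) (u * x)) z)"
    by (intro sum.cong refl sum.reindex_bij_betw[OF unit_mult_digits_bij, symmetric] UD)
  moreover have "\<bar>?S0 - (\<Sum>u\<in>?U. \<Sum>x\<in>?D 0. \<Sum>z\<in>?E. F (u, cutoff (int m) (u * x)) z)\<bar> \<le> real (card ?U) * (real (card (?D 0)) * (real (card ?E) * \<eta>))"
  proof (intro abs_sum_diff_le)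
    fix u x z assume "u \<in> ?U" "x \<in> ?D 0" "z \<in> ?E"
    then have "unitO u" "x \<in> vball 0" "z \<in> vball 1" by (auto simp: UD digits_def)
    then show "\<bar>p0 u x z - F (u, cutoff (int m) (u * x)) z\<bar> \<le> \<eta>"
      unfolding p0_def by (intro osc) (auto simp: diff_cutoff intro!: sphere_u(1) ux cutoff_vball)
  qed
  ultimately have D0: "\<bar>?S0 - ?R0\<bar> \<le> ?q ^ (3 * m) * \<eta>" using cardle[of 0] by linarith
  have "?R1 = (\<Sum>u\<in>?U. \<Sum>x\<in>?D 1. \<Sum>z\<in>?E. F (cutoff (int m) (u * x), u) z)"
    by (intro sum.cong refl sum.reindex_bij_betw[OF unit_mult_digits_bij, symmetric] UD)
  also have "\<dots> = (\<Sum>u\<in>?U. \<Sum>x\<in>?D 1. \<Sum>z\<in>?E. F (cutoff (int m) (u * x), u) (- z))"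
    by (intro sum.cong refl sum.reindex_bij_betw[OF uminus_digits_bij, symmetric])
  moreover have "\<bar>?S1 - (\<Sum>u\<in>?U. \<Sum>x\<in>?D 1. \<Sum>z\<in>?E. F (cutoff (int m) (u * x), u) (- z))\<bar> \<le> real (card ?U) * (real (card (?D 1)) * (real (card ?E) * \<eta>))"
  proof (intro abs_sum_diff_le)
    fix u x z assume "u \<in> ?U" "x \<in> ?D 1" "z \<in> ?E"
    then have "unitO u" "x \<in> vball 0" "z \<in> vball 1" by (auto simp: UD digits_def intro: vball_mono)
    then show "\<bar>p1 u x z - F (cutoff (int m) (u * x), u) (- z)\<bar> \<le> \<eta>"
      unfolding p1_def by (intro osc) (auto simp: diff_cutoff intro!: sphere_u ux cutoff_vball)
  qed
  ultimately have D1: "\<bar>?S1 - ?R1\<bar> \<le> ?q ^ (3 * m) * \<eta>" using cardle[of 1] by linarith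
  have "\<bar>(?S0 + ?S1) - (?R0 + ?R1)\<bar> \<le> ?q ^ (3 * m) * (2 * \<eta>)" using D0 D1 by linarith
  then have "\<bar>(?S0 + ?S1) - (?R0 + ?R1)\<bar> / ?q ^ (3 * m) \<le> 2 * \<eta>" using q by (simp add: field_simps)
  then have "\<bar>(?S0 + ?S1) / ?q ^ (3 * m) - digit_mean m F\<bar> \<le> 2 * \<eta>"
    unfolding digit_mean_split[OF m(1)] using q by (simp add: diff_divide_distrib[symmetric] abs_divide)
  then show ?thesis using part1 by linarith
qed

section \<open>Integrals as means over digits\<close>

text \<open>The map \<open>h\<close> pushes the probability measure \<open>N\<close> forward to the
  uniform measure on the finite set \<open>S\<close>. The formulation by fibres needs no measurable
  structure on the target.\<close>

definition equi :: "'x measure \<Rightarrow> ('x \<Rightarrow> 'y) \<Rightarrow> 'y set \<Rightarrow> bool" where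
  "equi N h S \<longleftrightarrow> prob_space N \<and> finite S \<and> S \<noteq> {} \<and> h \<in> space N \<rightarrow> S \<and>
     (\<forall>s\<in>S. h -` {s} \<inter> space N \<in> sets N \<and> measure N (h -` {s} \<inter> space N) = 1 / real (card S))"

lemma equi_pair:
  assumes "equi N h S" "equi N' h' S'"
  shows "equi (N \<Otimes>\<^sub>M N') (map_prod h h') (S \<times> S')"
proof -
  interpret N: prob_space N using assms by (simp add: equi_def)
  interpret N': prob_space N' using assms by (simp add: equi_def)
  interpret P: pair_prob_space N N' ..
  have "map_prod h h' -` {z} \<inter> space (N \<Otimes>\<^sub>M N') \<in> sets (N \<Otimes>\<^sub>M N') \<and>
      measure (N \<Otimes>\<^sub>M N') (map_prod h h' -` {z} \<inter> space (N \<Otimes>\<^sub>M N')) = 1 / real (card (S \<times> S'))"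
    if zS: "z \<in> S \<times> S'" for z
  proof -
    obtain s s' where z: "z = (s, s')" "s \<in> S" "s' \<in> S'" using zS by auto
    let ?A = "h -` {s} \<inter> space N" and ?B = "h' -` {s'} \<inter> space N'"
    have AB: "?A \<in> sets N" "?B \<in> sets N'" using assms z by (auto simp: equi_def)
    have eq: "map_prod h h' -` {z} \<inter> space (N \<Otimes>\<^sub>M N') = ?A \<times> ?B"
      by (auto simp: z space_pair_measure)
    have "measure (N \<Otimes>\<^sub>M N') (?A \<times> ?B) = measure N ?A * measure N' ?B"
      using AB by (simp add: measure_def N'.emeasure_pair_measure_Times enn2real_mult)
    then show ?thesis unfolding eq using AB assms z by (auto simp: equi_def card_cartesian_product)
  qed
  moreover have "prob_space (N \<Otimes>\<^sub>M N')" by unfold_locales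
  ultimately show ?thesis using assms by (auto simp: equi_def space_pair_measure)
qed

lemma equi_integral:
  fixes G :: "'y \<Rightarrow> real"
  assumes "equi N h S"
  shows "integrable N (\<lambda>x. G (h x))" "(\<integral>x. G (h x) \<partial>N) = (\<Sum>s\<in>S. G s) / real (card S)"
proof -
  interpret N: prob_space N using assms by (simp add: equi_def)
  have fin: "finite S" using assms by (simp add: equi_def)
  let ?A = "\<lambda>s. h -` {s} \<inter> space N"
  have A: "?A s \<in> sets N" "measure N (?A s) = 1 / real (card S)" if "s \<in> S" for s using assms that by (auto simp: equi_def)
  have eq: "G (h x) = (\<Sum>s\<in>S. G s * indicator (?A s) x)" if "x \<in> space N" for x
  proof -
    have "h x \<in> S" using assms that by (auto simp: equi_def)
    then have "(\<Sum>s\<in>S. G s * indicator (?A s) x) = (\<Sum>s\<in>S. if s = h x then G s else 0)"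
      using that by (intro sum.cong refl) (auto simp: indicator_def)
    then show ?thesis using fin \<open>h x \<in> S\<close> by simp
  qed
  have int: "integrable N (\<lambda>x. \<Sum>s\<in>S. G s * indicator (?A s) x)"
    using A by (intro Bochner_Integration.integrable_sum integrable_mult_right) (simp add: N.emeasure_eq_measure)
  have cong: "integrable N (\<lambda>x. G (h x)) = integrable N (\<lambda>x. \<Sum>s\<in>S. G s * indicator (?A s) x)"
    by (rule Bochner_Integration.integrable_cong) (auto simp: eq)
  show "integrable N (\<lambda>x. G (h x))" using int cong by simp
  have "(\<integral>x. G (h x) \<partial>N) = (\<integral>x. (\<Sum>s\<in>S. G s * indicator (?A s) x) \<partial>N)"
    by (rule Bochner_Integration.integral_cong) (auto simp: eq)
  also have "\<dots> = (\<Sum>s\<in>S. G s * measure N (?A s))"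
    using A by (subst Bochner_Integration.integral_sum) (auto simp: N.emeasure_eq_measure)
  finally show "(\<integral>x. G (h x) \<partial>N) = (\<Sum>s\<in>S. G s) / real (card S)"
    using A by (simp add: sum_divide_distrib)
qed

lemma equi_approx:
  fixes G :: "'x \<Rightarrow> real" and G' :: "'y \<Rightarrow> real"
  assumes E: "equi N h S" and meas: "G \<in> borel_measurable N"
    and close: "\<And>x. x \<in> space N \<Longrightarrow> \<bar>G x - G' (h x)\<bar> \<le> \<eta>"
  shows "\<bar>(\<integral>x. G x \<partial>N) - (\<Sum>s\<in>S. G' s) / real (card S)\<bar> \<le> \<eta>"
proof -
  interpret N: prob_space N using E by (simp add: equi_def)
  note I = equi_integral[OF E, of G']
  have d: "integrable N (\<lambda>x. G x - G' (h x))"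
    by (rule N.integrable_const_bound[where B = \<eta>]) (use close meas I(1) in auto)
  have "integrable N (\<lambda>x. (G x - G' (h x)) + G' (h x))" using d I(1) by (rule Bochner_Integration.integrable_add)
  then have G: "integrable N G" by simp
  have "\<bar>\<integral>x. G x - G' (h x) \<partial>N\<bar> \<le> (\<integral>x. \<bar>G x - G' (h x)\<bar> \<partial>N)" by (rule integral_abs_bound)
  also have "\<dots> \<le> (\<integral>x. \<eta> \<partial>N)" using d close by (intro integral_mono) auto
  also have "\<dots> = \<eta>" by (simp add: N.prob_space)
  finally show ?thesis using I G by simp
qed

section \<open>Haar measure on digit sequences and its truncations\<close>

definition seqs :: "nat \<Rightarrow> (nat \<Rightarrow> 'a::{finite,field}) set" where
  "seqs m = {c. \<forall>i\<ge>m. c i = 0}"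

definition trn :: "nat \<Rightarrow> (nat \<Rightarrow> 'a::{finite,field}) \<Rightarrow> nat \<Rightarrow> 'a" where
  "trn m c i = (if i < m then c i else 0)"

lemma prob_space_uniform_field: "prob_space (uniform_count_measure (UNIV :: 'a::{finite,field} set))"
  by (rule prob_space_uniform_count_measure) auto

lemma space_haarO [simp]: "space haarO = UNIV"
  by (auto simp: haarO_def space_PiM space_uniform_count_measure)

lemma Oemb_nth: "fls_nth (Oemb c) i = (if i < 0 then 0 else c (nat i))"
  by (simp add: Oemb_def)

lemma XOemb_nth: "fls_nth (fls_X * Oemb c) i = (if i < 1 then 0 else c (nat (i - 1)))"
  by (simp add: fls_X_times_conv_shift Oemb_nth)

lemma Oemb_bij: "bij_betw Oemb (seqs m) (digits 0 (int m) :: 'a::{finite,field} fls set)"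
proof (rule bij_betw_byWitness[where f' = "\<lambda>x i. fls_nth x (int i)"])
  show "Oemb ` seqs m \<subseteq> digits 0 (int m)"
    by (auto simp: seqs_def digits_def vball_def low_def Oemb_nth)
  show "(\<lambda>x i. fls_nth x (int i)) ` digits 0 (int m) \<subseteq> seqs m"
    by (auto simp: seqs_def digits_def low_def)
  show "\<forall>x\<in>digits 0 (int m). Oemb (\<lambda>i. fls_nth x (int i)) = x"
    by (auto intro!: fls_eqI simp: Oemb_nth digits_def vball_def)
qed (auto simp: Oemb_nth)

lemma XOemb_bij: "1 \<le> m \<Longrightarrow> bij_betw (\<lambda>c. fls_X * Oemb c) (seqs (m - 1)) (digits 1 (int m) :: 'a::{finite,field} fls set)"
proof (rule bij_betw_byWitness[where f' = "\<lambda>x i. fls_nth x (int i + 1)"])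
  assume m: "1 \<le> m"
  show "(\<lambda>c. fls_X * Oemb c) ` seqs (m - 1) \<subseteq> digits 1 (int m)"
    by (auto simp: seqs_def digits_def vball_def low_def XOemb_nth)
  show "(\<lambda>x i. fls_nth x (int i + 1)) ` digits 1 (int m) \<subseteq> seqs (m - 1)"
    using m by (auto simp: seqs_def digits_def low_def)
  show "\<forall>x\<in>digits 1 (int m). fls_X * Oemb (\<lambda>i. fls_nth x (int i + 1)) = x"
    by (auto intro!: fls_eqI simp: XOemb_nth digits_def vball_def)
qed (auto simp: XOemb_nth)

lemma card_seqs: "card (seqs m :: (nat \<Rightarrow> 'a::{finite,field}) set) = CARD('a) ^ m"
  using bij_betw_same_card[OF Oemb_bij[of m, where 'a='a]] by (simp add: card_digits)

lemma finite_seqs: "finite (seqs m)"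
  using bij_betw_finite[OF Oemb_bij[of m]] by simp

lemma Oemb_trn: "Oemb (trn m c) = cutoff (int m) (Oemb c)"
  by (auto intro!: fls_eqI simp: Oemb_nth trn_def)

lemma XOemb_trn: "1 \<le> m \<Longrightarrow> fls_X * Oemb (trn (m - 1) c) = cutoff (int m) (fls_X * Oemb c)"
  by (auto intro!: fls_eqI simp: XOemb_nth trn_def)

lemma Oemb_vball: "Oemb c \<in> vball 0" "fls_X * Oemb c \<in> vball 1"
  by (auto simp: vball_def Oemb_nth XOemb_nth)

lemma unitO_Oemb: "unitO (Oemb c) \<longleftrightarrow> c 0 \<noteq> 0"
proof -
  have "Oemb c \<in> vball 1 \<longleftrightarrow> c 0 = 0"
  proof
    assume "Oemb c \<in> vball 1"
    then have "fls_nth (Oemb c) 0 = 0" by (simp add: vball_def)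
    then show "c 0 = 0" by (simp add: Oemb_nth)
  next
    assume "c 0 = 0"
    then have "fls_nth (Oemb c) i = 0" if "i < 1" for i using that by (cases "i = 0") (auto simp: Oemb_nth)
    then show "Oemb c \<in> vball 1" by (simp add: vball_def)
  qed
  then show ?thesis using Oemb_vball(1) by (auto simp: unitO_iff)
qed

text \<open>The fibres of truncation are cylinders, which the infinite product measure weighs by the
  product of the \<open>m\<close> uniform weights.\<close>

lemma equi_haarO: "equi haarO (trn m) (seqs m :: (nat \<Rightarrow> 'a::{finite,field}) set)"
proof -
  let ?M = "uniform_count_measure (UNIV :: 'a set)"
  interpret product_prob_space "\<lambda>_::nat. ?M" UNIV
    by (unfold product_prob_space_def product_prob_space_axioms_def product_sigma_finite_def)
       (auto intro: prob_space_uniform_field prob_space_imp_sigma_finite)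
  have "trn m -` {s} \<inter> space haarO \<in> sets haarO \<and> measure haarO (trn m -` {s} \<inter> space haarO) = 1 / real (card (seqs m :: (nat \<Rightarrow> 'a) set))"
    if s: "s \<in> seqs m" for s :: "nat \<Rightarrow> 'a"
  proof -
    let ?E = "PiE {..<m} (\<lambda>i. {s i})"
    have eq: "trn m -` {s} \<inter> space haarO = prod_emb UNIV (\<lambda>_. ?M) {..<m} ?E"
    proof (intro set_eqI iffI)
      fix c assume "c \<in> trn m -` {s} \<inter> space haarO"
      then have "trn m c i = s i" for i by auto
      then have "c i = s i" if "i < m" for i using that by (metis trn_def)
      then show "c \<in> prod_emb UNIV (\<lambda>_. ?M) {..<m} ?E"
        by (auto simp: prod_emb_def space_PiM space_uniform_count_measure)
    next
      fix c assume "c \<in> prod_emb UNIV (\<lambda>_. ?M) {..<m} ?E"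
      then have "c i = s i" if "i < m" for i using that by (auto simp: prod_emb_def PiE_iff restrict_def split: if_splits)
      then have "trn m c = s" using s by (auto simp: trn_def seqs_def)
      then show "c \<in> trn m -` {s} \<inter> space haarO" by simp
    qed
    have "measure haarO (prod_emb UNIV (\<lambda>_. ?M) {..<m} ?E) = (\<Prod>i<m. measure ?M {s i})"
      unfolding haarO_def by (rule measure_PiM_emb) auto
    also have "\<dots> = 1 / real (card (seqs m :: (nat \<Rightarrow> 'a) set))"
      by (simp add: measure_uniform_count_measure card_seqs power_one_over)
    finally have "measure haarO (trn m -` {s} \<inter> space haarO) = 1 / real (card (seqs m :: (nat \<Rightarrow> 'a) set))" by (simp only: eq)
    moreover have "prod_emb UNIV (\<lambda>_. ?M) {..<m} ?E \<in> sets haarO"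
      unfolding haarO_def by (intro sets_PiM_I) auto
    ultimately show ?thesis by (simp only: eq)
  qed
  moreover have "prob_space (haarO :: (nat \<Rightarrow> 'a) measure)" unfolding haarO_def by (rule prob_space_PiM) (rule prob_space_uniform_field)
  moreover have "(\<lambda>_. 0 :: 'a) \<in> seqs m" by (simp add: seqs_def)
  moreover have "trn m \<in> space haarO \<rightarrow> (seqs m :: (nat \<Rightarrow> 'a) set)" by (auto simp: seqs_def trn_def)
  ultimately show ?thesis unfolding equi_def using finite_seqs by blast
qed

lemma sum_seqs3:
  fixes P :: "'a::{finite,field} fls \<Rightarrow> 'a fls \<Rightarrow> 'a fls \<Rightarrow> real"
  assumes "1 \<le> m"
  shows "(\<Sum>p\<in>(seqs m \<times> seqs m) \<times> seqs (m - 1). P (Oemb (fst (fst p))) (Oemb (snd (fst p))) (fls_X * Oemb (snd p)))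
    = (\<Sum>x\<in>digits 0 (int m). \<Sum>y\<in>digits 0 (int m). \<Sum>z\<in>digits 1 (int m). P x y z)"
proof -
  have "(\<Sum>p\<in>(seqs m \<times> seqs m) \<times> seqs (m - 1). P (Oemb (fst (fst p))) (Oemb (snd (fst p))) (fls_X * Oemb (snd p)))
    = (\<Sum>c\<in>seqs m. \<Sum>c'\<in>seqs m. \<Sum>e\<in>seqs (m - 1). P (Oemb c) (Oemb c') (fls_X * Oemb e))"
    by (simp add: sum.cartesian_product')
  also have "\<dots> = (\<Sum>c\<in>seqs m. \<Sum>c'\<in>seqs m. \<Sum>z\<in>digits 1 (int m). P (Oemb c) (Oemb c') z)"
    by (intro sum.cong refl sum.reindex_bij_betw[OF XOemb_bij[OF assms]])
  also have "\<dots> = (\<Sum>c\<in>seqs m. \<Sum>y\<in>digits 0 (int m). \<Sum>z\<in>digits 1 (int m). P (Oemb c) y z)"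
    by (intro sum.cong refl sum.reindex_bij_betw[OF Oemb_bij])
  also have "\<dots> = (\<Sum>x\<in>digits 0 (int m). \<Sum>y\<in>digits 0 (int m). \<Sum>z\<in>digits 1 (int m). P x y z)"
    by (rule sum.reindex_bij_betw[OF Oemb_bij])
  finally show ?thesis .
qed

abbreviation haar3 :: "(((nat \<Rightarrow> 'a::{finite,field}) \<times> (nat \<Rightarrow> 'a)) \<times> (nat \<Rightarrow> 'a)) measure" where
  "haar3 \<equiv> (haarO \<Otimes>\<^sub>M haarO) \<Otimes>\<^sub>M haarO"

text \<open>The last coordinate is truncated at \<open>m - 1\<close> because it enters as
  \<open>fls_X * Oemb\<close>: its entries below \<open>m - 1\<close> are the coefficients at the
  positions 1 to \<open>m - 1\<close>.\<close>

abbreviation trn3 :: "nat \<Rightarrow> ((nat \<Rightarrow> 'a::{finite,field}) \<times> (nat \<Rightarrow> 'a)) \<times> (nat \<Rightarrow> 'a) \<Rightarrow> ((nat \<Rightarrow> 'a) \<times> (nat \<Rightarrow> 'a)) \<times> (nat \<Rightarrow> 'a)" where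
  "trn3 m \<equiv> map_prod (map_prod (trn m) (trn m)) (trn (m - 1))"

definition lift_SQ :: "('a::{finite,field} fls \<times> 'a fls \<Rightarrow> 'a fls \<Rightarrow> real) \<Rightarrow> ((nat \<Rightarrow> 'a) \<times> (nat \<Rightarrow> 'a)) \<times> (nat \<Rightarrow> 'a) \<Rightarrow> real" where
  "lift_SQ F p = (if fst (fst p) 0 \<noteq> 0 \<or> snd (fst p) 0 \<noteq> 0
     then F (Oemb (fst (fst p)), Oemb (snd (fst p))) (fls_X * Oemb (snd p)) else 0)"

lemma lift_SQ_close:
  assumes m: "1 \<le> m" and \<eta>: "0 \<le> \<eta>"
    and osc: "\<And>u u' x x'. u \<in> sphere1 \<Longrightarrow> u' \<in> sphere1 \<Longrightarrow> x \<in> vball 1 \<Longrightarrow> x' \<in> vball 1 \<Longrightarrow>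
      fst u - fst u' \<in> vball (int m) \<Longrightarrow> snd u - snd u' \<in> vball (int m) \<Longrightarrow> x - x' \<in> vball (int m) \<Longrightarrow>
      \<bar>F u x - F u' x'\<bar> \<le> \<eta>"
  shows "\<bar>lift_SQ F p - lift_SQ F (trn3 m p)\<bar> \<le> \<eta>"
proof -
  obtain c c' e where p: "p = ((c, c'), e)" by (metis surj_pair)
  have 0: "trn m c 0 = c 0" "trn m c' 0 = c' 0" using m by (auto simp: trn_def)
  show ?thesis
  proof (cases "c 0 \<noteq> 0 \<or> c' 0 \<noteq> 0")
    case True
    have "\<bar>F (Oemb c, Oemb c') (fls_X * Oemb e) - F (Oemb (trn m c), Oemb (trn m c')) (fls_X * Oemb (trn (m - 1) e))\<bar> \<le> \<eta>"
    proof (rule osc)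
      show "(Oemb c, Oemb c') \<in> sphere1" "(Oemb (trn m c), Oemb (trn m c')) \<in> sphere1"
        using True 0 by (auto simp: sphere1_iff unitO_Oemb Oemb_vball)
      show "fls_X * Oemb e - fls_X * Oemb (trn (m - 1) e) \<in> vball (int m)"
        unfolding XOemb_trn[OF m] by (rule diff_cutoff)
      show "fls_X * Oemb e \<in> vball 1" "fls_X * Oemb (trn (m - 1) e) \<in> vball 1" by (rule Oemb_vball)+
    qed (simp_all only: fst_conv snd_conv Oemb_vball Oemb_trn diff_cutoff)
    then show ?thesis using True 0 by (simp add: p lift_SQ_def)
  next
    case False
    then show ?thesis using 0 \<eta> by (simp add: p lift_SQ_def)
  qed
qed

lemma equi_haar3: "equi haar3 (trn3 m) ((seqs m \<times> seqs m) \<times> seqs (m - 1))"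
  by (intro equi_pair equi_haarO)

lemma digit_mean_eq:
  fixes F :: "'a::{finite,field} fls \<times> 'a fls \<Rightarrow> 'a fls \<Rightarrow> real"
  assumes m: "1 \<le> m"
  shows "digit_mean m F = 1 / real CARD('a) * ((\<Sum>p\<in>(seqs m \<times> seqs m) \<times> seqs (m - 1). lift_SQ F p)
      / real (card ((seqs m \<times> seqs m) \<times> seqs (m - 1) :: (((nat \<Rightarrow> 'a) \<times> (nat \<Rightarrow> 'a)) \<times> (nat \<Rightarrow> 'a)) set)))"
proof -
  have sums: "(\<Sum>p\<in>(seqs m \<times> seqs m) \<times> seqs (m - 1). lift_SQ F p) = (\<Sum>x\<in>digits 0 (int m). \<Sum>y\<in>digits 0 (int m). \<Sum>z\<in>digits 1 (int m).
     if unitO x \<or> unitO y then F (x, y) z else 0)"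
    using sum_seqs3[OF m, of "\<lambda>x y z. if unitO x \<or> unitO y then F (x, y) z else 0"] by (simp add: lift_SQ_def unitO_Oemb)
  have cards: "real CARD('a) * real (card ((seqs m \<times> seqs m) \<times> seqs (m - 1) :: (((nat \<Rightarrow> 'a) \<times> (nat \<Rightarrow> 'a)) \<times> (nat \<Rightarrow> 'a)) set))
      = real CARD('a) ^ (3 * m)"
  proof -
    have "1 + (m + m + (m - 1)) = 3 * m" using m by simp
    then have "real CARD('a) ^ 1 * (real CARD('a) ^ m * real CARD('a) ^ m * real CARD('a) ^ (m - 1)) = real CARD('a) ^ (3 * m)"
      by (simp only: power_add[symmetric])
    then show ?thesis by (simp add: card_cartesian_product card_seqs)
  qed
  show ?thesis unfolding digit_mean_def sums[symmetric] cards[symmetric] by (simp only: times_divide_times_eq mult_1)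
qed

lemma int_prod_near_digit_mean:
  fixes F :: "'a::{finite,field} fls \<times> 'a fls \<Rightarrow> 'a fls \<Rightarrow> real"
  assumes m: "1 \<le> m" and meas: "lift_SQ F \<in> borel_measurable haar3" and \<eta>: "0 \<le> \<eta>"
    and osc: "\<And>u u' x x'. u \<in> sphere1 \<Longrightarrow> u' \<in> sphere1 \<Longrightarrow> x \<in> vball 1 \<Longrightarrow> x' \<in> vball 1 \<Longrightarrow>
      fst u - fst u' \<in> vball (int m) \<Longrightarrow> snd u - snd u' \<in> vball (int m) \<Longrightarrow> x - x' \<in> vball (int m) \<Longrightarrow>
      \<bar>F u x - F u' x'\<bar> \<le> \<eta>"
  shows "\<bar>int_prod F - digit_mean m F\<bar> \<le> \<eta>"
proof -
  let ?I = "\<integral>p. lift_SQ F p \<partial>haar3"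
  let ?S = "(\<Sum>p\<in>(seqs m \<times> seqs m) \<times> seqs (m - 1). lift_SQ F p)
      / real (card ((seqs m \<times> seqs m) \<times> seqs (m - 1) :: (((nat \<Rightarrow> 'a) \<times> (nat \<Rightarrow> 'a)) \<times> (nat \<Rightarrow> 'a)) set))"
  have "\<bar>?I - ?S\<bar> \<le> \<eta>"
    using equi_approx[OF equi_haar3 meas lift_SQ_close[OF m \<eta> osc]] by simp
  then have "\<bar>1 / real CARD('a) * ?I - 1 / real CARD('a) * ?S\<bar> \<le> 1 / real CARD('a) * \<eta>"
    by (subst right_diff_distrib[symmetric]) (simp add: abs_mult divide_right_mono)
  also have "\<dots> \<le> 1 * \<eta>" using card_field_gt_1[where 'a='a] \<eta> by (intro mult_right_mono) auto
  finally show ?thesis unfolding digit_mean_eq[OF m] int_prod_def lift_SQ_def by simp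
qed

text \<open>For functions constant at level \<open>m\<close> both integrals are exact finite means,
  so the product of integrals equals the Riemann sum without error.\<close>

lemma int_sphere_int_quot:
  fixes f :: "'a::{finite,field} fls \<times> 'a fls \<Rightarrow> real" and g :: "'a fls \<Rightarrow> real"
  assumes m: "1 \<le> m"
    and f: "\<And>u u'. u \<in> sphere1 \<Longrightarrow> u' \<in> sphere1 \<Longrightarrow> fst u - fst u' \<in> vball (int m) \<Longrightarrow> snd u - snd u' \<in> vball (int m) \<Longrightarrow> f u = f u'"
    and g: "\<And>x x'. x - x' \<in> vball (int m) \<Longrightarrow> g x = g x'"
  shows "int_sphere f * int_quot g = digit_mean m (\<lambda>u x. f u * g x)"
proof -
  let ?D = "digits 0 (int m) :: 'a fls set" and ?E = "digits 1 (int m) :: 'a fls set"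
  let ?G = "\<lambda>p. if fst p 0 \<noteq> 0 \<or> snd p 0 \<noteq> 0 then f (Oemb (fst p), Oemb (snd p)) else 0"
  have "?G p = ?G (map_prod (trn m) (trn m) p)" for p
  proof -
    obtain c c' where p: "p = (c, c')" by (cases p)
    have 0: "trn m c 0 = c 0" "trn m c' 0 = c' 0" using m by (auto simp: trn_def)
    show ?thesis
    proof (cases "c 0 \<noteq> 0 \<or> c' 0 \<noteq> 0")
      case True
      have "f (Oemb c, Oemb c') = f (Oemb (trn m c), Oemb (trn m c'))"
      proof (rule f)
        show "(Oemb c, Oemb c') \<in> sphere1" "(Oemb (trn m c), Oemb (trn m c')) \<in> sphere1"
          using True 0 by (auto simp: sphere1_iff unitO_Oemb Oemb_vball)
      qed (auto simp: Oemb_trn diff_cutoff)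
      then show ?thesis using 0 by (simp add: p)
    qed (simp add: p 0)
  qed
  then have "int_sphere f = (\<integral>p. ?G (map_prod (trn m) (trn m) p) \<partial>(haarO \<Otimes>\<^sub>M haarO))"
    unfolding int_sphere_def by presburger
  also have "\<dots> = (\<Sum>p\<in>seqs m \<times> seqs m. ?G p) / real (card (seqs m \<times> seqs m :: ((nat \<Rightarrow> 'a) \<times> (nat \<Rightarrow> 'a)) set))"
    by (rule equi_integral(2)[OF equi_pair[OF equi_haarO equi_haarO], of ?G])
  also have "(\<Sum>p\<in>seqs m \<times> seqs m. ?G p) = (\<Sum>c\<in>seqs m. \<Sum>c'\<in>seqs m. if unitO (Oemb c) \<or> unitO (Oemb c') then f (Oemb c, Oemb c') else 0)"
    unfolding sum.cartesian_product' fst_conv snd_conv unitO_Oemb by (rule refl)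
  also have "\<dots> = (\<Sum>c\<in>seqs m. \<Sum>y\<in>?D. if unitO (Oemb c) \<or> unitO y then f (Oemb c, y) else 0)"
    by (intro sum.cong refl sum.reindex_bij_betw[OF Oemb_bij, of "\<lambda>y. if unitO (Oemb _) \<or> unitO y then f (Oemb _, y) else 0"])
  also have "\<dots> = (\<Sum>x\<in>?D. \<Sum>y\<in>?D. if unitO x \<or> unitO y then f (x, y) else 0)"
    by (rule sum.reindex_bij_betw[OF Oemb_bij])
  finally have 1: "int_sphere f = (\<Sum>x\<in>?D. \<Sum>y\<in>?D. if unitO x \<or> unitO y then f (x, y) else 0) / (real CARD('a) ^ m * real CARD('a) ^ m)"
    by (simp add: card_cartesian_product card_seqs)
  have "(\<integral>c. g (fls_X * Oemb c) \<partial>haarO) = (\<integral>c. g (fls_X * Oemb (trn (m - 1) c)) \<partial>haarO)"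
    by (intro Bochner_Integration.integral_cong refl g) (simp only: XOemb_trn[OF m] diff_cutoff)
  also have "\<dots> = (\<Sum>c\<in>seqs (m - 1). g (fls_X * Oemb c)) / real (card (seqs (m - 1) :: (nat \<Rightarrow> 'a) set))"
    by (rule equi_integral(2)[OF equi_haarO, of "\<lambda>c. g (fls_X * Oemb c)"])
  also have "(\<Sum>c\<in>seqs (m - 1). g (fls_X * Oemb c)) = (\<Sum>z\<in>?E. g z)"
    by (rule sum.reindex_bij_betw[OF XOemb_bij[OF m]])
  finally have 2: "int_quot g = (\<Sum>z\<in>?E. g z) / real CARD('a) ^ m"
    unfolding int_quot_def using m by (cases m) (auto simp: card_seqs)
  have "(\<Sum>x\<in>?D. \<Sum>y\<in>?D. if unitO x \<or> unitO y then f (x, y) else 0) * (\<Sum>z\<in>?E. g z)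
    = (\<Sum>x\<in>?D. \<Sum>y\<in>?D. \<Sum>z\<in>?E. if unitO x \<or> unitO y then f (x, y) * g z else 0)"
    unfolding sum_distrib_right by (intro sum.cong refl) (simp add: sum_distrib_left)
  moreover have "real CARD('a) ^ m * real CARD('a) ^ m * real CARD('a) ^ m = real CARD('a) ^ (3 * m)"
  proof -
    have "m + m + m = 3 * m" by simp
    then show ?thesis by (simp only: power_add[symmetric])
  qed
  ultimately show ?thesis unfolding 1 2 digit_mean_def by simp
qed

section \<open>Conclusion\<close>

text \<open>The sequences over a finite alphabet form a compact space by Tychonoff, so finitely many
  of the open cylinders \<open>U p\<close> cover it, and the sum of their depths bounds each depth.
  As \<open>Good\<close> need not be monotone in \<open>k\<close>, the centre \<open>p\<close> and
  its own depth are kept in the conclusion.\<close>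

lemma cantor_space_modulus:
  fixes Good :: "(nat \<Rightarrow> 'b::finite) \<Rightarrow> nat \<Rightarrow> bool"
  assumes "\<And>p. \<exists>k. Good p k"
  obtains m where "\<And>p'. \<exists>p k. k \<le> m \<and> Good p k \<and> (\<forall>i<k. p' i = p i)"
proof -
  obtain K where K: "\<And>p. Good p (K p)" using assms by metis
  let ?X = "product_topology (\<lambda>_::nat. discrete_topology (UNIV :: 'b set)) UNIV"
  define U where "U p = {p'. \<forall>i<K p. p' i = p i}" for p
  have top: "topspace ?X = UNIV" by (simp add: PiE_def)
  have "compact_space ?X"
    by (simp add: compact_space_product_topology compact_space_discrete_topology)
  moreover have "openin ?X (U p)" for p
  proof -
    have "U p = PiE UNIV (\<lambda>i. if i < K p then {p i} else UNIV)" by (auto simp: U_def PiE_def Pi_iff split: if_splits)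
    moreover have "openin ?X (PiE UNIV (\<lambda>i. if i < K p then {p i} else UNIV))"
    proof (rule product_topology_basis)
      show "finite {i. (if i < K p then {p i} else UNIV) \<noteq> topspace (discrete_topology (UNIV :: 'b set))}"
        by (rule finite_subset[of _ "{..<K p}"]) auto
    qed auto
    ultimately show ?thesis by simp
  qed
  moreover have "topspace ?X \<subseteq> \<Union> (range U)" by (auto simp: U_def)
  ultimately obtain \<F> where F: "finite \<F>" "\<F> \<subseteq> range U" "topspace ?X \<subseteq> \<Union> \<F>"
    using compactinD[of ?X "topspace ?X" "range U"] by (auto simp: compact_space_def)
  obtain P where P: "finite P" "\<F> = U ` P" using F(1,2) by (meson finite_subset_image)
  have "\<exists>p k. k \<le> (\<Sum>p\<in>P. K p) \<and> Good p k \<and> (\<forall>i<k. p' i = p i)" for p'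
  proof -
    obtain p where "p \<in> P" "p' \<in> U p" using F(3) P by (auto simp: top)
    moreover have "K p \<le> (\<Sum>p\<in>P. K p)" using \<open>p \<in> P\<close> P(1) by (intro member_le_sum) auto
    ultimately show ?thesis using K by (intro exI[of _ p] exI[of _ "K p"]) (auto simp: U_def)
  qed
  then show ?thesis using that by blast
qed

definition osc_le :: "('a::{finite,field} fls \<times> 'a fls \<Rightarrow> 'a fls \<Rightarrow> real) \<Rightarrow> nat \<Rightarrow> real \<Rightarrow> bool" where
  "osc_le F m \<eta> \<longleftrightarrow> (\<forall>u\<in>sphere1. \<forall>u'\<in>sphere1. \<forall>x\<in>vball 1. \<forall>x'\<in>vball 1.
     fst u - fst u' \<in> vball (int m) \<longrightarrow> snd u - snd u' \<in> vball (int m) \<longrightarrow> x - x' \<in> vball (int m) \<longrightarrow>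
     \<bar>F u x - F u' x'\<bar> \<le> \<eta>)"

lemma Oemb_of_vball0: "x \<in> vball 0 \<Longrightarrow> Oemb (\<lambda>i. fls_nth x (int i)) = x"
  by (auto intro!: fls_eqI simp: Oemb_nth vball_def)

lemma XOemb_of_vball1: "x \<in> vball 1 \<Longrightarrow> fls_X * Oemb (\<lambda>i. fls_nth x (int i + 1)) = x"
  by (auto intro!: fls_eqI simp: XOemb_nth vball_def)

lemma Oemb_diff_vball: "\<forall>i<k. c i = c' i \<Longrightarrow> Oemb c - Oemb c' \<in> vball (int k)"
  by (auto simp: vball_def Oemb_nth)

lemma XOemb_diff_vball: "\<forall>i<k. c i = c' i \<Longrightarrow> fls_X * Oemb c - fls_X * Oemb c' \<in> vball (int k)"
  by (auto simp: vball_def XOemb_nth)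

text \<open>Uniform continuity on a compact space: a point of the sphere together with a point of
  \<open>vball 1\<close> is coded by the sequence of its coefficient triples, to which
  \<open>cantor_space_modulus\<close> applies. Both points are compared with a common centre, hence
  \<open>\<eta> / 2\<close>.\<close>

lemma cont_SQ_uniform:
  fixes F :: "'a::{finite,field} fls \<times> 'a fls \<Rightarrow> 'a fls \<Rightarrow> real"
  assumes cont: "cont_SQ F" and \<eta>: "0 < \<eta>"
  obtains m where "1 \<le> m" "osc_le F m \<eta>"
proof -
  define un where "un p = (Oemb (\<lambda>i. fst (p i)), Oemb (\<lambda>i. fst (snd (p i))))" for p :: "nat \<Rightarrow> 'a \<times> 'a \<times> 'a"
  define xn where "xn p = fls_X * Oemb (\<lambda>i. snd (snd (p i)))" for p :: "nat \<Rightarrow> 'a \<times> 'a \<times> 'a"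
  \<comment> \<open>Off the sphere the condition is vacuous. The demand \<open>1 \<le> k\<close>
    makes a point share its digits at index 0 with the centre, and these digits decide membership in
    the sphere.\<close>
  define Good where "Good p k \<longleftrightarrow> 1 \<le> k \<and> (un p \<in> sphere1 \<longrightarrow> (\<forall>p'. un p' \<in> sphere1 \<longrightarrow> (\<forall>i<k. p' i = p i) \<longrightarrow>
    \<bar>F (un p') (xn p') - F (un p) (xn p)\<bar> < \<eta> / 2))" for p k
  have un_diff: "fst (un p) - fst (un p') \<in> vball (int k)" "snd (un p) - snd (un p') \<in> vball (int k)" "xn p - xn p' \<in> vball (int k)"
    if "\<forall>i<k. p' i = p i" for p p' k
    unfolding un_def xn_def fst_conv snd_conv using that by (auto intro!: Oemb_diff_vball XOemb_diff_vball)
  have sphere_un: "un p \<in> sphere1 \<longleftrightarrow> fst (p 0) \<noteq> 0 \<or> fst (snd (p 0)) \<noteq> 0" for p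
    by (simp add: un_def sphere1_iff Oemb_vball unitO_Oemb)
  have "\<exists>k. Good p k" for p
  proof (cases "un p \<in> sphere1")
    case True
    obtain \<rho> where \<rho>: "\<rho> > 0" "\<And>u' x'. u' \<in> sphere1 \<Longrightarrow> knorm (fst (un p) - fst u', snd (un p) - snd u') \<le> \<rho> \<Longrightarrow>
        kabs (xn p - x') \<le> \<rho> \<Longrightarrow> \<bar>F u' x' - F (un p) (xn p)\<bar> < \<eta> / 2"
    proof -
      have "\<eta> / 2 > 0" using \<eta> by simp
      then show ?thesis using cont True that unfolding cont_SQ_def by metis
    qed
    obtain k where k: "(1 / real CARD('a)) ^ k < \<rho>"
      using real_arch_pow_inv[OF \<rho>(1), of "1 / real CARD('a)"] card_field_gt_1[where 'a='a] by auto
    have "real CARD('a) powi (- int (Suc k)) \<le> (1 / real CARD('a)) ^ k"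
    proof -
      have "(1 / real CARD('a)) ^ Suc k \<le> (1 / real CARD('a)) ^ k"
        using card_field_gt_1[where 'a='a] by (intro power_decreasing) auto
      then show ?thesis by (simp only: power_int_minus power_int_of_nat power_one_over inverse_eq_divide)
    qed
    then have le: "real CARD('a) powi (- int (Suc k)) \<le> \<rho>" using k by linarith
    have "Good p (Suc k)"
      unfolding Good_def
    proof (intro conjI impI allI)
      fix p' assume p': "un p' \<in> sphere1" "\<forall>i<Suc k. p' i = p i"
      note d = un_diff[OF p'(2)]
      show "\<bar>F (un p') (xn p') - F (un p) (xn p)\<bar> < \<eta> / 2"
      proof (rule \<rho>(2)[OF p'(1)])
        show "knorm (fst (un p) - fst (un p'), snd (un p) - snd (un p')) \<le> \<rho>"
          using knorm_le_iff[of "(fst (un p) - fst (un p'), snd (un p) - snd (un p'))" "int (Suc k)"] d le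
          unfolding fst_conv snd_conv by linarith
        show "kabs (xn p - xn p') \<le> \<rho>" using kabs_le_iff[of "xn p - xn p'" "int (Suc k)"] d le by linarith
      qed
    qed simp
    then show ?thesis by blast
  next
    case False
    then show ?thesis by (intro exI[of _ 1]) (simp add: Good_def)
  qed
  then obtain m where m: "\<And>p'. \<exists>p k. k \<le> m \<and> Good p k \<and> (\<forall>i<k. p' i = p i)"
    using cantor_space_modulus[of Good] by blast
  \<comment> \<open>Level \<open>m + 1\<close>, because entry \<open>i\<close> of the code holds the
    coefficient of \<open>x\<close> at position \<open>i + 1\<close>.\<close>
  have "osc_le F (m + 1) \<eta>"
    unfolding osc_le_def
  proof (intro ballI impI)
    fix u u' :: "'a fls \<times> 'a fls" and x x' :: "'a fls"
    assume *: "u \<in> sphere1" "u' \<in> sphere1" "x \<in> vball 1" "x' \<in> vball 1"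
      "fst u - fst u' \<in> vball (int (m + 1))" "snd u - snd u' \<in> vball (int (m + 1))" "x - x' \<in> vball (int (m + 1))"
    define enc where "enc u x = (\<lambda>i. (fls_nth (fst u) (int i), fls_nth (snd u) (int i), fls_nth x (int i + 1)))"
      for u :: "'a fls \<times> 'a fls" and x :: "'a fls"
    have enc: "un (enc u x) = u" "xn (enc u x) = x" if "u \<in> sphere1" "x \<in> vball 1" for u x
      using that by (auto simp: un_def xn_def enc_def sphere1_iff Oemb_of_vball0 XOemb_of_vball1)
    have agree: "enc u x i = enc u' x' i" if "i < m" for i
      using *(5-7) that by (auto simp: enc_def vball_def)
    obtain p k where pk: "k \<le> m" "Good p k" "\<forall>i<k. enc u x i = p i" using m[of "enc u x"] by blast
    have k1: "1 \<le> k" using pk by (simp add: Good_def)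
    have p': "\<forall>i<k. enc u' x' i = p i" using pk agree by (metis order_less_le_trans)
    have "enc u x 0 = p 0" using pk(3) k1 by auto
    then have "un p \<in> sphere1" using *(1) sphere_un[of p] sphere_un[of "enc u x"] enc[OF *(1,3)] by simp
    then have good: "\<bar>F (un p') (xn p') - F (un p) (xn p)\<bar> < \<eta> / 2"
      if "un p' \<in> sphere1" "\<forall>i<k. p' i = p i" for p'
      using pk(2) that unfolding Good_def by blast
    have "un (enc u x) \<in> sphere1" "un (enc u' x') \<in> sphere1" using *(1,2) enc[OF *(1,3)] enc[OF *(2,4)] by simp_all
    then have "\<bar>F (un (enc u x)) (xn (enc u x)) - F (un p) (xn p)\<bar> < \<eta> / 2"
      "\<bar>F (un (enc u' x')) (xn (enc u' x')) - F (un p) (xn p)\<bar> < \<eta> / 2"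
      using good pk(3) p' by blast+
    then show "\<bar>F u x - F u' x'\<bar> \<le> \<eta>" unfolding enc[OF *(1,3)] enc[OF *(2,4)] by linarith
  qed
  then show ?thesis using that[of "m + 1"] by simp
qed

lemma osc_leD:
  assumes "osc_le F m \<eta>" "u \<in> sphere1" "u' \<in> sphere1" "x \<in> vball 1" "x' \<in> vball 1"
    "fst u - fst u' \<in> vball (int m)" "snd u - snd u' \<in> vball (int m)" "x - x' \<in> vball (int m)"
  shows "\<bar>F u x - F u' x'\<bar> \<le> \<eta>"
  using assms unfolding osc_le_def by blast

lemma osc_le_bounded:
  fixes F :: "'a::{finite,field} fls \<times> 'a fls \<Rightarrow> 'a fls \<Rightarrow> real"
  assumes m: "1 \<le> m" and osc: "osc_le F m \<eta>"
  obtains K where "\<And>u x. u \<in> sphere1 \<Longrightarrow> x \<in> vball 1 \<Longrightarrow> \<bar>F u x\<bar> \<le> K"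
proof -
  let ?D = "digits 0 (int m) :: 'a fls set" and ?E = "digits 1 (int m) :: 'a fls set" and ?c = "cutoff (int m) :: 'a fls \<Rightarrow> 'a fls"
  let ?K = "\<eta> + (\<Sum>(u, x)\<in>(?D \<times> ?D) \<times> ?E. \<bar>F u x\<bar>)"
  have "\<bar>F u x\<bar> \<le> ?K" if u: "u \<in> sphere1" and x: "x \<in> vball 1" for u x
  proof -
    obtain a b where ab: "u = (a, b)" by (cases u)
    have v: "a \<in> vball 0" "b \<in> vball 0" "unitO a \<or> unitO b" using u by (auto simp: sphere1_iff ab)
    have "unitO (?c a) \<or> unitO (?c b)" using v(3) unitO_cong[of a "?c a" "int m"] unitO_cong[of b "?c b" "int m"]
        cutoff_diff[of "int m" a] cutoff_diff[of "int m" b] m by auto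
    then have s: "(?c a, ?c b) \<in> sphere1" using v by (auto simp: sphere1_iff intro: cutoff_vball)
    have "\<bar>F u x - F (?c a, ?c b) (?c x)\<bar> \<le> \<eta>"
      by (rule osc_leD[OF osc u s x]) (use x in \<open>auto simp: ab diff_cutoff intro: cutoff_vball\<close>)
    moreover have "(case ((?c a, ?c b), ?c x) of (u, x) \<Rightarrow> \<bar>F u x\<bar>) \<le> (\<Sum>(u, x)\<in>(?D \<times> ?D) \<times> ?E. \<bar>F u x\<bar>)"
      by (rule member_le_sum) (use v x in \<open>auto intro!: cutoff_digits\<close>)
    ultimately show ?thesis by simp
  qed
  then show ?thesis using that by blast
qed

text \<open>The integrand is a limit of its truncations, which take finitely many values on
  measurable cylinders. Measurability makes the Bochner integral in \<open>int_prod\<close> the true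
  integral instead of its default value.\<close>

lemma lift_SQ_measurable:
  fixes F :: "'a::{finite,field} fls \<times> 'a fls \<Rightarrow> 'a fls \<Rightarrow> real"
  assumes "\<And>\<eta>. 0 < \<eta> \<Longrightarrow> \<exists>m\<ge>1. osc_le F m \<eta>"
  shows "lift_SQ F \<in> borel_measurable haar3"
proof -
  have "\<exists>m. 1 \<le> m \<and> osc_le F m (1 / real (Suc j))" for j using assms[of "1 / real (Suc j)"] by auto
  then obtain M where M: "\<And>j. 1 \<le> M j" "\<And>j. osc_le F (M j) (1 / real (Suc j))" by metis
  show ?thesis
  proof (rule borel_measurable_LIMSEQ_real)
    show "(\<lambda>p. lift_SQ F (trn3 (M j) p)) \<in> borel_measurable haar3" for j
      using equi_integral(1)[OF equi_haar3] by (rule borel_measurable_integrable)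
    fix p :: "((nat \<Rightarrow> 'a) \<times> (nat \<Rightarrow> 'a)) \<times> (nat \<Rightarrow> 'a)"
    define D where "D j = lift_SQ F p - lift_SQ F (trn3 (M j) p)" for j
    have close: "\<bar>D j\<bar> \<le> 1 / real (Suc j)" for j
      unfolding D_def by (rule lift_SQ_close[OF M(1) _ osc_leD[OF M(2)]]) simp_all
    have "D \<longlonglongrightarrow> 0"
    proof (rule Lim_null_comparison)
      show "\<forall>\<^sub>F j in sequentially. norm (D j) \<le> 1 / real (Suc j)"
        using close by (simp only: real_norm_def always_eventually simp_thms)
      show "(\<lambda>j. 1 / real (Suc j)) \<longlonglongrightarrow> 0" by (rule lim_1_over_n[THEN LIMSEQ_Suc])
    qed
    then have "(\<lambda>j. lift_SQ F p - D j) \<longlonglongrightarrow> lift_SQ F p - 0" by (intro tendsto_diff tendsto_const)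
    then show "(\<lambda>j. lift_SQ F (trn3 (M j) p)) \<longlonglongrightarrow> lift_SQ F p" by (simp add: D_def)
  qed
qed

lemma Lambda_tendsto:
  fixes F :: "'a::{finite,field} fls \<times> 'a fls \<Rightarrow> 'a fls \<Rightarrow> real"
  assumes cont: "cont_SQ F"
  shows "(\<lambda>n. Lambda n F) \<longlonglongrightarrow> int_prod F"
proof (rule LIMSEQ_I)
  fix e :: real assume e: "0 < e"
  let ?q = "real CARD('a)"
  have per: "\<And>u x r. inR r \<Longrightarrow> F u (x + r) = F u x" using cont unfolding cont_SQ_def by blast
  have unif: "\<exists>m\<ge>1. osc_le F m \<eta>" if "0 < \<eta>" for \<eta> using cont_SQ_uniform[OF cont that] by metis
  \<comment> \<open>The total is six times \<open>\<eta>\<close>: one from the integral, four from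
    \<open>Lambda_near_digit_mean\<close> and one from its term decaying in
    \<open>n\<close>.\<close>
  define \<eta> where "\<eta> = e / 10"
  have \<eta>: "\<eta> > 0" using e by (simp add: \<eta>_def)
  obtain m where m: "1 \<le> m" "osc_le F m \<eta>" using unif[OF \<eta>] by blast
  obtain K where K: "\<And>u x. u \<in> sphere1 \<Longrightarrow> x \<in> vball 1 \<Longrightarrow> \<bar>F u x\<bar> \<le> K" using osc_le_bounded[OF m] by blast
  have I: "\<bar>int_prod F - digit_mean m F\<bar> \<le> \<eta>"
    by (rule int_prod_near_digit_mean[OF m(1) lift_SQ_measurable[OF unif]]) (use \<eta> osc_leD[OF m(2)] in auto)
  let ?c = "8 * K * ?q ^ (5 * m + 1)"
  have "(\<lambda>n. ?c * (1 / ?q) ^ n) \<longlonglongrightarrow> ?c * 0"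
    using card_field_gt_1[where 'a='a] by (intro tendsto_mult tendsto_const LIMSEQ_realpow_zero) auto
  then have "(\<lambda>n. ?c / ?q ^ n) \<longlonglongrightarrow> 0" by (simp add: power_one_over)
  then obtain N where N: "\<And>n. n \<ge> N \<Longrightarrow> norm (?c / ?q ^ n - 0) < \<eta>" using LIMSEQ_D[OF _ \<eta>] by blast
  have "norm (Lambda n F - int_prod F) < e" if n: "n \<ge> max N (2 * m)" for n
  proof -
    have "\<bar>Lambda n F - digit_mean m F\<bar> \<le> 4 * \<eta> + ?c / ?q ^ n"
      by (rule Lambda_near_digit_mean[OF m(1) _ per K]) (use n osc_leD[OF m(2)] in auto)
    moreover have "norm (?c / ?q ^ n - 0) < \<eta>" using N[of n] n by simp
    then have "?c / ?q ^ n < \<eta>" by (simp only: real_norm_def diff_zero abs_less_iff)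
    moreover have "10 * \<eta> = e" by (simp add: \<eta>_def)
    ultimately show ?thesis using I e unfolding real_norm_def by linarith
  qed
  then show "\<exists>N. \<forall>n\<ge>N. norm (Lambda n F - int_prod F) < e" by blast
qed

section \<open>The error term for locally constant test functions\<close>

lemma mats_sphere1:
  assumes "(a, b, c, d) \<in> mats v n" "0 \<le> v"
  shows "(a * fls_X_intpow (int n), b * fls_X_intpow (int n)) \<in> sphere1"
    "(b * fls_X_intpow (int n), a * fls_X_intpow (int n)) \<in> sphere1"
proof -
  let ?X = "fls_X_intpow (int n) :: 'a fls"
  have a: "a \<in> Rdeg n" "b / a \<in> vball 0" using assms by (auto simp: mats_def intro: vball_mono)
  then have u: "unitO (a * ?X)" "a \<noteq> 0" using X_unit[OF a(1)] by (auto simp: Rdeg_def)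
  have "(a * ?X) * (b / a) \<in> vball 0" using vball_unit_mult[OF u(1)] a by blast
  moreover have "(a * ?X) * (b / a) = b * ?X" using u by simp
  ultimately have "b * ?X \<in> vball 0" by (simp only:)
  then show "(a * ?X, b * ?X) \<in> sphere1" "(b * ?X, a * ?X) \<in> sphere1"
    using u unitO_vball[OF u(1)] by (auto simp: sphere1_iff)
qed

text \<open>The trivial bound, for \<open>n\<close> too small in comparison with \<open>m\<close>
  for equidistribution to say anything.\<close>

lemma Lambda_abs_le:
  fixes F :: "'a::{finite,field} fls \<times> 'a fls \<Rightarrow> 'a fls \<Rightarrow> real"
  assumes per: "\<And>u x r. inR r \<Longrightarrow> F u (x + r) = F u x" and n: "1 \<le> n"
    and bound: "\<And>u x. u \<in> sphere1 \<Longrightarrow> x \<in> vball 1 \<Longrightarrow> \<bar>F u x\<bar> \<le> K"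
  shows "\<bar>Lambda n F\<bar> \<le> 2 * K"
proof -
  let ?q = "real CARD('a)" and ?X = "fls_X_intpow (int n) :: 'a fls"
  let ?T0 = "\<Sum>(a, b, c, d)\<in>mats 0 n. F (a * ?X, b * ?X) (c / a)"
  let ?T1 = "\<Sum>(a, b, c, d)\<in>mats 1 n. F (b * ?X, a * ?X) (- c / a)"
  let ?k = "1 / ((?q - 1) * ?q ^ (2 * n + 2))"
  have q: "1 < ?q" by (rule card_field_gt_1)
  have K0: "K \<ge> 0" using bound[of "(1, 0)" 0] by (simp add: sphere1_iff)
  have T: "\<bar>\<Sum>M\<in>mats v n. G M\<bar> \<le> ?q ^ (2 * n + 2) * K"
    if v: "0 \<le> v" "v \<le> 1" and G: "\<And>M. M \<in> mats v n \<Longrightarrow> \<bar>G M\<bar> \<le> K" for v and G :: "'a mat \<Rightarrow> real"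
  proof -
    have "\<bar>\<Sum>M\<in>mats v n. G M\<bar> \<le> (\<Sum>M\<in>(mats v n :: 'a mat set). K)"
      by (rule order_trans[OF sum_abs sum_mono]) (rule G)
    also have "\<dots> \<le> ?q ^ (2 * n + 2) * K"
      using card_mats_le[of v n, where 'a='a] v n K0 by (simp only: sum_constant mult_right_mono)
    finally show ?thesis .
  qed
  have "\<bar>?T0\<bar> \<le> ?q ^ (2 * n + 2) * K"
  proof (rule T)
    fix M :: "'a mat" assume M: "M \<in> mats 0 n"
    obtain a b c d where Me: "M = (a, b, c, d)" by (cases M)
    have "c / a \<in> vball 1" using M by (simp add: Me mats_def)
    then show "\<bar>case M of (a, b, c, d) \<Rightarrow> F (a * ?X, b * ?X) (c / a)\<bar> \<le> K"
      using bound mats_sphere1(1)[of a b c d 0 n] M by (simp add: Me)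
  qed auto
  moreover have "\<bar>?T1\<bar> \<le> ?q ^ (2 * n + 2) * K"
  proof (rule T)
    fix M :: "'a mat" assume M: "M \<in> mats 1 n"
    obtain a b c d where Me: "M = (a, b, c, d)" by (cases M)
    have "c / a \<in> vball 1" using M by (simp add: Me mats_def)
    then show "\<bar>case M of (a, b, c, d) \<Rightarrow> F (b * ?X, a * ?X) (- c / a)\<bar> \<le> K"
      using bound mats_sphere1(2)[of a b c d 1 n] M by (simp add: Me)
  qed auto
  ultimately have "\<bar>?T0 + ?T1\<bar> \<le> ?q ^ (2 * n + 2) * (2 * K)" by linarith
  then have "\<bar>?k * (?T0 + ?T1)\<bar> \<le> ?k * (?q ^ (2 * n + 2) * (2 * K))"
    using q by (simp only: abs_mult) (intro mult_mono, auto)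
  also have "\<dots> \<le> 1 / ?q ^ (2 * n + 2) * (?q ^ (2 * n + 2) * (2 * K))"
    by (rule mult_right_mono[OF Lambda_coeff_le]) (use K0 in auto)
  also have "\<dots> = 2 * K" using q by simp
  also have "?k * (?T0 + ?T1) = Lambda n F"
    unfolding Lambda_coeff[symmetric] by (rule Lambda_eq_mats_sum[OF per n, symmetric])
  finally show ?thesis .
qed

text \<open>Needed for scales of at least 1, where test functions are constant on the relevant
  domains. The norms carry the factor \<open>1 / \<epsilon>\<^sup>2\<close>, which tends to 0 for
  large scales, so nothing short of equality would do. Both sides equal \<open>C\<close> times the
  total mass \<open>(1 - CARD('a)^(-2)) / CARD('a)\<close>.\<close>

lemma Lambda_const:
  fixes F :: "'a::{finite,field} fls \<times> 'a fls \<Rightarrow> 'a fls \<Rightarrow> real"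
  assumes per: "\<And>u x r. inR r \<Longrightarrow> F u (x + r) = F u x" and n: "1 \<le> n"
    and const: "\<And>u x. u \<in> sphere1 \<Longrightarrow> x \<in> vball 1 \<Longrightarrow> F u x = C"
  shows "Lambda n F = digit_mean 1 F"
proof -
  let ?q = "real CARD('a)" and ?X = "fls_X_intpow (int n) :: 'a fls"
  let ?T0 = "\<Sum>(a, b, c, d)\<in>mats 0 n. F (a * ?X, b * ?X) (c / a)"
  let ?T1 = "\<Sum>(a, b, c, d)\<in>mats 1 n. F (b * ?X, a * ?X) (- c / a)"
  have q: "1 < ?q" by (rule card_field_gt_1)
  have card: "(\<Sum>(a, b, c, d)\<in>(mats v n :: 'a mat set). C) = (?q - 1)\<^sup>2 * ?q ^ (2 * n - 1) * (?q ^ nat (1 - v) * C)" if "v \<le> 1" for v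
    using mats_sum_beta[of v 1 "\<lambda>_. C" n] that n by (simp add: card_digits)
  have "?T0 = (\<Sum>(a, b, c, d)\<in>(mats 0 n :: 'a mat set). C)"
  proof (rule sum.cong[OF refl])
    fix M :: "'a mat" assume M: "M \<in> mats 0 n"
    obtain a b c d where Me: "M = (a, b, c, d)" by (cases M)
    have "c / a \<in> vball 1" using M by (simp add: Me mats_def)
    then show "(case M of (a, b, c, d) \<Rightarrow> F (a * ?X, b * ?X) (c / a)) = (case M of (a, b, c, d) \<Rightarrow> C)"
      using const mats_sphere1(1)[of a b c d 0 n] M by (simp add: Me)
  qed
  then have T0: "?T0 = (?q - 1)\<^sup>2 * ?q ^ (2 * n - 1) * (?q * C)" using card[of 0] by simp
  have "?T1 = (\<Sum>(a, b, c, d)\<in>(mats 1 n :: 'a mat set). C)"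
  proof (rule sum.cong[OF refl])
    fix M :: "'a mat" assume M: "M \<in> mats 1 n"
    obtain a b c d where Me: "M = (a, b, c, d)" by (cases M)
    have "- c / a \<in> vball 1" using M by (simp add: Me mats_def)
    then show "(case M of (a, b, c, d) \<Rightarrow> F (b * ?X, a * ?X) (- c / a)) = (case M of (a, b, c, d) \<Rightarrow> C)"
      unfolding Me case_prod_conv using const mats_sphere1(2)[of a b c d 1 n] M by (simp add: Me)
  qed
  then have T1: "?T1 = (?q - 1)\<^sup>2 * ?q ^ (2 * n - 1) * C" using card[of 1] by simp
  have qn: "?q ^ (2 * n + 2) = ?q ^ (2 * n - 1) * ?q ^ 3"
  proof -
    have "2 * n + 2 = 2 * n - 1 + 3" using n by simp
    then show ?thesis by (simp only: power_add[symmetric])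
  qed
  have "Lambda n F = 1 / ((?q - 1) * ?q ^ (2 * n + 2)) * (?T0 + ?T1)"
    unfolding Lambda_coeff[symmetric] by (rule Lambda_eq_mats_sum[OF per n])
  also have "\<dots> = (?q - 1) * (?q + 1) * C / ?q ^ 3"
    unfolding T0 T1 qn using q by (simp add: field_simps power2_eq_square)
  finally have L: "Lambda n F = (?q - 1) * (?q + 1) * C / ?q ^ 3" .
  have D: "w \<in> vball 0" if "w \<in> digits 0 (int 1)" for w :: "'a fls" using that by (simp add: digits_def)
  have E: "w \<in> vball 1" "w \<in> vball 0" if "w \<in> digits 1 (int 1)" for w :: "'a fls"
    using that by (auto simp: digits_def intro: vball_mono)
  have U: "unitO w" "w \<in> vball 0" if "w \<in> units 1" for w :: "'a fls"
    using that unitO_vball[of w] by (auto simp: units_def)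
  have "(\<Sum>u\<in>units 1. \<Sum>w\<in>digits 0 (int 1). \<Sum>z\<in>digits 1 (int 1). F (u, w) z)
      = (\<Sum>u\<in>(units 1 :: 'a fls set). \<Sum>w\<in>(digits 0 (int 1) :: 'a fls set). \<Sum>z\<in>(digits 1 (int 1) :: 'a fls set). C)"
    by (intro sum.cong refl const) (use U D E in \<open>auto simp: sphere1_iff\<close>)
  moreover have "(\<Sum>u\<in>units 1. \<Sum>w\<in>digits 1 (int 1). \<Sum>z\<in>digits 1 (int 1). F (w, u) z)
      = (\<Sum>u\<in>(units 1 :: 'a fls set). \<Sum>w\<in>(digits 1 (int 1) :: 'a fls set). \<Sum>z\<in>(digits 1 (int 1) :: 'a fls set). C)"
    by (intro sum.cong refl const) (use U E in \<open>auto simp: sphere1_iff\<close>)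
  moreover have "real (card (units 1 :: 'a fls set)) = ?q - 1" using card_units[of 1, where 'a='a] by simp
  ultimately have "digit_mean 1 F = ((?q - 1) * (?q * C) + (?q - 1) * C) / ?q ^ 3"
    unfolding digit_mean_split[OF order_refl] by (simp only: sum_constant) (simp add: card_digits)
  then have "digit_mean 1 F = (?q - 1) * (?q + 1) * C / ?q ^ 3" by (simp add: algebra_simps)
  then show ?thesis using L by simp
qed

lemma digit_mean_abs_le:
  fixes F :: "'a::{finite,field} fls \<times> 'a fls \<Rightarrow> 'a fls \<Rightarrow> real"
  assumes bound: "\<And>u x. u \<in> sphere1 \<Longrightarrow> x \<in> vball 1 \<Longrightarrow> \<bar>F u x\<bar> \<le> K"
  shows "\<bar>digit_mean m F\<bar> \<le> K"
proof -
  let ?q = "real CARD('a)"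
  let ?D = "digits 0 (int m) :: 'a fls set" and ?E = "digits 1 (int m) :: 'a fls set"
  have q: "1 < ?q" by (rule card_field_gt_1)
  have K0: "K \<ge> 0" using bound[of "(1, 0)" 0] by (simp add: sphere1_iff)
  let ?S = "\<Sum>x\<in>?D. \<Sum>y\<in>?D. \<Sum>z\<in>?E. if unitO x \<or> unitO y then F (x, y) z else 0"
  have "\<bar>?S - (\<Sum>x\<in>?D. \<Sum>y\<in>?D. \<Sum>z\<in>?E. 0)\<bar> \<le> real (card ?D) * (real (card ?D) * (real (card ?E) * K))"
  proof (intro abs_sum_diff_le)
    fix x y z assume "x \<in> ?D" "y \<in> ?D" "z \<in> ?E"
    then show "\<bar>(if unitO x \<or> unitO y then F (x, y) z else 0) - 0\<bar> \<le> K"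
      using bound[of "(x, y)" z] K0 by (auto simp: sphere1_iff digits_def)
  qed
  also have "\<dots> \<le> ?q ^ m * (?q ^ m * (?q ^ m * K))"
    using q K0 by (intro mult_mono) (auto simp: card_digits intro!: power_increasing)
  also have "\<dots> = ?q ^ (m + m + m) * K" by (simp only: power_add mult.assoc)
  also have "m + m + m = 3 * m" by simp
  finally have "\<bar>?S\<bar> \<le> ?q ^ (3 * m) * K" by simp
  then show ?thesis unfolding digit_mean_def using q by (simp add: field_simps)
qed

text \<open>For \<open>\<epsilon> < 1\<close> the level \<open>m\<close> is the least with
  \<open>CARD('a)^(-m) \<le> \<epsilon>\<close>. Minimality gives
  \<open>1 / \<epsilon> \<ge> CARD('a)^(m - 1)\<close>, which converts powers of
  \<open>CARD('a)^m\<close> into norms. The constant \<open>CARD('a)^3\<close> is the product of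
  \<open>CARD('a)^2\<close>, lost in this conversion, and one factor from the exponent
  \<open>5 * m + 1\<close>.\<close>

lemma Lambda_error_term:
  fixes f :: "'a::{finite,field} fls \<times> 'a fls \<Rightarrow> real" and g :: "'a fls \<Rightarrow> real"
  assumes \<epsilon>: "0 < \<epsilon>" and f: "loc_const_S \<epsilon> f" and g: "loc_const_Q \<epsilon> g" and n: "1 \<le> n"
  shows "\<bar>Lambda n (\<lambda>u x. f u * g x) - int_sphere f * int_quot g\<bar>
    \<le> 8 * real CARD('a) ^ 3 * real CARD('a) powr (- real n / 4) * lcnorm_S \<epsilon> f * lcnorm_Q \<epsilon> g"
proof -
  let ?q = "real CARD('a)" and ?F = "\<lambda>u x. f u * g x"
  have q: "1 < ?q" by (rule card_field_gt_1)
  define A where "A = (SUP v\<in>sphere1. \<bar>f v\<bar>)"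
  define B where "B = (SUP x. \<bar>g x\<bar>)"
  have fA: "\<bar>f u\<bar> \<le> A" if "u \<in> sphere1" for u
    unfolding A_def using f that by (intro cSUP_upper) (auto simp: loc_const_S_def bdd_above_def)
  have gB: "\<bar>g x\<bar> \<le> B" for x
    unfolding B_def using g by (intro cSUP_upper) (auto simp: loc_const_Q_def bdd_above_def)
  have "(1, 0) \<in> (sphere1 :: ('a fls \<times> 'a fls) set)" by (simp add: sphere1_iff)
  then have A0: "A \<ge> 0" using fA[of "(1, 0)"] by simp
  have B0: "B \<ge> 0" using gB[of 0] by simp
  have bound: "\<bar>?F u x\<bar> \<le> A * B" if "u \<in> sphere1" for u x
    unfolding abs_mult using fA[OF that] gB[of x] A0 by (intro mult_mono) auto
  have per: "?F u (x + r) = ?F u x" if "inR r" for u x r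
    using g that by (simp add: loc_const_Q_def Rperiodic_def)
  have fc: "f u = f u'" if "u \<in> sphere1" "u' \<in> sphere1" "fst u - fst u' \<in> vball k" "snd u - snd u' \<in> vball k"
    "?q powi (- k) \<le> \<epsilon>" for u u' k
  proof -
    have "knorm (fst u - fst u', snd u - snd u') \<le> \<epsilon>"
      using knorm_le_iff[of "(fst u - fst u', snd u - snd u')" k] that by simp
    then show ?thesis using f that unfolding loc_const_S_def by blast
  qed
  have gc: "g x = g x'" if "x - x' \<in> vball k" "?q powi (- k) \<le> \<epsilon>" for x x' k
  proof -
    have "kabs (x - x') \<le> \<epsilon>" using kabs_le_iff[of "x - x'" k] that by simp
    then show ?thesis using g unfolding loc_const_Q_def by blast
  qed
  have lc: "lcnorm_S \<epsilon> f * lcnorm_Q \<epsilon> g = A * B * (1 / \<epsilon>)\<^sup>2"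
    by (simp add: lcnorm_S_def lcnorm_Q_def A_def B_def power2_eq_square)
  show ?thesis
  proof (cases "1 \<le> \<epsilon>")
    case True
    have "inverse ?q \<le> 1" using q by (simp add: inverse_le_1_iff)
    then have pe: "?q powi (- 0) \<le> \<epsilon>" "?q powi (- int 1) \<le> \<epsilon>" using True by (simp_all add: power_int_minus)
    have const: "?F u x = f (1, 0) * g 0" if "u \<in> sphere1" "x \<in> vball 1" for u x
    proof -
      have "f u = f (1, 0)"
        by (rule fc[of _ _ 0]) (use that pe in \<open>auto simp: sphere1_iff intro!: vball_diff\<close>)
      moreover have "g x = g 0" by (rule gc[of _ _ "int 1"]) (use that pe in auto)
      ultimately show ?thesis by simp
    qed
    have "Lambda n ?F = digit_mean 1 ?F" by (rule Lambda_const[OF per n const])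
    moreover have "int_sphere f * int_quot g = digit_mean 1 ?F"
      by (rule int_sphere_int_quot) (auto intro: fc[OF _ _ _ _ pe(2)] gc[OF _ pe(2)])
    moreover have "0 \<le> 8 * ?q ^ 3 * ?q powr (- real n / 4) * (lcnorm_S \<epsilon> f * lcnorm_Q \<epsilon> g)"
      unfolding lc using A0 B0 by simp
    ultimately show ?thesis by (simp only: mult.assoc diff_self abs_zero)
  next
    case False
    have "\<exists>k. (1 / ?q) ^ k \<le> \<epsilon>" using real_arch_pow_inv[OF \<epsilon>, of "1 / ?q"] q by (auto intro: less_imp_le)
    define m where "m = (LEAST k. (1 / ?q) ^ k \<le> \<epsilon>)"
    have m: "(1 / ?q) ^ m \<le> \<epsilon>" unfolding m_def by (rule LeastI_ex) fact
    have m1: "1 \<le> m" using m False by (cases m) auto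
    have "\<not> (1 / ?q) ^ (m - 1) \<le> \<epsilon>" using m1 not_less_Least[of "m - 1" "\<lambda>k. (1 / ?q) ^ k \<le> \<epsilon>"] by (simp add: m_def)
    then have "\<epsilon> \<le> 1 / ?q ^ (m - 1)" by (simp add: power_one_over)
    then have "?q ^ (m - 1) \<le> 1 / \<epsilon>" using \<epsilon> q by (simp add: field_simps)
    then have "(?q ^ (m - 1))\<^sup>2 \<le> (1 / \<epsilon>)\<^sup>2" by (rule power_mono) simp
    then have big: "A * B * (?q ^ (m - 1))\<^sup>2 \<le> lcnorm_S \<epsilon> f * lcnorm_Q \<epsilon> g"
      unfolding lc using A0 B0 by (intro mult_left_mono) auto
    have pm: "?q powi (- int m) \<le> \<epsilon>" using m by (simp add: power_int_minus power_one_over inverse_eq_divide)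
    have I: "int_sphere f * int_quot g = digit_mean m ?F"
      by (rule int_sphere_int_quot[OF m1]) (auto intro: fc[OF _ _ _ _ pm] gc[OF _ pm])
    have pw: "?q ^ 3 * ?q powr (- real n / 4) * (?q ^ (m - 1))\<^sup>2 = ?q powr (2 * real m + 1 - real n / 4)"
    proof -
      have "?q ^ 3 = ?q powr 3" using q by (simp add: powr_numeral)
      moreover have "(?q ^ (m - 1))\<^sup>2 = ?q powr (2 * (real m - 1))"
        using q m1 by (simp add: powr_realpow[symmetric] powr_powr of_nat_diff flip: power_mult) (simp add: algebra_simps)
      ultimately have "?q ^ 3 * ?q powr (- real n / 4) * (?q ^ (m - 1))\<^sup>2 = ?q powr (3 + - real n / 4 + 2 * (real m - 1))"
        by (simp only: powr_add)
      also have "3 + - real n / 4 + 2 * (real m - 1) = 2 * real m + 1 - real n / 4" by simp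
      finally show ?thesis .
    qed
    have key: "\<bar>Lambda n ?F - digit_mean m ?F\<bar> \<le> 8 * (A * B) * ?q powr (2 * real m + 1 - real n / 4)"
    \<comment> \<open>In the first case \<open>5 * m + 1 - n\<close> is at most
      \<open>2 * m + 1 - n / 4\<close>. In the second the exponent \<open>2 * m + 1 - n / 4\<close>
      is positive, and the trivial bounds add up to three times \<open>A * B\<close>.\<close>
    proof (cases "8 * m \<le> n")
      case True
      have "\<bar>Lambda n ?F - digit_mean m ?F\<bar> \<le> 4 * 0 + 8 * (A * B) * ?q ^ (5 * m + 1) / ?q ^ n"
      proof (rule Lambda_near_digit_mean[OF m1 _ per bound])
        show "2 * m \<le> n" using True by simp
        fix u u' :: "'a fls \<times> 'a fls" and x x' :: "'a fls"
        assume "u \<in> sphere1" "u' \<in> sphere1" "fst u - fst u' \<in> vball (int m)" "snd u - snd u' \<in> vball (int m)"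
          "x - x' \<in> vball (int m)"
        then have "f u = f u'" "g x = g x'" using fc[OF _ _ _ _ pm] gc[OF _ pm] by blast+
        then show "\<bar>?F u x - ?F u' x'\<bar> \<le> 0" by simp
      qed
      also have "\<dots> = 8 * (A * B) * (?q ^ (5 * m + 1) / ?q ^ n)" by simp
      also have "?q ^ (5 * m + 1) / ?q ^ n = ?q powr (real (5 * m + 1) - real n)"
        using q by (simp only: powr_diff powr_realpow)
      also have "8 * (A * B) * ?q powr (real (5 * m + 1) - real n) \<le> 8 * (A * B) * ?q powr (2 * real m + 1 - real n / 4)"
        using A0 B0 q True by (intro mult_left_mono powr_mono) auto
      finally show ?thesis .
    next
      case False
      have "\<bar>Lambda n ?F\<bar> \<le> 2 * (A * B)" by (rule Lambda_abs_le[OF per n bound])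
      moreover have "\<bar>digit_mean m ?F\<bar> \<le> A * B" by (rule digit_mean_abs_le[OF bound])
      moreover have AB: "0 \<le> A * B" using A0 B0 by simp
      ultimately have "\<bar>Lambda n ?F - digit_mean m ?F\<bar> \<le> 8 * (A * B) * 1" by linarith
      also have "\<dots> \<le> 8 * (A * B) * ?q powr (2 * real m + 1 - real n / 4)"
        using AB q False by (intro mult_left_mono ge_one_powr_ge_zero) auto
      finally show ?thesis .
    qed
    also have "8 * (A * B) * ?q powr (2 * real m + 1 - real n / 4)
        = 8 * ?q ^ 3 * ?q powr (- real n / 4) * (A * B * (?q ^ (m - 1))\<^sup>2)"
      unfolding pw[symmetric] by (simp only: mult_ac)
    also have "\<dots> \<le> 8 * ?q ^ 3 * ?q powr (- real n / 4) * (lcnorm_S \<epsilon> f * lcnorm_Q \<epsilon> g)"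
      by (rule mult_left_mono[OF big]) simp
    finally show ?thesis unfolding I by (simp only: mult.assoc)
  qed
qed

theorem theorem1p1:
  fixes T :: "'a::{finite,field} itself"
  shows "(\<forall>F :: 'a fls \<times> 'a fls \<Rightarrow> 'a fls \<Rightarrow> real. cont_SQ F \<longrightarrow>
            (\<lambda>n. Lambda n F) \<longlonglongrightarrow> int_prod F)
       \<and> (\<exists>\<tau>::real. 0 < \<tau> \<and> \<tau> \<le> 1/8 \<and>
            (\<forall>\<delta>>0. \<exists>C N. \<forall>\<epsilon>>0. \<forall>(f :: 'a fls \<times> 'a fls \<Rightarrow> real) (g :: 'a fls \<Rightarrow> real).
               loc_const_S \<epsilon> f \<longrightarrow> loc_const_Q \<epsilon> g \<longrightarrow>
               (\<forall>n\<ge>N. \<bar>Lambda n (\<lambda>u x. f u * g x) - int_sphere f * int_quot g\<bar>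
                  \<le> C * real CARD('a) powr (2 * real n * (- \<tau> + \<delta>)) * lcnorm_S \<epsilon> f * lcnorm_Q \<epsilon> g)))"
proof (intro conjI)
  show "\<forall>F :: 'a fls \<times> 'a fls \<Rightarrow> 'a fls \<Rightarrow> real. cont_SQ F \<longrightarrow> (\<lambda>n. Lambda n F) \<longlonglongrightarrow> int_prod F"
    using Lambda_tendsto by blast
  let ?q = "real CARD('a)"
  have q: "1 < ?q" by (rule card_field_gt_1)
  have main: "\<bar>Lambda n (\<lambda>u x. f u * g x) - int_sphere f * int_quot g\<bar>
      \<le> 8 * ?q ^ 3 * ?q powr (2 * real n * (- (1 / 8) + \<delta>)) * lcnorm_S \<epsilon> f * lcnorm_Q \<epsilon> g"
    if "\<delta> > 0" "\<epsilon> > 0" "loc_const_S \<epsilon> f" "loc_const_Q \<epsilon> g" "n \<ge> 1"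
    for \<delta> \<epsilon> and f :: "'a fls \<times> 'a fls \<Rightarrow> real" and g :: "'a fls \<Rightarrow> real" and n
  proof -
    let ?D = "\<bar>Lambda n (\<lambda>u x. f u * g x) - int_sphere f * int_quot g\<bar>"
    let ?L = "lcnorm_S \<epsilon> f * lcnorm_Q \<epsilon> g"
    have le: "?D \<le> 8 * ?q ^ 3 * ?q powr (- real n / 4) * ?L"
      using Lambda_error_term[OF that(2-5)] by (simp only: mult.assoc)
    have "0 \<le> 8 * ?q ^ 3 * ?q powr (- real n / 4) * ?L" using le abs_ge_zero order_trans by blast
    moreover have "0 < 8 * ?q ^ 3 * ?q powr (- real n / 4)" using q by simp
    \<comment> \<open>Nonnegativity of the product of norms is read off from the error bound itself,
      whose left side is an absolute value.\<close>
    ultimately have L0: "0 \<le> ?L" by (simp only: zero_le_mult_iff) linarith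
    \<comment> \<open>With rate 1/8 the exponent \<open>2 * n / 8\<close> is exactly
      \<open>n / 4\<close>, and \<open>\<delta>\<close> only enlarges the right-hand side; hence the
      constant can be chosen independently of \<open>\<delta>\<close>.\<close>
    have "- real n / 4 \<le> 2 * real n * (- (1 / 8) + \<delta>)" using that(1) by (simp add: algebra_simps)
    then have "?q powr (- real n / 4) \<le> ?q powr (2 * real n * (- (1 / 8) + \<delta>))" using q by (intro powr_mono) auto
    then have "8 * ?q ^ 3 * ?q powr (- real n / 4) * ?L \<le> 8 * ?q ^ 3 * ?q powr (2 * real n * (- (1 / 8) + \<delta>)) * ?L"
      using L0 by (intro mult_right_mono mult_left_mono) auto
    then show ?thesis using le by (simp only: mult.assoc)
  qed
  show "\<exists>\<tau>::real. 0 < \<tau> \<and> \<tau> \<le> 1/8 \<and>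
            (\<forall>\<delta>>0. \<exists>C N. \<forall>\<epsilon>>0. \<forall>(f :: 'a fls \<times> 'a fls \<Rightarrow> real) (g :: 'a fls \<Rightarrow> real).
               loc_const_S \<epsilon> f \<longrightarrow> loc_const_Q \<epsilon> g \<longrightarrow>
               (\<forall>n\<ge>N. \<bar>Lambda n (\<lambda>u x. f u * g x) - int_sphere f * int_quot g\<bar>
                  \<le> C * ?q powr (2 * real n * (- \<tau> + \<delta>)) * lcnorm_S \<epsilon> f * lcnorm_Q \<epsilon> g))"
  proof (rule exI[of _ "1 / 8"], intro conjI allI impI)
    fix \<delta> :: real assume \<delta>: "0 < \<delta>"
    show "\<exists>C N. \<forall>\<epsilon>>0. \<forall>(f :: 'a fls \<times> 'a fls \<Rightarrow> real) (g :: 'a fls \<Rightarrow> real).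
               loc_const_S \<epsilon> f \<longrightarrow> loc_const_Q \<epsilon> g \<longrightarrow>
               (\<forall>n\<ge>N. \<bar>Lambda n (\<lambda>u x. f u * g x) - int_sphere f * int_quot g\<bar>
                  \<le> C * ?q powr (2 * real n * (- (1 / 8) + \<delta>)) * lcnorm_S \<epsilon> f * lcnorm_Q \<epsilon> g)"
      by (rule exI[of _ "8 * ?q ^ 3"], rule exI[of _ 1]) (use main[OF \<delta>] in blast)
  qed auto
qed

end
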